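(* Let $\rho>0$ and let $\Theta_\rho$ be a determinantal point process on $\mathbb{C}$ with the Mittag-Leffler kernel $$C_\rho(u,w)=\frac{\rho}{2\pi}\mathrm{E}_{2/\rho,\,2/\rho}(u\bar w)\,\mathrm{e}^{-|u|^\rho/2-|w|^\rho/2},\quad u,w\in\mathbb{C},$$ with respect to Lebesgue measure on $\mathbb{C}$. For $t\geq 0$, let $\Theta_\rho(D_t)$ denote the number of atoms of $\Theta_\rho$ inside the disk $D_t:=\{z\in\mathbb{C}:|z|<t\}$. Then, for $b>0$, $b\neq 1$, $$-\log\mathbb{P}\{\Theta_\rho(D_t)=\lfloor b(\rho/2)t^\rho\rfloor\}=\frac{\rho}{8}\big|2b^2\log b-(b-1)(3b-1)\big|t^{2\rho}+\frac{|b-1|\rho^2}{4}t^\rho\log t+O(t^\rho)$$ as $t\to\infty$.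
   Context: For $a,b>0$, $\mathrm{E}_{a,\,b}(z):=\sum_{k\geq 0}\frac{z^k}{\Gamma(ak+b)}$, $z\in\mathbb{C}$, is the Mittag-Leffler function with parameters $a$ and $b$, and $\Gamma$ is the Euler gamma function; $\bar w$ is the complex conjugate of $w$. A determinantal point process on $\mathbb{C}$ with kernel $C$ with respect to Lebesgue measure is a simple point process $\Theta$ such that, for any $k\geq 1$ and any mutually disjoint Borel subsets $B_1,\ldots,B_k$ of $\mathbb{C}$, $$\mathbb{E}\Big[\prod_{j=1}^k\Theta(B_j)\Big]=\int_{B_1\times\ldots\times B_k}\det(C(z_i,z_j))_{1\leq i,j\leq k}\,\mathrm{d}z_1\ldots\mathrm{d}z_k.$$ The case $\rho=2$ is the infinite Ginibre point process, with kernel $\pi^{-1}\mathrm{e}^{u\bar w-|u|^2/2-|w|^2/2}$. Known fact: the set of absolute values of atoms of $\Theta_\rho$ has the same distribution as $((\hat S_n)^{1/\rho})_{n\geq 1}$, where $\hat S_1,\hat S_2,\ldots$ are independent and $\hat S_n$ has the distribution of the sum of $n$ independent random variables, each having the gamma distribution with density $x\mapsto\frac{1}{\Gamma(2/\rho)}x^{2/\rho-1}\mathrm{e}^{-x}\mathbf{1}_{(0,\infty)}(x)$. In particular, $(\Theta_\rho(D_t))_{t\ge 0}$ has the same distribution as $\big(\sum_{n\geq 1}\mathbf{1}_{\{\hat S_n\leq t^\rho\}}\big)_{t\ge 0}$. *)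

theory Defs
  imports
    "HOL-Probability.Probability"
    "HOL-Library.Landau_Symbols"
    "Jordan_Normal_Form.Determinant"
begin

definition mittag_leffler :: "real \<Rightarrow> real \<Rightarrow> complex \<Rightarrow> complex" where
  "mittag_leffler a b z = (\<Sum>k. z ^ k / of_real (Gamma (a * real k + b)))"

definition mittag_leffler_kernel :: "real \<Rightarrow> complex \<Rightarrow> complex \<Rightarrow> complex" where
  "mittag_leffler_kernel \<rho> u w =
     of_real (\<rho> / (2 * pi)) * mittag_leffler (2 / \<rho>) (2 / \<rho>) (u * cnj w)
       * of_real (exp (- (cmod u powr \<rho>) / 2 - cmod w powr \<rho> / 2))"

text \<open>
  A point process is a random locally finite, integer-valued Borel measure. Measurability of all
  the counts is measurability for the usual sigma-algebra on the space of such measures, and on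
  the complex plane the relatively compact sets are the bounded ones. Atoms may be multiple here;
  simplicity is a separate condition.
\<close>

definition point_process :: "'w measure \<Rightarrow> ('w \<Rightarrow> complex measure) \<Rightarrow> bool" where
  "point_process M \<Theta> \<longleftrightarrow>
     prob_space M \<and>
     (\<forall>\<omega>\<in>space M. sets (\<Theta> \<omega>) = sets borel) \<and>
     (\<forall>B\<in>sets borel. (\<lambda>\<omega>. emeasure (\<Theta> \<omega>) B) \<in> borel_measurable M) \<and>
     (\<forall>\<omega>\<in>space M. \<forall>B\<in>sets borel. bounded B \<longrightarrow> (\<exists>n::nat. emeasure (\<Theta> \<omega>) B = of_nat n))"

definition simple_point_process :: "'w measure \<Rightarrow> ('w \<Rightarrow> complex measure) \<Rightarrow> bool" where
  "simple_point_process M \<Theta> \<longleftrightarrow>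
     point_process M \<Theta> \<and> (AE \<omega> in M. \<forall>z. emeasure (\<Theta> \<omega>) {z} \<le> 1)"

text \<open>
  The sets need not be bounded, so both sides are extended nonnegative integrals. A Hermitian
  positive semidefinite kernel, such as the Mittag-Leffler kernel, has real and nonnegative
  determinants, so that taking the real part and coercing to \<open>ennreal\<close> loses nothing.
\<close>

definition determinantal_point_process ::
    "'w measure \<Rightarrow> ('w \<Rightarrow> complex measure) \<Rightarrow> (complex \<Rightarrow> complex \<Rightarrow> complex) \<Rightarrow> bool" where
  "determinantal_point_process M \<Theta> C \<longleftrightarrow>
     simple_point_process M \<Theta> \<and>
     (\<forall>k\<ge>1. \<forall>B. (\<forall>i<k. B i \<in> sets borel) \<and> disjoint_family_on B {..<k} \<longrightarrow>
        (\<integral>\<^sup>+ \<omega>. (\<Prod>j<k. emeasure (\<Theta> \<omega>) (B j)) \<partial>M) =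
        (\<integral>\<^sup>+ z \<in> PiE {..<k} B.
            ennreal (Re (Determinant.det (mat k k (\<lambda>(i, j). C (z i) (z j)))))
          \<partial>(PiM {..<k} (\<lambda>_. lborel :: complex measure))))"

end

theory Submission
  imports Defs "HOL-Real_Asymp.Real_Asymp"
begin

text \<open>
  Put \<open>a = 2 / \<rho>\<close>, \<open>x = t powr \<rho>\<close>, and let \<open>p n\<close> be the probability that a gamma variable of shape
  \<open>a (n + 1)\<close> is at most \<open>x\<close>. The kernel restricted to the disk is the sum of \<open>\<psi> n u * cnj (\<psi> n w)\<close>
  over monomials with a radial weight, which are orthogonal with squared norms \<open>p n\<close>. Hence the
  factorial moments of the number of points are those of a sum of independent indicators with
  success probabilities \<open>p n\<close>, and these determine its law.

  For such a sum, and \<open>p\<close> decreasing, the probability of exactly \<open>m\<close> successes equals the probability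
  that the first \<open>m\<close> trials succeed and all others fail, up to a factor \<open>exp (O x)\<close>: the upper bound
  is a Chernoff bound tilted by the odds of trial \<open>m\<close>. The logarithm of that product is dominated by
  the indices with \<open>a n\<close> between \<open>x\<close> and \<open>b x\<close>, where Stirling's formula gives
  \<open>x - y + y ln (y / x) + ln x / 2\<close> with \<open>y = a n\<close>; the sum over \<open>n\<close> is then a Riemann sum.
\<close>

section \<open>Elementary symmetric sums and sums of independent indicators\<close>

text \<open>The error term \<open>O (t powr \<rho>)\<close> is of the order of the number of indices
  that matter, so every index may lose a bounded factor; this is why a crude Chernoff bound
  suffices. Near \<open>a * n = x\<close> the tail estimate loses
  \<open>ln (x / (\<bar>a * n - x\<bar> + 1))\<close>, unbounded for a single index, but still
  \<open>O x\<close> in total because \<open>V ^ J / fact J \<le> exp V\<close>. Two obstacles shape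
  the rest. The defining identity of a determinantal process sees only disjoint sets, while the
  count in a disk needs factorial moments of one set; these are recovered by refining dyadic cells,
  where simplicity rules out two points in one fine cell. And no infinite family of indicators is
  constructed: all bounds concern the first \<open>K\<close> indices, hold for all large
  \<open>K\<close>, and pass to the limit. The coefficient
  \<open>2 * b\<^sup>2 * ln b - (b - 1) * (3 * b - 1)\<close> is four times the integral of
  \<open>1 - s + s * ln s\<close> from 1 to \<open>b\<close>; the second-order term is
  \<open>ln x / 2\<close> times the number \<open>\<bar>b - 1\<bar> * x / a\<close> of indices in
  between.\<close>

definition esym :: "('a \<Rightarrow> 'b::comm_semiring_1) \<Rightarrow> 'a set \<Rightarrow> nat \<Rightarrow> 'b" where
  "esym w I k = (\<Sum>A | A \<subseteq> I \<and> card A = k. \<Prod>i\<in>A. w i)"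

text \<open>The Poisson binomial law, as an explicit finite sum, so that no probability space
  carrying independent indicators has to be built.\<close>

definition bern :: "('a \<Rightarrow> real) \<Rightarrow> 'a set \<Rightarrow> nat \<Rightarrow> real" where
  "bern p I m = (\<Sum>A | A \<subseteq> I \<and> card A = m. (\<Prod>i\<in>A. p i) * (\<Prod>i\<in>I - A. 1 - p i))"

lemma subsets_insert_card_Suc:
  assumes "finite I" "x \<notin> I"
  shows "{A. A \<subseteq> insert x I \<and> card A = Suc k} =
    {A. A \<subseteq> I \<and> card A = Suc k} \<union> insert x ` {A. A \<subseteq> I \<and> card A = k}"
    (is "?L = ?R1 \<union> insert x ` ?R2")
proof (intro equalityI subsetI)
  fix A assume A: "A \<in> ?L"
  then have "finite A" using assms finite_subset by auto
  show "A \<in> ?R1 \<union> insert x ` ?R2"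
  proof (cases "x \<in> A")
    case True
    then have "A = insert x (A - {x})" "A - {x} \<in> ?R2"
      using A \<open>finite A\<close> by auto
    then show ?thesis by blast
  qed (use A in auto)
next
  fix A assume "A \<in> ?R1 \<union> insert x ` ?R2"
  then show "A \<in> ?L"
    using assms by (auto simp: card_insert_if finite_subset)
qed

lemma sum_subsets_insert_card_Suc:
  fixes F :: "'a set \<Rightarrow> 'b::comm_monoid_add"
  assumes "finite I" "x \<notin> I"
  shows "(\<Sum>A | A \<subseteq> insert x I \<and> card A = Suc k. F A) =
    (\<Sum>A | A \<subseteq> I \<and> card A = Suc k. F A) + (\<Sum>A | A \<subseteq> I \<and> card A = k. F (insert x A))"
proof -
  have "inj_on (insert x) {A. A \<subseteq> I \<and> card A = k}"
    by (rule inj_onI) (metis (no_types, lifting) assms(2) insert_ident mem_Collect_eq subsetD)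
  moreover have "{A. A \<subseteq> I \<and> card A = Suc k} \<inter> insert x ` {A. A \<subseteq> I \<and> card A = k} = {}"
    using assms by auto
  ultimately show ?thesis
    unfolding subsets_insert_card_Suc[OF assms]
    using assms by (simp add: sum.union_disjoint sum.reindex)
qed

lemma subsets_card_0: "finite I \<Longrightarrow> {A. A \<subseteq> I \<and> card A = 0} = {{}}"
  by (auto simp: finite_subset)

lemma esym_0 [simp]: "finite I \<Longrightarrow> esym w I 0 = 1"
  by (simp only: esym_def subsets_card_0) simp

lemma esym_eq_0: "finite I \<Longrightarrow> card I < k \<Longrightarrow> esym w I k = 0"
  unfolding esym_def by (rule sum.neutral) (auto dest: card_mono)

lemma esym_insert_Suc:
  assumes "finite I" "x \<notin> I"
  shows "esym w (insert x I) (Suc k) = esym w I (Suc k) + w x * esym w I k"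
proof -
  have "(\<Prod>i\<in>insert x A. w i) = w x * (\<Prod>i\<in>A. w i)" if "A \<subseteq> I" for A
    using that assms by (subst prod.insert) (auto intro: finite_subset)
  then show ?thesis
    unfolding esym_def sum_subsets_insert_card_Suc[OF assms] by (simp add: sum_distrib_left)
qed

lemma bern_0: "finite I \<Longrightarrow> bern p I 0 = (\<Prod>i\<in>I. 1 - p i)"
  by (simp only: bern_def subsets_card_0) simp

lemma bern_insert_Suc:
  assumes "finite I" "x \<notin> I"
  shows "bern p (insert x I) (Suc m) = (1 - p x) * bern p I (Suc m) + p x * bern p I m"
proof -
  have 1: "(\<Prod>i\<in>A. p i) * (\<Prod>i\<in>insert x I - A. 1 - p i) =
      (1 - p x) * ((\<Prod>i\<in>A. p i) * (\<Prod>i\<in>I - A. 1 - p i))" if "A \<subseteq> I" for A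
  proof -
    have "insert x I - A = insert x (I - A)" using that assms by auto
    then show ?thesis using assms by simp
  qed
  have 2: "(\<Prod>i\<in>insert x A. p i) * (\<Prod>i\<in>insert x I - insert x A. 1 - p i) =
      p x * ((\<Prod>i\<in>A. p i) * (\<Prod>i\<in>I - A. 1 - p i))" if "A \<subseteq> I" for A
  proof -
    have "insert x I - insert x A = I - A" "finite A" "x \<notin> A"
      using that assms finite_subset by auto
    then show ?thesis by simp
  qed
  show ?thesis
    unfolding bern_def sum_subsets_insert_card_Suc[OF assms] sum_distrib_left
    by (intro arg_cong2[of _ _ _ _ "(+)"] sum.cong refl) (use 1 2 in blast)+
qed

text \<open>Inclusion and exclusion: \<open>fact k * esym p I k\<close> is the \<open>k\<close>-th
  factorial moment, and the alternating sum inverts the passage from probabilities to moments. The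
  cutoff \<open>K\<close> is only bounded below by \<open>card I\<close>, so the induction may use
  its hypothesis with both \<open>K\<close> and the predecessor of \<open>K\<close>, and the sum may
  later be read as a series.\<close>

lemma bern_eq_alternating_sum:
  assumes "finite I" "card I \<le> K"
  shows "bern p I m = (\<Sum>k\<le>K. (-1) ^ (k + m) * real (k choose m) * esym p I k)"
  using assms
proof (induction I arbitrary: m K rule: finite_induct)
  case empty
  have "esym p {} k = (if k = 0 then 1 else 0)" for k
    by (simp add: esym_eq_0)
  moreover have "bern p {} m = (if m = 0 then 1 else 0)"
    by (cases m) (auto simp: bern_0, auto simp: bern_def intro!: sum.neutral)
  ultimately show ?case
    by (simp add: if_distrib[of "\<lambda>x. _ * x"] sum.delta cong: if_cong)
next
  case (insert x I)
  then obtain K' where K: "K = Suc K'" "card I \<le> K'"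
    by (cases K) auto
  let ?t = "\<lambda>m k. (-1) ^ (k + m) * real (k choose m)"
  have "(\<Sum>k\<le>K. ?t m k * esym p (insert x I) k) =
     ?t m 0 + (\<Sum>k\<le>K'. ?t m (Suc k) * (esym p I (Suc k) + p x * esym p I k))"
    using insert by (simp only: K sum.atMost_Suc_shift esym_insert_Suc[OF insert(1,2)]) simp
  also have "\<dots> = (\<Sum>k\<le>K. ?t m k * esym p I k) + p x * (\<Sum>k\<le>K'. ?t m (Suc k) * esym p I k)"
    using insert(1)
    by (simp only: K sum.atMost_Suc_shift distrib_left sum.distrib sum_distrib_left) (simp add: mult_ac)
  also have "(\<Sum>k\<le>K. ?t m k * esym p I k) = bern p I m"
    using insert.IH[of K m] K by simp
  finally have eq: "(\<Sum>k\<le>K. ?t m k * esym p (insert x I) k) =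
    bern p I m + p x * (\<Sum>k\<le>K'. ?t m (Suc k) * esym p I k)" .
  show ?case
  proof (cases m)
    case 0
    have "(\<Sum>k\<le>K'. ?t m (Suc k) * esym p I k) = - bern p I m"
      unfolding insert.IH[OF K(2), of m] using 0 by (simp add: sum_negf)
    with eq show ?thesis using insert(1,2) 0 by (simp add: bern_0 algebra_simps)
  next
    case (Suc m')
    \<comment> \<open>Pascal's rule for \<open>Suc k choose Suc m'\<close>; the alternating sign
      produces the difference that \<open>bern_insert_Suc\<close> asks for.\<close>
    have "(\<Sum>k\<le>K'. ?t m (Suc k) * esym p I k) =
      (\<Sum>k\<le>K'. ?t m' k * esym p I k) - (\<Sum>k\<le>K'. ?t m k * esym p I k)"
      using Suc by (simp add: sum_subtractf[symmetric] algebra_simps)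
    also have "\<dots> = bern p I m' - bern p I m"
      by (simp only: insert.IH[OF K(2)])
    finally have S: "(\<Sum>k\<le>K'. ?t m (Suc k) * esym p I k) = bern p I m' - bern p I m" .
    show ?thesis
      unfolding eq S using bern_insert_Suc[OF insert(1,2), of p m'] Suc by (simp add: algebra_simps)
  qed
qed

text \<open>Group the injective index maps by their image: each \<open>k\<close>-element set is the
  image of exactly \<open>fact k\<close> of them.\<close>

lemma sum_inj_PiE_eq_esym:
  fixes w :: "'a \<Rightarrow> 'b::comm_semiring_1"
  assumes "finite I"
  shows "(\<Sum>c | c \<in> PiE {..<k} (\<lambda>_. I) \<and> inj_on c {..<k}. \<Prod>j<k. w (c j)) = of_nat (fact k) * esym w I k"
proof -
  let ?S = "{c. c \<in> PiE {..<k} (\<lambda>_. I) \<and> inj_on c {..<k}}"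
  let ?T = "{A. A \<subseteq> I \<and> card A = k}"
  have fin: "finite ?S" "finite ?T"
    using assms by (auto intro: finite_subset[OF _ finite_PiE[of "{..<k}" "\<lambda>_. I"]])
  have "(\<Sum>c\<in>?S. \<Prod>j<k. w (c j)) = (\<Sum>A\<in>?T. \<Sum>c | c \<in> ?S \<and> c ` {..<k} = A. \<Prod>j<k. w (c j))"
    using fin by (subst sum.group) (auto simp: card_image PiE_def Pi_def)
  also have "\<dots> = (\<Sum>A\<in>?T. of_nat (fact k) * (\<Prod>i\<in>A. w i))"
  proof (rule sum.cong[OF refl])
    fix A assume A: "A \<in> ?T"
    then have finA: "finite A" using assms finite_subset by auto
    have eq: "{c. c \<in> ?S \<and> c ` {..<k} = A} = {c \<in> {..<k} \<rightarrow>\<^sub>E A. inj_on c {..<k}}"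
    proof (intro equalityI subsetI)
      fix c assume "c \<in> {c \<in> {..<k} \<rightarrow>\<^sub>E A. inj_on c {..<k}}"
      moreover then have "c ` {..<k} = A"
        using A finA by (intro card_subset_eq) (auto simp: card_image)
      ultimately show "c \<in> {c. c \<in> ?S \<and> c ` {..<k} = A}" using A by (auto simp: PiE_def Pi_def)
    qed (auto simp: PiE_def Pi_def)
    have "card {c \<in> {..<k} \<rightarrow>\<^sub>E A. inj_on c {..<k}} = fact k"
      using A finA by (subst card_inj_on_subset_funcset) (auto simp: fact_prod_rev)
    moreover have "\<And>c. inj_on c {..<k} \<Longrightarrow> c ` {..<k} = A \<Longrightarrow> (\<Prod>j<k. w (c j)) = (\<Prod>i\<in>A. w i)"
      by (metis prod.reindex_cong)
    then have "(\<Sum>c | c \<in> ?S \<and> c ` {..<k} = A. \<Prod>j<k. w (c j)) =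
        (\<Sum>c | c \<in> ?S \<and> c ` {..<k} = A. \<Prod>i\<in>A. w i)"
      by (intro sum.cong) auto
    ultimately show "(\<Sum>c | c \<in> ?S \<and> c ` {..<k} = A. \<Prod>j<k. w (c j)) = of_nat (fact k) * (\<Prod>i\<in>A. w i)"
      unfolding eq by simp
  qed
  finally show ?thesis by (simp add: esym_def sum_distrib_left)
qed

lemma esym_nonneg: "(\<And>i. i \<in> I \<Longrightarrow> 0 \<le> w i) \<Longrightarrow> 0 \<le> (esym w I k :: real)"
  unfolding esym_def by (intro sum_nonneg prod_nonneg) auto

lemma esym_mono_set:
  assumes "finite J" "I \<subseteq> J" "\<And>i. i \<in> J \<Longrightarrow> 0 \<le> w i"
  shows "esym w I k \<le> (esym w J k :: real)"
  unfolding esym_def using assms by (intro sum_mono2 prod_nonneg) auto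

text \<open>Dropping injectivity in \<open>sum_inj_PiE_eq_esym\<close> leaves an expanded
  \<open>k\<close>-th power. The \<open>fact k\<close> in the denominator later justifies
  interchanging limits and series.\<close>

lemma esym_le_power:
  assumes "finite I" "\<And>i. i \<in> I \<Longrightarrow> 0 \<le> w i"
  shows "esym w I k \<le> (\<Sum>i\<in>I. w i) ^ k / (fact k :: real)"
proof -
  have "fact k * esym w I k \<le> (\<Sum>c\<in>PiE {..<k} (\<lambda>_. I). \<Prod>j<k. w (c j))"
    unfolding sum_inj_PiE_eq_esym[OF assms(1), where k = k and w = w, unfolded of_nat_fact, symmetric]
    using assms by (intro sum_mono2 prod_nonneg finite_PiE) (auto simp: PiE_def Pi_def)
  also have "\<dots> = (\<Sum>i\<in>I. w i) ^ k"
    using prod_sum_PiE[of "{..<k}" "\<lambda>_. I" "\<lambda>_. w"] assms by simp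
  finally show ?thesis by (simp add: field_simps)
qed

text \<open>Vandermonde's identity cut down to the selections that take at most one of the
  \<open>n\<close> added elements.\<close>

lemma choose_add_ge: "(N choose Suc k) + n * (N choose k) \<le> (N + n) choose Suc k"
proof (induction n)
  case (Suc n)
  have "N choose k \<le> (N + n) choose k" by (simp add: binomial_right_mono)
  then show ?case using Suc by simp
qed simp

text \<open>With \<open>n i\<close> points in cell \<open>i\<close>, the left side counts the
  \<open>k\<close>-sets of points with no two in one cell, the right side all \<open>k\<close>-sets.
  They agree when no cell holds two points, which is \<open>esym_nat_eq_choose\<close>.\<close>

lemma esym_nat_le_choose:
  fixes n :: "'a \<Rightarrow> nat"
  assumes "finite I"
  shows "esym n I k \<le> (\<Sum>i\<in>I. n i) choose k"
  using assms
proof (induction I arbitrary: k rule: finite_induct)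
  case empty then show ?case by (cases k) (auto simp: esym_eq_0)
next
  case (insert x I)
  show ?case
  proof (cases k)
    case (Suc k')
    then have "esym n (insert x I) k \<le> ((\<Sum>i\<in>I. n i) choose Suc k') + n x * ((\<Sum>i\<in>I. n i) choose k')"
      using insert by (simp add: esym_insert_Suc add_mono)
    also have "\<dots> \<le> ((\<Sum>i\<in>I. n i) + n x) choose Suc k'" by (rule choose_add_ge)
    finally show ?thesis using insert Suc by (simp add: add.commute)
  qed (use insert in simp)
qed

lemma esym_nat_eq_choose:
  fixes n :: "'a \<Rightarrow> nat"
  assumes "finite I" "\<And>i. i \<in> I \<Longrightarrow> n i \<le> 1"
  shows "esym n I k = (\<Sum>i\<in>I. n i) choose k"
  using assms
proof (induction I arbitrary: k rule: finite_induct)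
  case empty then show ?case by (cases k) (auto simp: esym_eq_0)
next
  case (insert x I)
  have "n x = 0 \<or> n x = 1" using insert.prems[of x] by auto
  then show ?case using insert by (cases k) (auto simp: esym_insert_Suc)
qed

text \<open>The inversion formula for a deterministic count: \<open>N\<close> indicators that
  succeed with probability 1 have binomial coefficients as elementary symmetric sums and exactly
  \<open>N\<close> successes.\<close>

lemma sum_alternating_choose_choose:
  "(\<Sum>k\<le>N. (-1) ^ (k + m) * real (k choose m) * real (N choose k)) = (if N = m then 1 else 0)"
proof -
  have "esym (\<lambda>_. 1) {..<N} k = real (N choose k)" for k
    using n_subsets[of "{..<N}" k] by (simp add: esym_def)
  moreover have "bern (\<lambda>_. 1) {..<N} m = (if N = m then 1 else 0)"
  proof -
    have "(\<Prod>i\<in>{..<N} - A. 1 - 1 :: real) = (if A = {..<N} then 1 else 0)" if "A \<subseteq> {..<N}" for A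
      using that by auto
    then have "bern (\<lambda>_. 1) {..<N} m =
        (\<Sum>A | A \<subseteq> {..<N} \<and> card A = m. if A = {..<N} then 1 else 0)"
      unfolding bern_def by (intro sum.cong) auto
    then show ?thesis by (simp add: sum.delta)
  qed
  ultimately show ?thesis
    using bern_eq_alternating_sum[of "{..<N}" N "\<lambda>_. 1" m] by simp
qed

section \<open>Two-sided bounds for the probability of exactly \<open>m\<close> successes\<close>

lemma bern_ge:
  fixes p :: "nat \<Rightarrow> real"
  assumes "\<And>n. 0 \<le> p n" "\<And>n. p n \<le> 1" "m \<le> K"
  shows "(\<Prod>n<m. p n) * (\<Prod>n=m..<K. 1 - p n) \<le> bern p {..<K} m"
proof -
  have "{..<K} - {..<m} = {m..<K}" by auto
  then have "(\<Prod>n<m. p n) * (\<Prod>n=m..<K. 1 - p n) =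
      (\<Sum>A\<in>{{..<m}}. (\<Prod>i\<in>A. p i) * (\<Prod>i\<in>{..<K} - A. 1 - p i))" by simp
  also have "\<dots> \<le> bern p {..<K} m"
    unfolding bern_def using assms
    by (intro sum_mono2 mult_nonneg_nonneg prod_nonneg) auto
  finally show ?thesis .
qed

text \<open>The Chernoff bound in coefficient form: the left side is one term of the generating
  function on the right, all of whose terms are nonnegative.\<close>

lemma bern_mult_power_le:
  assumes "finite I" "\<And>i. i \<in> I \<Longrightarrow> 0 \<le> p i" "\<And>i. i \<in> I \<Longrightarrow> p i \<le> 1" "0 \<le> z"
  shows "bern p I m * z ^ m \<le> (\<Prod>i\<in>I. z * p i + (1 - p i))"
proof -
  have "bern p I m * z ^ m =
      (\<Sum>A | A \<subseteq> I \<and> card A = m. (\<Prod>i\<in>A. z * p i) * (\<Prod>i\<in>I - A. 1 - p i))"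
    unfolding bern_def sum_distrib_right
    by (rule sum.cong) (auto simp: prod.distrib)
  also have "\<dots> \<le> (\<Sum>A\<in>Pow I. (\<Prod>i\<in>A. z * p i) * (\<Prod>i\<in>I - A. 1 - p i))"
    using assms by (intro sum_mono2 mult_nonneg_nonneg prod_nonneg) auto
  finally show ?thesis using prod_add[OF assms(1)] by metis
qed

text \<open>Tilting by the odds of the last index below \<open>m\<close> makes all indices below \<open>m\<close> contribute
  a factor at most 2 each.\<close>

lemma bern_le:
  fixes p :: "nat \<Rightarrow> real"
  assumes p0: "\<And>n. 0 < p n" and p1: "\<And>n. p n < 1" and dec: "\<And>n n'. n \<le> n' \<Longrightarrow> p n' \<le> p n"
    and m: "0 < m" "m \<le> K" and S: "(\<Sum>n=m..<K. p n / p (m - 1)) \<le> S"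
  shows "bern p {..<K} m \<le> 2 ^ m * exp S * ((\<Prod>n<m. p n) * (\<Prod>n=m..<K. 1 - p n))"
proof -
  define z where "z = (1 - p (m - 1)) / p (m - 1)"
  have z: "0 < z" using p0 p1 by (simp add: z_def)
  have low: "z * p n + (1 - p n) \<le> 2 * z * p n" if "n < m" for n
  proof -
    have "1 / p n \<le> 1 / p (m - 1)"
      using dec[of n "m - 1"] that p0 by (intro frac_le) auto
    then have "(1 - p n) / p n \<le> z" using p0[of n] p0[of "m-1"] by (simp add: z_def diff_divide_distrib)
    then show ?thesis using p0[of n] by (simp add: field_simps)
  qed
  \<comment> \<open>From \<open>m\<close> on the tilted odds \<open>z * p n / (1 - p n)\<close> are
    at most \<open>p n / p (m - 1)\<close>, because \<open>1 - p n\<close> is at least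
    \<open>1 - p (m - 1)\<close>; these ratios are what \<open>S\<close> bounds in total.\<close>
  have high: "z * p n + (1 - p n) \<le> (1 - p n) * exp (p n / p (m - 1))" if "m \<le> n" for n
  proof -
    have "(1 - p (m - 1)) * p n \<le> (1 - p n) * p n"
      using dec[of "m - 1" n] that p0[of n] by (intro mult_right_mono) auto
    then have "z * p n \<le> (1 - p n) * (p n / p (m - 1))"
      using p0[of "m-1"] by (simp add: z_def divide_right_mono)
    then have "z * p n + (1 - p n) \<le> (1 - p n) * (1 + p n / p (m - 1))"
      by (simp add: algebra_simps)
    also have "\<dots> \<le> (1 - p n) * exp (p n / p (m - 1))"
      using p1[of n] by (intro mult_left_mono exp_ge_add_one_self) auto
    finally show ?thesis .
  qed
  have nn: "0 \<le> z * p n + (1 - p n)" for n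
    using z p0[of n] p1[of n] by (intro add_nonneg_nonneg mult_nonneg_nonneg) auto
  have "{..<K} = {..<m} \<union> {m..<K}" "{..<m} \<inter> {m..<K} = {}" using m by auto
  then have "(\<Prod>n<K. z * p n + (1 - p n)) =
      (\<Prod>n<m. z * p n + (1 - p n)) * (\<Prod>n=m..<K. z * p n + (1 - p n))"
    by (simp add: prod.union_disjoint)
  also have "\<dots> \<le> (\<Prod>n<m. 2 * z * p n) * (\<Prod>n=m..<K. (1 - p n) * exp (p n / p (m - 1)))"
    by (intro mult_mono prod_mono prod_nonneg conjI nn low high) (use z p0 p1 in \<open>auto simp: less_imp_le intro!: mult_nonneg_nonneg\<close>)
  also have "\<dots> = (2 * z) ^ m * (\<Prod>n<m. p n) * ((\<Prod>n=m..<K. 1 - p n) * exp (\<Sum>n=m..<K. p n / p (m - 1)))"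
    by (simp add: prod.distrib exp_sum)
  also have "\<dots> \<le> (2 * z) ^ m * (\<Prod>n<m. p n) * ((\<Prod>n=m..<K. 1 - p n) * exp S)"
    using S z less_imp_le[OF p0] less_imp_le[OF p1]
    by (intro mult_left_mono mult_nonneg_nonneg prod_nonneg) auto
  finally have prod_le: "(\<Prod>n<K. z * p n + (1 - p n)) \<le>
      (2 * z) ^ m * (\<Prod>n<m. p n) * ((\<Prod>n=m..<K. 1 - p n) * exp S)" .
  have "bern p {..<K} m * z ^ m \<le> (\<Prod>n<K. z * p n + (1 - p n))"
    using z p0 p1 by (intro bern_mult_power_le) (auto simp: less_imp_le)
  also note prod_le
  also have "(2 * z) ^ m * (\<Prod>n<m. p n) * ((\<Prod>n=m..<K. 1 - p n) * exp S) =
      (2 ^ m * exp S * ((\<Prod>n<m. p n) * (\<Prod>n=m..<K. 1 - p n))) * z ^ m"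
    by (simp add: power_mult_distrib mult_ac)
  finally have "bern p {..<K} m * z ^ m \<le>
      (2 ^ m * exp S * ((\<Prod>n<m. p n) * (\<Prod>n=m..<K. 1 - p n))) * z ^ m" .
  then show ?thesis by (rule mult_right_le_imp_le) (use z in simp)
qed

section \<open>Incomplete gamma integrals\<close>

definition gamma_lower :: "real \<Rightarrow> real \<Rightarrow> real" where
  "gamma_lower y x = (\<integral>u. indicator {0..x} u * (u powr (y - 1) * exp (- u)) \<partial>lborel)"

definition gamma_upper :: "real \<Rightarrow> real \<Rightarrow> real" where
  "gamma_upper y x = (\<integral>u. indicator {x<..} u * (u powr (y - 1) * exp (- u)) \<partial>lborel)"

definition gamma_cdf :: "real \<Rightarrow> real \<Rightarrow> real" where
  "gamma_cdf y x = gamma_lower y x / Gamma y"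

lemma has_bochner_integral_Gamma:
  assumes "0 < y"
  shows "has_bochner_integral lborel (\<lambda>u::real. indicator {0..} u * (u powr (y - 1) * exp (- u))) (Gamma y)"
proof -
  have "(\<integral>\<^sup>+u. ennreal (indicator {0..} u * ((u::real) powr (y - 1) * exp (- u))) \<partial>lborel) = ennreal (Gamma y)"
    unfolding Gamma_conv_nn_integral_real[OF assms] by (simp add: exp_minus field_simps)
  moreover have "0 \<le> Gamma y" using assms by (simp add: Gamma_real_pos less_imp_le)
  ultimately show ?thesis
    by (intro has_bochner_integral_nn_integral) auto
qed

lemma integrable_Gamma_part:
  assumes "0 < y" "S \<subseteq> {0..}" "S \<in> sets borel"
  shows "integrable lborel (\<lambda>u. indicator S u * (u powr (y - 1) * exp (- u)) :: real)"
  by (rule Bochner_Integration.integrable_bound[OF integrable.intros[OF has_bochner_integral_Gamma[OF assms(1)]]])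
     (use assms in \<open>auto simp: indicator_def\<close>)

lemma gamma_lower_plus_upper:
  assumes "0 < y" "0 \<le> x"
  shows "gamma_lower y x + gamma_upper y x = Gamma y"
proof -
  have "gamma_lower y x + gamma_upper y x =
    (\<integral>u. indicator {0..x} u * (u powr (y - 1) * exp (- u)) + indicator {x<..} u * (u powr (y - 1) * exp (- u)) \<partial>lborel)"
    unfolding gamma_lower_def gamma_upper_def using assms
    by (intro Bochner_Integration.integral_add[symmetric] integrable_Gamma_part) auto
  also have "\<dots> = (\<integral>u. indicator {0..} u * (u powr (y - 1) * exp (- u)) \<partial>lborel)"
    using assms by (intro Bochner_Integration.integral_cong) (auto simp: indicator_def)
  also have "\<dots> = Gamma y"
    using has_bochner_integral_Gamma[OF assms(1)] by (rule has_bochner_integral_integral_eq)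
  finally show ?thesis .
qed

text \<open>The direct lower bounds for incomplete gamma integrals below all come from one rectangle
  under the integrand. Only its position and width vary, the width being \<open>sqrt x\<close> where
  the order of magnitude must be exact.\<close>

lemma integral_part_ge_rectangle:
  fixes y l r :: real
  assumes "0 < y" "S \<subseteq> {0..}" "S \<in> sets borel" "{l<..r} \<subseteq> S" "l \<le> r"
    and h: "\<And>u. l < u \<Longrightarrow> u \<le> r \<Longrightarrow> h \<le> u powr (y - 1) * exp (- u)"
  shows "(r - l) * h \<le> (\<integral>u. indicator S u * (u powr (y - 1) * exp (- u)) \<partial>lborel)"
proof -
  have "(r - l) * h = (\<integral>u. indicator {l<..r} u * h \<partial>lborel)"
    by (subst integral_mult_left_zero) (use assms(5) in simp)
  also have "\<dots> \<le> (\<integral>u. indicator S u * (u powr (y - 1) * exp (- u)) \<partial>lborel)"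
    using assms(4,5)
    by (intro integral_mono integrable_Gamma_part integrable_mult_left integrable_real_indicator assms)
       (auto simp: indicator_def intro!: h)
  finally show ?thesis .
qed

lemma min_powr_le:
  fixes u :: real
  assumes "0 < l" "l \<le> u" "u \<le> r"
  shows "min (l powr e) (r powr e) \<le> u powr e"
proof (cases "0 \<le> e")
  case True
  then have "l powr e \<le> u powr e" using assms by (intro powr_mono2) auto
  then show ?thesis by simp
next
  case False
  then have "r powr e \<le> u powr e" using assms by (intro powr_mono2') auto
  then show ?thesis by simp
qed

lemma gamma_lower_pos:
  assumes "0 < y" "0 < x"
  shows "0 < gamma_lower y x"
proof -
  define h where "h = min ((x / 2) powr (y - 1)) (x powr (y - 1)) * exp (- x)"
  have "(x - x / 2) * h \<le> gamma_lower y x"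
    unfolding gamma_lower_def
  proof (rule integral_part_ge_rectangle[OF assms(1)])
    fix u assume u: "x / 2 < u" "u \<le> x"
    have "min ((x / 2) powr (y - 1)) (x powr (y - 1)) \<le> u powr (y - 1)"
      using u assms by (intro min_powr_le) auto
    then show "h \<le> u powr (y - 1) * exp (- u)"
      unfolding h_def using u by (intro mult_mono) auto
  qed (use assms in auto)
  moreover have "0 < (x - x / 2) * h" using assms by (simp add: h_def)
  ultimately show ?thesis by linarith
qed

lemma gamma_upper_pos:
  assumes "0 < y" "0 < x"
  shows "0 < gamma_upper y x"
proof -
  define h where "h = min (x powr (y - 1)) ((x + 1) powr (y - 1)) * exp (- (x + 1))"
  have "((x + 1) - x) * h \<le> gamma_upper y x"
    unfolding gamma_upper_def
  proof (rule integral_part_ge_rectangle[OF assms(1)])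
    fix u assume u: "x < u" "u \<le> x + 1"
    have "min (x powr (y - 1)) ((x + 1) powr (y - 1)) \<le> u powr (y - 1)"
      using u assms by (intro min_powr_le) auto
    then show "h \<le> u powr (y - 1) * exp (- u)"
      unfolding h_def using u by (intro mult_mono) auto
  qed (use assms in auto)
  moreover have "0 < h" using assms by (simp add: h_def)
  ultimately show ?thesis by simp
qed

lemma one_minus_gamma_cdf:
  assumes "0 < y" "0 \<le> x"
  shows "1 - gamma_cdf y x = gamma_upper y x / Gamma y"
  using gamma_lower_plus_upper[OF assms] Gamma_real_pos[OF assms(1)]
  by (simp add: gamma_cdf_def field_simps)

lemma gamma_cdf_pos: "0 < y \<Longrightarrow> 0 < x \<Longrightarrow> 0 < gamma_cdf y x"
  by (simp add: gamma_cdf_def gamma_lower_pos Gamma_real_pos)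

lemma gamma_cdf_less_1:
  assumes "0 < y" "0 < x"
  shows "gamma_cdf y x < 1"
proof -
  have "0 < 1 - gamma_cdf y x"
    using assms by (subst one_minus_gamma_cdf) (auto simp: gamma_upper_pos Gamma_real_pos)
  then show ?thesis by simp
qed

section \<open>Dependence of the gamma distribution function on its shape\<close>

lemma gamma_lower_add_le:
  assumes "0 < y" "0 \<le> h" "0 < x"
  shows "gamma_lower (y + h) x \<le> x powr h * gamma_lower y x"
proof -
  have "u powr (y + h - 1) \<le> x powr h * u powr (y - 1)" if "0 \<le> u" "u \<le> x" for u
  proof -
    have "u powr (y + h - 1) = u powr h * u powr (y - 1)"
      by (simp add: powr_add[symmetric] algebra_simps)
    also have "\<dots> \<le> x powr h * u powr (y - 1)"
      using that assms by (intro mult_right_mono powr_mono2) auto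
    finally show ?thesis .
  qed
  then have "gamma_lower (y + h) x \<le>
      (\<integral>u. x powr h * (indicator {0..x} u * (u powr (y - 1) * exp (- u))) \<partial>lborel)"
    unfolding gamma_lower_def using assms
    by (intro integral_mono integrable_Gamma_part integrable_mult_right) (auto simp: indicator_def)
  then show ?thesis by (simp add: gamma_lower_def)
qed

lemma gamma_upper_add_ge:
  assumes "0 < y" "0 \<le> h" "0 < x"
  shows "x powr h * gamma_upper y x \<le> gamma_upper (y + h) x"
proof -
  have "x powr h * u powr (y - 1) \<le> u powr (y + h - 1)" if "x < u" for u
  proof -
    have "x powr h * u powr (y - 1) \<le> u powr h * u powr (y - 1)"
      using that assms by (intro mult_right_mono powr_mono2) auto
    also have "\<dots> = u powr (y + h - 1)"
      by (simp add: powr_add[symmetric] algebra_simps)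
    finally show ?thesis .
  qed
  then have "(\<integral>u. x powr h * (indicator {x<..} u * (u powr (y - 1) * exp (- u))) \<partial>lborel) \<le> gamma_upper (y + h) x"
    unfolding gamma_upper_def using assms
    by (intro integral_mono integrable_Gamma_part integrable_mult_right) (auto simp: indicator_def)
  then show ?thesis by (simp add: gamma_upper_def)
qed

text \<open>Raising the shape by \<open>h\<close> multiplies the integrand by
  \<open>u powr h\<close>, which is at most \<open>x powr h\<close> below the cut and at least that
  above it. So the lower part loses weight against the upper part; cross multiplication makes the
  comparison.\<close>

lemma gamma_cdf_antimono:
  assumes "0 < y" "y \<le> y'" "0 < x"
  shows "gamma_cdf y' x \<le> gamma_cdf y x"
proof -
  define h where "h = y' - y"
  have h: "y' = y + h" "0 \<le> h" using assms by (auto simp: h_def)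
  let ?A = "gamma_lower y x" let ?B = "gamma_upper y x"
  let ?A' = "gamma_lower y' x" let ?B' = "gamma_upper y' x"
  have pos: "0 < ?A" "0 < ?B" "0 < ?A'" "0 < ?B'"
    using assms by (auto intro: gamma_lower_pos gamma_upper_pos)
  have "?A' * ?B \<le> (x powr h * ?A) * ?B"
    using gamma_lower_add_le[OF assms(1) h(2) assms(3)] pos h(1) by (intro mult_right_mono) auto
  also have "\<dots> = ?A * (x powr h * ?B)" by simp
  also have "\<dots> \<le> ?A * ?B'"
    using gamma_upper_add_ge[OF assms(1) h(2) assms(3)] pos h(1) by (intro mult_left_mono) auto
  finally have "?A' * ?B \<le> ?A * ?B'" .
  then have "?A' / (?A' + ?B') \<le> ?A / (?A + ?B)"
    using pos by (simp add: frac_le_eq divide_simps algebra_simps)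
  then show ?thesis
    using gamma_lower_plus_upper[of y x] gamma_lower_plus_upper[of y' x] assms by (simp add: gamma_cdf_def)
qed

lemma gamma_cdf_plus1_le:
  assumes "0 < y" "0 < x"
  shows "gamma_cdf (y + 1) x \<le> (x / y) * gamma_cdf y x"
proof -
  define G where "G = Gamma y"
  have "y \<notin> \<int>\<^sub>\<le>\<^sub>0" using assms by auto
  then have "Gamma (y + 1) = y * G" unfolding G_def by (rule Gamma_plus1)
  moreover have "0 < G" using assms by (simp add: G_def Gamma_real_pos)
  moreover have "gamma_lower (y + 1) x \<le> x * gamma_lower y x"
    using gamma_lower_add_le[of y 1 x] assms by simp
  ultimately show ?thesis
    using assms by (simp add: gamma_cdf_def G_def[symmetric] divide_right_mono)
qed

text \<open>Where \<open>2 * x \<le> y\<close>, each unit step in the shape at least halves the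
  value by \<open>gamma_cdf_plus1_le\<close>; the factor 2 pays for rounding \<open>s\<close> down
  to an integer.\<close>

lemma gamma_cdf_geometric:
  assumes "0 < x" "2 * x \<le> y" "0 \<le> s"
  shows "gamma_cdf (y + s) x \<le> 2 * 2 powr (- s) * gamma_cdf y x"
proof -
  have y: "0 < y" using assms by simp
  have nat: "gamma_cdf (y + real k) x \<le> (1 / 2) ^ k * gamma_cdf y x" for k
  proof (induction k)
    case (Suc k)
    have "gamma_cdf (y + real k + 1) x \<le> (x / (y + real k)) * gamma_cdf (y + real k) x"
      using y assms by (intro gamma_cdf_plus1_le) auto
    also have "\<dots> \<le> (1 / 2) * gamma_cdf (y + real k) x"
      using y assms by (intro mult_right_mono less_imp_le[OF gamma_cdf_pos]) (auto simp: field_simps)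
    also have "\<dots> \<le> (1 / 2) ^ Suc k * gamma_cdf y x" using Suc by simp
    finally show ?case by (simp add: add_ac)
  qed simp
  define k where "k = nat \<lfloor>s\<rfloor>"
  have k: "real k \<le> s" "s \<le> real k + 1" unfolding k_def using assms by linarith+
  have "gamma_cdf (y + s) x \<le> gamma_cdf (y + real k) x"
    using k y assms by (intro gamma_cdf_antimono) auto
  also have "\<dots> \<le> (1 / 2) ^ k * gamma_cdf y x" by (rule nat)
  also have "\<dots> \<le> 2 * 2 powr (- s) * gamma_cdf y x"
  proof (rule mult_right_mono)
    have "(1 / 2 :: real) ^ k = 2 powr (- real k)" by (simp add: powr_minus powr_realpow power_one_over field_simps)
    also have "\<dots> \<le> 2 powr (1 - s)" using k by (intro powr_mono) auto
    also have "\<dots> = 2 * 2 powr (- s)" by (simp add: powr_diff powr_minus field_simps)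
    finally show "(1 / 2 :: real) ^ k \<le> 2 * 2 powr (- s)" .
  qed (use y assms gamma_cdf_pos less_imp_le in blast)
  finally show ?thesis .
qed

text \<open>The exponent \<open>(y - 1) * ln u - u\<close> is concave, hence below its tangent at
  \<open>u = x\<close>, whose slope is \<open>- k\<close>. Integrating the exponential of the
  tangent gives the factor \<open>1 / k\<close>, the source of the later distance term
  \<open>x / (\<bar>y - x\<bar> + 1)\<close>.\<close>

lemma gamma_upper_le:
  assumes "1 \<le> y" "y \<le> x"
  shows "gamma_upper y x \<le> x powr (y - 1) * exp (- x) * (x / (x - y + 1))"
proof -
  define A where "A = x powr (y - 1) * exp (- x)"
  define k where "k = (x - y + 1) / x"
  have x: "0 < x" using assms by simp
  have k: "0 < k" using assms by (simp add: k_def)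
  have A: "0 < A" using x by (simp add: A_def)
  have bound: "u powr (y - 1) * exp (- u) \<le> A * exp (- (k * (u - x)))" if "x \<le> u" for u
  proof -
    have "(y - 1) * (ln u - ln x) \<le> (y - 1) * (u / x - 1)"
      using ln_le_minus_one[of "u / x"] assms that x
      by (intro mult_left_mono) (auto simp: ln_div)
    also have "\<dots> = (u - x) - k * (u - x)" using x by (simp add: k_def field_simps)
    finally have "(y - 1) * ln u - u \<le> (y - 1) * ln x - x - k * (u - x)" by (simp add: algebra_simps)
    then have "exp ((y - 1) * ln u - u) \<le> exp ((y - 1) * ln x - x - k * (u - x))" by simp
    then show ?thesis using that x
      by (simp add: A_def powr_def exp_diff exp_minus divide_inverse)
  qed
  have "ennreal (gamma_upper y x) \<le>
      (\<integral>\<^sup>+u. ennreal (A * exp (- (k * (u - x)))) * indicator {x..} u \<partial>lborel)"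
  proof -
    have "ennreal (gamma_upper y x) =
        (\<integral>\<^sup>+u. ennreal (indicator {x<..} u * (u powr (y - 1) * exp (- u))) \<partial>lborel)"
      unfolding gamma_upper_def using assms
      by (intro nn_integral_eq_integral[symmetric] integrable_Gamma_part) auto
    also have "\<dots> \<le> (\<integral>\<^sup>+u. ennreal (A * exp (- (k * (u - x)))) * indicator {x..} u \<partial>lborel)"
      by (intro nn_integral_mono) (auto simp: indicator_def intro!: ennreal_leI bound)
    finally show ?thesis .
  qed
  also have "\<dots> = ennreal (0 - (- A / k * exp (- (k * (x - x)))))"
  proof (rule nn_integral_FTC_atLeast[where F = "\<lambda>u. - A / k * exp (- (k * (u - x)))"])
    show "DERIV (\<lambda>u. - A / k * exp (- (k * (u - x)))) u :> A * exp (- (k * (u - x)))" for u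
      using k by (auto intro!: derivative_eq_intros)
    show "((\<lambda>u. - A / k * exp (- (k * (u - x)))) \<longlongrightarrow> 0) at_top"
      using k by real_asymp
  qed (use A in auto)
  finally have "gamma_upper y x \<le> A / k" using A k by simp
  then show ?thesis by (simp add: A_def k_def)
qed

text \<open>Here the tangent at \<open>u = x\<close> has slope \<open>(y - x - 1) / x\<close>, which
  is not positive when \<open>y\<close> is close to \<open>x\<close>. Enlarging it by
  \<open>2 / x\<close> makes \<open>k\<close> positive and costs at most 2 in the exponent, since
  \<open>0 \<le> u\<close>; this is the factor \<open>exp 2\<close>.\<close>

lemma gamma_lower_le:
  assumes "1 \<le> y" "x \<le> y" "0 < x"
  shows "gamma_lower y x \<le> exp 2 * x powr (y - 1) * exp (- x) * (x / (y - x + 1))"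
proof -
  define A where "A = exp 2 * x powr (y - 1) * exp (- x)"
  define k where "k = (y - x + 1) / x"
  have k: "0 < k" using assms by (simp add: k_def)
  have A: "0 < A" using assms by (simp add: A_def)
  have bound: "u powr (y - 1) * exp (- u) \<le> A * exp (- (k * (x - u)))" if "0 \<le> u" "u \<le> x" for u
  proof (cases "u = 0")
    case False
    have "(y - 1) * (ln u - ln x) \<le> (y - 1) * (u / x - 1)"
      using ln_le_minus_one[of "u / x"] assms that False
      by (intro mult_left_mono) (auto simp: ln_div)
    also have "\<dots> = (u - x) + 2 * (x - u) / x - k * (x - u)"
      using assms by (simp add: k_def field_simps)
    also have "2 * (x - u) / x \<le> 2" using that assms by (simp add: field_simps)
    finally have "(y - 1) * ln u - u \<le> 2 + (y - 1) * ln x - x - k * (x - u)" by (simp add: algebra_simps)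
    then have "exp ((y - 1) * ln u - u) \<le> exp (2 + (y - 1) * ln x - x - k * (x - u))" by simp
    then show ?thesis using that False assms
      by (simp add: A_def powr_def exp_diff exp_add exp_minus divide_inverse)
  qed (use A in simp)
  have "ennreal (gamma_lower y x) \<le>
      (\<integral>\<^sup>+u. ennreal (A * exp (- (k * (x - u)))) * indicator {0..x} u \<partial>lborel)"
  proof -
    have "ennreal (gamma_lower y x) =
        (\<integral>\<^sup>+u. ennreal (indicator {0..x} u * (u powr (y - 1) * exp (- u))) \<partial>lborel)"
      unfolding gamma_lower_def using assms
      by (intro nn_integral_eq_integral[symmetric] integrable_Gamma_part) auto
    also have "\<dots> \<le> (\<integral>\<^sup>+u. ennreal (A * exp (- (k * (x - u)))) * indicator {0..x} u \<partial>lborel)"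
      by (intro nn_integral_mono) (auto simp: indicator_def intro!: ennreal_leI bound)
    finally show ?thesis .
  qed
  also have "\<dots> = ennreal (A / k * exp (- (k * (x - x))) - A / k * exp (- (k * (x - 0))))"
  proof (rule nn_integral_FTC_Icc[where F = "\<lambda>u. A / k * exp (- (k * (x - u)))"])
    show "((\<lambda>u. A / k * exp (- (k * (x - u)))) has_real_derivative A * exp (- (k * (x - u)))) (at u)" for u
      using k by (auto intro!: derivative_eq_intros)
  qed (use A assms in auto)
  also have "\<dots> \<le> ennreal (A / k)" using A k by (intro ennreal_leI) simp
  finally have "gamma_lower y x \<le> A / k" using A k by simp
  then show ?thesis by (simp add: A_def k_def)
qed

lemma gamma_upper_ge:
  assumes "1 \<le> y" "0 < x"
  shows "x powr (y - 1) * exp (- x) * exp (- 1) \<le> gamma_upper y x"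
proof -
  have "((x + 1) - x) * (x powr (y - 1) * exp (- (x + 1))) \<le> gamma_upper y x"
    unfolding gamma_upper_def using assms
    by (intro integral_part_ge_rectangle mult_mono powr_mono2) auto
  then show ?thesis by (simp add: exp_add[symmetric] mult.assoc)
qed

text \<open>The rectangle stands on the last unit interval before \<open>x\<close>. Replacing
  \<open>x\<close> by \<open>x - 1\<close> in the power costs a factor that stays bounded because
  \<open>y / x\<close> is at most \<open>U\<close>; \<open>2 \<le> x\<close> gives
  \<open>x / (x - 1) \<le> 2\<close>.\<close>

lemma gamma_lower_ge:
  assumes "1 \<le> y" "2 \<le> x" "y \<le> U * x"
  shows "x powr (y - 1) * exp (- x) * exp (- 2 * U) \<le> gamma_lower y x"
proof -
  have "0 \<le> U"
    using assms by (smt (verit) mult_nonpos_nonneg)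
  have "(x - (x - 1)) * ((x - 1) powr (y - 1) * exp (- x)) \<le> gamma_lower y x"
    unfolding gamma_lower_def using assms
    by (intro integral_part_ge_rectangle mult_mono powr_mono2) auto
  then have lower: "(x - 1) powr (y - 1) * exp (- x) \<le> gamma_lower y x" by simp
  have "x powr (y - 1) * exp (- 2 * U) \<le> (x - 1) powr (y - 1)"
  proof -
    have "ln x - ln (x - 1) \<le> x / (x - 1) - 1"
      using ln_le_minus_one[of "x / (x - 1)"] assms by (simp add: ln_div)
    also have "\<dots> = 1 / (x - 1)" using assms by (simp add: field_simps)
    finally have "(y - 1) * (ln x - ln (x - 1)) \<le> (y - 1) * (1 / (x - 1))"
      using assms by (intro mult_left_mono) auto
    also have "\<dots> \<le> U * x * (1 / (x - 1))"
      using assms by (intro mult_right_mono) auto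
    also have "\<dots> \<le> 2 * U"
    proof -
      have "U * x \<le> U * (2 * (x - 1))" using assms \<open>0 \<le> U\<close> by (intro mult_left_mono) auto
      then show ?thesis using assms by (simp add: field_simps)
    qed
    finally have "(y - 1) * ln x - 2 * U \<le> (y - 1) * ln (x - 1)" by (simp add: algebra_simps)
    then have "exp ((y - 1) * ln x - 2 * U) \<le> exp ((y - 1) * ln (x - 1))" by simp
    then show ?thesis using assms by (simp add: powr_def exp_diff exp_minus divide_inverse)
  qed
  then have "x powr (y - 1) * exp (- 2 * U) * exp (- x) \<le> (x - 1) powr (y - 1) * exp (- x)"
    by (intro mult_right_mono) auto
  then have "x powr (y - 1) * exp (- x) * exp (- 2 * U) \<le> (x - 1) powr (y - 1) * exp (- x)"
    by (simp only: mult_ac)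
  with lower show ?thesis by (rule order_trans[rotated])
qed

text \<open>At shape \<open>x\<close> a unit rectangle would be too small by a factor of order
  \<open>sqrt x\<close>. The integrand changes only by a bounded factor over a width of
  \<open>sqrt x\<close> beside \<open>x\<close>, and the wider rectangle has the order
  \<open>x powr (x - 1 / 2) * exp (- x)\<close> of \<open>Gamma x\<close>.\<close>

lemma gamma_upper_diag_ge:
  assumes "1 \<le> x"
  shows "exp (- 2) * x powr (x - 1 / 2) * exp (- x) \<le> gamma_upper x x"
proof -
  have "((x + sqrt x) - x) * (x powr (x - 1) * exp (- x) * exp (- 2)) \<le> gamma_upper x x"
    unfolding gamma_upper_def
  proof (rule integral_part_ge_rectangle)
    fix u assume u: "x < u" "u \<le> x + sqrt x"
    define v where "v = (u - x) / x"
    have vx: "v * x = u - x" using assms by (simp add: v_def)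
    have v: "0 \<le> v" "v * x \<le> sqrt x" "u = x * (1 + v)"
      using u assms vx by (auto simp: v_def algebra_simps)
    have "(v * x) ^ 2 \<le> (sqrt x) ^ 2" using v assms by (intro power_mono) auto
    then have "v ^ 2 * x * x \<le> 1 * x" using assms by (simp add: power2_eq_square mult_ac)
    then have v2: "v ^ 2 * x \<le> 1" using assms by (simp only: mult_le_cancel_right)
    have "sqrt x \<le> x" using assms by (intro real_le_lsqrt) (auto simp: power2_eq_square)
    then have "v * x \<le> 1 * x" using v(2) by simp
    then have v1: "v \<le> 1" by (rule mult_right_le_imp_le) (use assms in simp)
    \<comment> \<open>To first order the gain \<open>x * v\<close> in the logarithm cancels the loss
      \<open>u - x\<close> in \<open>exp (- u)\<close>; the remainder is bounded since
      \<open>v ^ 2 * x \<le> 1\<close>.\<close>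
    have "(x - 1) * (v - v ^ 2) \<le> (x - 1) * ln (1 + v)"
      using assms v v1 by (intro mult_left_mono ln_one_plus_pos_lower_bound) auto
    moreover have "(x - 1) * (v - v ^ 2) = x * v - v - v ^ 2 * x + v ^ 2"
      by (simp add: algebra_simps)
    ultimately have le: "x * v - 2 \<le> (x - 1) * ln (1 + v)"
      using v1 v2 zero_le_power2[of v] by linarith
    have "ln u = ln x + ln (1 + v)" using v assms by (simp add: ln_mult)
    then have "(x - 1) * ln u = (x - 1) * ln x + (x - 1) * ln (1 + v)" by (simp only: distrib_left)
    with le vx have "(x - 1) * ln x - x - 2 \<le> (x - 1) * ln u - u" by (simp add: mult.commute)
    then have "exp ((x - 1) * ln x - x - 2) \<le> exp ((x - 1) * ln u - u)" by simp
    then show "x powr (x - 1) * exp (- x) * exp (- 2) \<le> u powr (x - 1) * exp (- u)"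
      using assms u by (simp add: powr_def exp_diff exp_minus divide_inverse)
  qed (use assms in auto)
  moreover have "x powr (x - 1 / 2) = sqrt x * x powr (x - 1)"
    using assms by (simp add: powr_half_sqrt[symmetric] powr_add[symmetric])
  ultimately show ?thesis by (simp add: mult_ac)
qed

lemma gamma_lower_diag_ge:
  assumes "4 \<le> x"
  shows "exp (- 2) * x powr (x - 1 / 2) * exp (- x) \<le> gamma_lower x x"
proof -
  have sx: "sqrt x * 2 \<le> x"
  proof -
    have "2 \<le> sqrt x" using assms by (simp add: real_le_rsqrt)
    then have "sqrt x * 2 \<le> sqrt x * sqrt x" using assms by (intro mult_left_mono) auto
    then show ?thesis using assms by simp
  qed
  have "(x - (x - sqrt x)) * (x powr (x - 1) * exp (- x) * exp (- 2)) \<le> gamma_lower x x"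
    unfolding gamma_lower_def
  proof (rule integral_part_ge_rectangle)
    fix u assume u: "x - sqrt x < u" "u \<le> x"
    define v where "v = (x - u) / x"
    have vx: "v * x = x - u" using assms by (simp add: v_def)
    have v: "0 \<le> v" "v * x \<le> sqrt x" "u = x * (1 - v)"
      using u assms vx by (auto simp: v_def algebra_simps)
    have "(v * x) ^ 2 \<le> (sqrt x) ^ 2" using v assms by (intro power_mono) auto
    then have "v ^ 2 * x * x \<le> 1 * x" using assms by (simp add: power2_eq_square mult_ac)
    then have v2: "v ^ 2 * x \<le> 1" using assms by (simp only: mult_le_cancel_right)
    have "v * x * 2 \<le> 1 * x" using v(2) sx by simp
    then have v1: "v \<le> 1 / 2" using assms by simp
    \<comment> \<open>This bound needs \<open>v \<le> 1 / 2\<close>, that is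
      \<open>2 * sqrt x \<le> x\<close>, whence the assumption \<open>4 \<le> x\<close>.\<close>
    have "- v - 2 * v ^ 2 \<le> ln (1 - v)"
      using ln_one_minus_pos_lower_bound[of v] v v1 by (smt (verit) zero_le_power2)
    then have "(x - 1) * (- v - 2 * v ^ 2) \<le> (x - 1) * ln (1 - v)"
      using assms by (intro mult_left_mono) auto
    moreover have "(x - 1) * (- v - 2 * v ^ 2) = - (x * v) - 2 * (v ^ 2 * x) + v + 2 * v ^ 2"
      by (simp add: algebra_simps)
    ultimately have le: "- (x * v) - 2 \<le> (x - 1) * ln (1 - v)"
      using v2 v(1) zero_le_power2[of v] by linarith
    have "ln u = ln x + ln (1 - v)" using v v1 assms by (simp add: ln_mult)
    then have "(x - 1) * ln u = (x - 1) * ln x + (x - 1) * ln (1 - v)" by (simp only: distrib_left)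
    with le vx have "(x - 1) * ln x - x - 2 \<le> (x - 1) * ln u - u" by (simp add: mult.commute)
    then have "exp ((x - 1) * ln x - x - 2) \<le> exp ((x - 1) * ln u - u)" by simp
    moreover have "0 < u" using u sx assms by (smt (verit) real_sqrt_gt_zero)
    ultimately show "x powr (x - 1) * exp (- x) * exp (- 2) \<le> u powr (x - 1) * exp (- u)"
      using assms by (simp add: powr_def exp_diff exp_minus divide_inverse)
  qed (use assms sx in auto)
  moreover have "x powr (x - 1 / 2) = sqrt x * x powr (x - 1)"
    using assms by (simp add: powr_half_sqrt[symmetric] powr_add[symmetric])
  ultimately show ?thesis by (simp add: mult_ac)
qed

section \<open>Asymptotics of the tail probabilities\<close>

text \<open>Along unit steps the error \<open>h y\<close> does not increase and
  \<open>h y - 1 / (4 * y)\<close> does not decrease, so \<open>h\<close> is bounded because it is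
  bounded on the compact interval \<open>{1..2}\<close>. The two monotonicities are the midpoint and
  trapezoid estimates for the integral of \<open>1 / u\<close> over
  \<open>{y..y + 1}\<close>.\<close>

lemma ln_Gamma_Stirling:
  obtains C :: real where "\<And>y. 1 \<le> y \<Longrightarrow> \<bar>ln (Gamma y) - (y * ln y - y - ln y / 2)\<bar> \<le> C"
proof -
  define h :: "real \<Rightarrow> real" where "h y = ln (Gamma y) - (y * ln y - y - ln y / 2)" for y
  have step: "h (y + 1) \<le> h y" "h y - 1 / (4 * y) \<le> h (y + 1) - 1 / (4 * (y + 1))" if "1 \<le> y" for y
  proof -
    have "Gamma (y + 1) = y * Gamma y" using that by (intro Gamma_plus1) auto
    then have "ln (Gamma (y + 1)) = ln y + ln (Gamma y)"
      using that Gamma_real_pos[of y] by (simp add: ln_mult_pos)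
    then have diff: "h (y + 1) - h y = 1 - (y + 1 / 2) * (ln (y + 1) - ln y)"
      by (simp add: h_def algebra_simps add_divide_distrib diff_divide_distrib)
    have "2 / (2 * y + 1) \<le> ln (y + 1) - ln y"
      using ln_inverse_approx_ge[of y "y + 1"] that by simp
    then have "2 \<le> (ln (y + 1) - ln y) * (2 * y + 1)" using that by (simp only: pos_divide_le_eq)
    moreover have "(y + 1 / 2) * (ln (y + 1) - ln y) = (ln (y + 1) - ln y) * (2 * y + 1) / 2" by (simp add: field_simps)
    ultimately have "1 \<le> (y + 1 / 2) * (ln (y + 1) - ln y)" by linarith
    then show "h (y + 1) \<le> h y" using diff by simp
    have "(y + 1 / 2) * (ln (y + 1) - ln y) \<le> (y + 1 / 2) * ((inverse y + inverse (y + 1)) / 2)"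
      using ln_inverse_approx_le[of y 1] that by (intro mult_left_mono) auto
    also have "\<dots> = 1 + (1 / (4 * y) - 1 / (4 * (y + 1)))"
    proof -
      define w where "w = y * (y + 1)"
      have w: "0 < w" using that by (simp add: w_def)
      have e: "inverse y + inverse (y + 1) = (2 * y + 1) / w" "1 / (4 * y) - 1 / (4 * (y + 1)) = 1 / (4 * w)"
        using that by (simp_all add: w_def divide_simps)
      have "(y + 1 / 2) * (2 * y + 1) / 2 = w + 1 / 4" by (simp add: w_def field_simps)
      then have "(y + 1 / 2) * ((2 * y + 1) / w / 2) = (w + 1 / 4) / w" by (simp add: field_simps)
      also have "\<dots> = 1 + 1 / (4 * w)" using w by (simp add: add_divide_distrib)
      finally show ?thesis unfolding e .
    qed
    finally show "h y - 1 / (4 * y) \<le> h (y + 1) - 1 / (4 * (y + 1))" using diff by simp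
  qed
  have nat_step: "h (y + real n) \<le> h y \<and> h y - 1 / (4 * y) \<le> h (y + real n) - 1 / (4 * (y + real n))"
    if "1 \<le> y" for y n
  proof (induction n)
    case (Suc n)
    then show ?case using step[of "y + real n"] that by (simp add: add_ac)
  qed simp
  have "continuous_on {1..2} h"
    unfolding h_def by (intro continuous_intros) (auto simp: Gamma_eq_zero_iff dest: nonpos_Ints_nonpos)
  then have "bounded (h ` {1..2})"
    by (intro compact_imp_bounded compact_continuous_image) auto
  then obtain B where B: "\<And>y. 1 \<le> y \<Longrightarrow> y \<le> 2 \<Longrightarrow> \<bar>h y\<bar> \<le> B"
    unfolding bounded_iff by (metis atLeastAtMost_iff imageI real_norm_def)
  have "\<bar>h y\<bar> \<le> B + 1" if "1 \<le> y" for y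
  proof -
    define n where "n = nat \<lfloor>y - 1\<rfloor>"
    define z where "z = y - real n"
    have z: "1 \<le> z" "z \<le> 2" "y = z + real n" unfolding z_def n_def using that by linarith+
    have "1 / (4 * z) \<le> 1" "0 \<le> 1 / (4 * (z + real n))" using z by (auto simp: field_simps)
    with nat_step[OF z(1), of n] B[OF z(1,2)] show ?thesis
      unfolding z(3) by linarith
  qed
  then show ?thesis using that[of "B + 1"] by (simp add: h_def)
qed

text \<open>At \<open>y = x\<close> both tails stay away from 0. By monotonicity in the shape this
  bounds \<open>p n\<close> below while \<open>a * (n + 1) \<le> x\<close>, and
  \<open>1 - p n\<close> below afterwards.\<close>

lemma gamma_cdf_diag:
  obtains c :: real where "0 < c" "\<And>x. 4 \<le> x \<Longrightarrow> c \<le> gamma_cdf x x" "\<And>x. 4 \<le> x \<Longrightarrow> c \<le> 1 - gamma_cdf x x"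
proof -
  obtain C :: real where C: "\<And>y. 1 \<le> y \<Longrightarrow> \<bar>ln (Gamma y) - (y * ln y - y - ln y / 2)\<bar> \<le> C"
    by (rule ln_Gamma_Stirling) blast
  have le: "exp (- 2 - C) * Gamma x \<le> exp (- 2) * x powr (x - 1 / 2) * exp (- x)" if "4 \<le> x" for x
  proof -
    have "ln (Gamma x) \<le> C + ((x - 1 / 2) * ln x - x)"
      using C[of x] that by (simp add: algebra_simps)
    then have "exp (ln (Gamma x)) \<le> exp (C + ((x - 1 / 2) * ln x - x))" by simp
    also have "\<dots> = exp C * (x powr (x - 1 / 2) * exp (- x))"
    proof -
      have "exp (C + (t - x)) = exp C * (exp t * exp (- x))" for t
        by (simp add: exp_add exp_diff exp_minus divide_inverse)
      then show ?thesis using that by (simp add: powr_def)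
    qed
    finally have "Gamma x \<le> exp C * (x powr (x - 1 / 2) * exp (- x))"
      using that Gamma_real_pos[of x] by simp
    then have "exp (- 2 - C) * Gamma x \<le> exp (- 2 - C) * (exp C * (x powr (x - 1 / 2) * exp (- x)))"
      by (intro mult_left_mono) auto
    then show ?thesis by (simp add: mult.assoc[symmetric] exp_add[symmetric])
  qed
  show ?thesis
  proof (rule that[of "exp (- 2 - C)"])
    fix x :: real assume x: "4 \<le> x"
    have G: "0 < Gamma x" using x by (simp add: Gamma_real_pos)
    show "exp (- 2 - C) \<le> gamma_cdf x x"
      using le[OF x] gamma_lower_diag_ge[OF x] G by (simp add: gamma_cdf_def pos_le_divide_eq)
    show "exp (- 2 - C) \<le> 1 - gamma_cdf x x"
      using le[OF x] gamma_upper_diag_ge[of x] x G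
      by (subst one_minus_gamma_cdf) (simp_all add: pos_le_divide_eq)
  qed simp
qed

text \<open>Up to a bounded error, minus the logarithm of the Poisson weight
  \<open>x powr y * exp (- x) / Gamma (y + 1)\<close>, with \<open>ln x\<close> in place of
  \<open>ln y\<close>, as long as \<open>1 \<le> y\<close> and \<open>y / x\<close> stays between
  positive constants.\<close>

definition rate :: "real \<Rightarrow> real \<Rightarrow> real" where
  "rate x y = x - y + y * ln (y / x) + ln x / 2"

text \<open>The tail that excludes the mean \<open>y\<close> of the gamma distribution: the
  untypical outcome, which the indices between \<open>x\<close> and \<open>b * x\<close> are forced
  to have.\<close>

definition tail_prob :: "real \<Rightarrow> real \<Rightarrow> real" where
  "tail_prob x y = (if y \<le> x then 1 - gamma_cdf y x else gamma_cdf y x)"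

text \<open>Stirling's formula combined with the integral bounds above. The upper and lower bounds
  differ essentially by \<open>x / (\<bar>y - x\<bar> + 1)\<close>, bounded far from the diagonal
  but not near it, so its logarithm is kept as a separate term to be summed later. The factor
  \<open>U\<close> keeps that logarithm nonnegative.\<close>

lemma neg_ln_tail_prob:
  assumes "0 < L" "L \<le> 1" "1 \<le> U"
  obtains C where "0 \<le> C"
    "\<And>x y. 2 \<le> x \<Longrightarrow> 1 \<le> L * x \<Longrightarrow> L * x \<le> y \<Longrightarrow> y \<le> U * x \<Longrightarrow>
      \<bar>- ln (tail_prob x y) - rate x y\<bar> \<le> C + ln (U * x / (\<bar>y - x\<bar> + 1))"
proof -
  obtain C0 :: real where C0: "\<And>y. 1 \<le> y \<Longrightarrow> \<bar>ln (Gamma y) - (y * ln y - y - ln y / 2)\<bar> \<le> C0"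
    by (rule ln_Gamma_Stirling) blast
  have "0 \<le> C0" using C0[of 1] by linarith
  have lnL: "0 \<le> - ln L" using assms by simp
  have lnU: "0 \<le> ln U" using assms by simp
  define C where "C = C0 + 2 + 2 * U - ln L + ln U"
  show ?thesis
  proof (rule that[of C])
    show "0 \<le> C" using \<open>0 \<le> C0\<close> lnL lnU assms unfolding C_def by linarith
    fix x y assume x: "2 \<le> x" and Lx: "1 \<le> L * x" and yL: "L * x \<le> y" and yU: "y \<le> U * x"
    have y: "1 \<le> y" using Lx yL by simp
    have G: "0 < Gamma y" using y by (simp add: Gamma_real_pos)
    have lower: "0 < gamma_lower y x" and upper: "0 < gamma_upper y x"
      using x y by (auto intro: gamma_lower_pos gamma_upper_pos)
    have UxT: "\<bar>y - x\<bar> + 1 \<le> U * x"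
    proof (cases "y \<le> x")
      case True
      have "x \<le> U * x" using assms x by simp
      then show ?thesis using True y by linarith
    next
      case False
      then show ?thesis using yU x by simp
    qed
    then have T0: "0 \<le> ln (U * x / (\<bar>y - x\<bar> + 1))" using x assms by simp
    have Tge: "ln (x / (\<bar>y - x\<bar> + 1)) \<le> ln (U * x / (\<bar>y - x\<bar> + 1))"
      using assms x by (simp add: divide_right_mono)
    have lny: "ln y - ln x \<le> ln U" "ln L \<le> ln y - ln x"
    proof -
      have "ln y \<le> ln (U * x)" using y yU by simp
      also have "\<dots> = ln U + ln x" using assms x by (simp add: ln_mult)
      finally show "ln y - ln x \<le> ln U" by simp
      have "ln L + ln x = ln (L * x)" using assms x by (simp add: ln_mult)
      also have "\<dots> \<le> ln y" using y yL assms x by simp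
      finally show "ln L \<le> ln y - ln x" by simp
    qed
    have rate: "rate x y = (y * ln y - y - ln y / 2) - ((y - 1) * ln x - x) + (ln y - ln x) / 2"
      using x y by (simp add: rate_def ln_div algebra_simps add_divide_distrib diff_divide_distrib)
    have C1: "ln (Gamma y) \<le> (y * ln y - y - ln y / 2) + C0" "(y * ln y - y - ln y / 2) - C0 \<le> ln (Gamma y)"
      using C0[OF y] by linarith+
    \<comment> \<open>\<open>g\<close> stands for \<open>ln (Gamma y)\<close>, \<open>S\<close> for
      its Stirling approximation, \<open>v\<close> for the logarithm of the incomplete integral,
      \<open>w\<close> for that of the integrand at \<open>x\<close>, and \<open>d\<close> for
      \<open>ln y - ln x\<close>. Both tails fit the same inequalities.\<close>
    have combine: "\<bar>g - v - (S - w + d / 2)\<bar> \<le> C + T"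
      if "g \<le> S + C0" "S - C0 \<le> g" "v \<le> 2 + w + T'" "w - 2 * U - 1 \<le> v" "T' \<le> T" "0 \<le> T"
        "d \<le> ln U" "ln L \<le> d" for g v S w d T T' :: real
      using that lnL lnU assms unfolding C_def by (intro abs_leI) linarith+
    show "\<bar>- ln (tail_prob x y) - rate x y\<bar> \<le> C + ln (U * x / (\<bar>y - x\<bar> + 1))"
    proof (cases "y \<le> x")
      case True
      have eq: "- ln (tail_prob x y) = ln (Gamma y) - ln (gamma_upper y x)"
        using True x y G upper by (simp add: tail_prob_def one_minus_gamma_cdf ln_divide_pos)
      have "ln (gamma_upper y x) \<le> ln (x powr (y - 1) * exp (- x) * (x / (\<bar>y - x\<bar> + 1)))"
        using gamma_upper_le[OF y True] upper True by simp
      also have "\<dots> = (y - 1) * ln x - x + ln (x / (\<bar>y - x\<bar> + 1))"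
        using x by (subst ln_mult; simp add: ln_mult ln_powr)
      finally have 1: "ln (gamma_upper y x) \<le> (y - 1) * ln x - x + ln (x / (\<bar>y - x\<bar> + 1))" .
      have "(y - 1) * ln x - x - 1 = ln (x powr (y - 1) * exp (- x) * exp (- 1))"
        using x by (simp add: ln_mult ln_powr)
      also have "\<dots> \<le> ln (gamma_upper y x)"
        using gamma_upper_ge[OF y, of x] upper x by simp
      finally show ?thesis
        using 1 assms unfolding eq rate by (intro combine[OF C1 _ _ Tge T0 lny]) linarith+
    next
      case False
      have eq: "- ln (tail_prob x y) = ln (Gamma y) - ln (gamma_lower y x)"
        using False x y G lower by (simp add: tail_prob_def gamma_cdf_def ln_divide_pos)
      have "ln (gamma_lower y x) \<le> ln (exp 2 * x powr (y - 1) * exp (- x) * (x / (\<bar>y - x\<bar> + 1)))"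
        using gamma_lower_le[OF y, of x] lower False x by simp
      also have "\<dots> = 2 + (y - 1) * ln x - x + ln (x / (\<bar>y - x\<bar> + 1))"
        using x by (subst ln_mult; simp add: ln_mult ln_powr)
      finally have 1: "ln (gamma_lower y x) \<le> 2 + (y - 1) * ln x - x + ln (x / (\<bar>y - x\<bar> + 1))" .
      have "(y - 1) * ln x - x - 2 * U = ln (x powr (y - 1) * exp (- x) * exp (- 2 * U))"
        using x by (simp add: ln_mult ln_powr)
      also have "\<dots> \<le> ln (gamma_lower y x)"
        using gamma_lower_ge[OF y x yU] lower x by simp
      finally show ?thesis
        using 1 assms unfolding eq rate by (intro combine[OF C1 _ _ Tge T0 lny]) linarith+
    qed
  qed
qed

text \<open>All ratios are at most 1, and only \<open>O x\<close> indices precede the point where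
  \<open>2 * x \<le> a * n\<close>; from there the ratios decay like powers of
  \<open>2 powr (- a)\<close>. The bound is uniform in \<open>M\<close> and \<open>K\<close>. Since
  \<open>p n\<close> has shape \<open>a * (n + 1)\<close>, the denominator is
  \<open>p (M - 1)\<close>.\<close>

lemma gamma_cdf_sum_le:
  assumes a: "0 < a"
  obtains C where "0 \<le> C"
    "\<And>x K M. 1 \<le> x \<Longrightarrow> 0 < M \<Longrightarrow>
      (\<Sum>n=M..<K. gamma_cdf (a * real (n + 1)) x / gamma_cdf (a * real M) x) \<le> C * x"
proof -
  define \<rho> :: real where "\<rho> = 2 powr (- a)"
  have \<rho>: "0 < \<rho>" "\<rho> < 1" using a powr_less_mono[of "-a" 0 2] by (auto simp: \<rho>_def)
  define C where "C = 2 / a + 1 + 2 / (1 - \<rho>)"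
  show ?thesis
  proof (rule that[of C])
    show "0 \<le> C" using a \<rho> by (simp add: C_def)
    fix x :: real and K M :: nat assume x: "1 \<le> x" and M: "0 < M"
    let ?p = "\<lambda>n. gamma_cdf (a * real (n + 1)) x"
    define N where "N = nat \<lceil>2 * x / a\<rceil>"
    define q where "q = max N M"
    have N: "2 * x \<le> a * real N" "real N \<le> 2 * x / a + 1"
    proof -
      have "2 * x / a \<le> real N" unfolding N_def by (rule real_nat_ceiling_ge)
      then show "2 * x \<le> a * real N" using a by (simp add: field_simps)
      have "0 \<le> 2 * x / a" using a x by simp
      then show "real N \<le> 2 * x / a + 1" unfolding N_def by linarith
    qed
    have pM: "0 < gamma_cdf (a * real M) x" using a M x by (intro gamma_cdf_pos) auto
    have ratio: "?p n / gamma_cdf (a * real M) x \<le> (if n < q then 1 else 2 * \<rho> ^ (n - q))" if "M \<le> n" for n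
    proof (cases "n < q")
      case True
      have "?p n \<le> gamma_cdf (a * real M) x"
        using that a M x by (intro gamma_cdf_antimono) auto
      then show ?thesis using True pM by simp
    next
      case False
      have "?p n = gamma_cdf (a * real q + a * (real (n - q) + 1)) x"
        using False by (simp add: algebra_simps of_nat_diff)
      also have "\<dots> \<le> 2 * 2 powr (- (a * (real (n - q) + 1))) * gamma_cdf (a * real q) x"
      proof (rule gamma_cdf_geometric)
        have "a * real N \<le> a * real q" using a by (intro mult_left_mono) (auto simp: q_def)
        then show "2 * x \<le> a * real q" using N by simp
      qed (use x a in auto)
      also have "\<dots> \<le> 2 * \<rho> ^ (n - q) * gamma_cdf (a * real M) x"
      proof (intro mult_mono)
        have "2 powr (- (a * (real (n - q) + 1))) \<le> 2 powr (- a * real (n - q))"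
          using a by (intro powr_mono) (auto simp: algebra_simps)
        also have "\<dots> = \<rho> ^ (n - q)" by (simp add: \<rho>_def powr_power mult.commute)
        finally show "2 powr (- (a * (real (n - q) + 1))) \<le> \<rho> ^ (n - q)" .
        show "gamma_cdf (a * real q) x \<le> gamma_cdf (a * real M) x"
          using a M x by (intro gamma_cdf_antimono) (auto simp: q_def)
        show "0 \<le> gamma_cdf (a * real q) x"
          using a M x by (intro less_imp_le[OF gamma_cdf_pos]) (auto simp: q_def)
      qed (use \<rho> in auto)
      finally show ?thesis using False pM by (simp add: divide_le_eq)
    qed
    have "(\<Sum>n=M..<K. ?p n / gamma_cdf (a * real M) x) \<le>
        (\<Sum>n=M..<K. if n < q then 1 else 2 * \<rho> ^ (n - q))"
      using ratio by (intro sum_mono) auto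
    also have "\<dots> \<le> (\<Sum>n=M..<q + K. if n < q then 1 else 2 * \<rho> ^ (n - q))"
      using \<rho> by (intro sum_mono2) auto
    also have "{M..<q + K} = {M..<q} \<union> {q..<q + K}" by (auto simp: q_def)
    also have "(\<Sum>n\<in>{M..<q} \<union> {q..<q + K}. if n < q then 1 else 2 * \<rho> ^ (n - q)) =
        (\<Sum>n=M..<q. 1) + (\<Sum>n=q..<q + K. 2 * \<rho> ^ (n - q))"
      by (subst sum.union_disjoint) auto
    also have "(\<Sum>n=q..<q + K. 2 * \<rho> ^ (n - q)) = 2 * (\<Sum>n<K. \<rho> ^ n)"
      using sum.shift_bounds_nat_ivl[of "\<lambda>n. 2 * \<rho> ^ (n - q)" 0 q K]
      by (simp add: add.commute sum_distrib_left lessThan_atLeast0)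
    also have "(\<Sum>n<K. \<rho> ^ n) \<le> 1 / (1 - \<rho>)"
    proof -
      have "(\<Sum>n<K. \<rho> ^ n) = (1 - \<rho> ^ K) / (1 - \<rho>)" using \<rho> by (subst sum_gp_strict) auto
      also have "\<dots> \<le> 1 / (1 - \<rho>)" using \<rho> by (intro divide_right_mono) auto
      finally show ?thesis .
    qed
    also have "(\<Sum>n=M..<q. 1) \<le> 2 * x / a + 1"
      using N by (auto simp: q_def max_def)
    finally have "(\<Sum>n=M..<K. ?p n / gamma_cdf (a * real M) x) \<le> 2 * x / a + 1 + 2 * (1 / (1 - \<rho>))"
      by simp
    also have "\<dots> \<le> 2 / a * x + 1 * x + 2 / (1 - \<rho>) * x"
      using x \<rho> a mult_left_mono[of 1 x "2 / (1 - \<rho>)"] mult_left_mono[of 1 x "2 / a"] by simp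
    also have "\<dots> = C * x" by (simp add: C_def algebra_simps)
    finally show "(\<Sum>n=M..<K. ?p n / gamma_cdf (a * real M) x) \<le> C * x" .
  qed
qed

text \<open>The product of the arguments is \<open>V ^ J / fact J\<close>, a single term of the
  series of \<open>exp V\<close>.\<close>

lemma sum_ln_divide_le:
  assumes "0 < V"
  shows "(\<Sum>j<J. ln (V / (real j + 1))) \<le> V"
proof -
  have "(\<Sum>j<J. ln (V / (real j + 1))) = ln (\<Prod>j<J. V / (real j + 1))"
    using assms by (intro ln_prod[symmetric]) auto
  also have "(\<Prod>j<J. V / (real j + 1)) = V ^ J / fact J"
  proof (induction J)
    case (Suc J)
    then have "(\<Prod>j<Suc J. V / (real j + 1)) = V ^ J / fact J * (V / (real J + 1))" by simp
    also have "\<dots> = V ^ Suc J / fact (Suc J)" by (simp add: add.commute mult.commute)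
    finally show ?case .
  qed simp
  finally have eq: "(\<Sum>j<J. ln (V / (real j + 1))) = ln (V ^ J / fact J)" .
  have "V ^ J / fact J \<le> exp V"
  proof -
    have "(\<Sum>n\<in>{J}. V ^ n / fact n) \<le> (\<Sum>n. V ^ n / fact n)"
      using assms exp_converges[of V]
      by (intro sum_le_suminf) (auto simp: sums_iff divide_inverse mult.commute)
    also have "\<dots> = exp V"
      using exp_converges[of V] by (simp add: sums_iff divide_inverse mult.commute)
    finally show ?thesis by simp
  qed
  then have "ln (V ^ J / fact J) \<le> ln (exp V)"
    using assms by (intro ln_mono) auto
  then show ?thesis by (simp add: eq)
qed

text \<open>An antiderivative of \<open>1 - s + s * ln s\<close>, the leading part of
  \<open>rate x (s * x) / x\<close>. Its increment between 1 and \<open>b\<close> gives the leading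
  coefficient.\<close>

definition rate_int :: "real \<Rightarrow> real" where
  "rate_int s = s - 3 / 4 * s\<^sup>2 + s\<^sup>2 / 2 * ln s"

lemma has_derivative_rate_int:
  "0 < s \<Longrightarrow> (rate_int has_real_derivative (1 - s + s * ln s)) (at s)"
  unfolding rate_int_def
  by (auto intro!: derivative_eq_intros simp: power2_eq_square field_simps)

lemma rate_int_mono:
  assumes "0 < s" "s \<le> t"
  shows "rate_int s \<le> rate_int t"
proof (rule DERIV_nonneg_imp_nondecreasing[OF assms(2)])
  fix u assume u: "s \<le> u" "u \<le> t"
  have "ln (1 / u) \<le> 1 / u - 1" using u assms by (intro ln_le_minus_one) auto
  then have "u * ln (1 / u) \<le> u * (1 / u - 1)" using u assms by (intro mult_left_mono) auto
  then have "0 \<le> 1 - u + u * ln u" using u assms by (simp add: ln_div algebra_simps)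
  then show "\<exists>y. (rate_int has_real_derivative y) (at u) \<and> 0 \<le> y"
    using has_derivative_rate_int[of u] u assms by auto
qed

text \<open>Monotonicity of \<open>rate_int\<close> turns the distinction between
  \<open>b < 1\<close> and \<open>b > 1\<close> into an absolute value.\<close>

lemma rate_int_max_minus_min:
  assumes "0 < b"
  shows "rate_int (max b 1) - rate_int (min b 1) = \<bar>2 * b\<^sup>2 * ln b - (b - 1) * (3 * b - 1)\<bar> / 4"
proof -
  have "2 * b\<^sup>2 * ln b - (b - 1) * (3 * b - 1) = 4 * (rate_int b - rate_int 1)"
    by (simp add: rate_int_def power2_eq_square algebra_simps)
  then show ?thesis
    using rate_int_mono[of b 1] rate_int_mono[of 1 b] assms by (cases "b \<le> 1") (auto simp: abs_if)
qed

section \<open>Sums over the indices between the mean and the target\<close>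

context
  fixes a L U :: real
  assumes a: "0 < a" and L: "0 < L" "L \<le> 1" and U: "1 \<le> U"
begin

text \<open>In the application \<open>L = min b 1\<close> and \<open>U = max b 1\<close>, which
  treats \<open>b < 1\<close> and \<open>b > 1\<close> together. For \<open>0 \<le> x\<close> the
  rounding puts \<open>n\<close> in \<open>{lo x..<hi x}\<close> exactly when
  \<open>L * x < a * (n + 1)\<close> and \<open>a * (n + 1) \<le> U * x\<close>.\<close>

abbreviation lo :: "real \<Rightarrow> nat" where "lo x \<equiv> nat \<lfloor>L * x / a\<rfloor>"
abbreviation hi :: "real \<Rightarrow> nat" where "hi x \<equiv> nat \<lfloor>U * x / a\<rfloor>"

lemma lo_hi_bounds:
  assumes "0 \<le> x"
  shows "real (lo x) \<le> L * x / a" "L * x / a < real (lo x) + 1"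
    "real (hi x) \<le> U * x / a" "U * x / a < real (hi x) + 1" "lo x \<le> hi x"
proof -
  have 0: "0 \<le> L * x / a" "0 \<le> U * x / a" using a L U assms by auto
  then show "real (lo x) \<le> L * x / a" "L * x / a < real (lo x) + 1"
    "real (hi x) \<le> U * x / a" "U * x / a < real (hi x) + 1" by linarith+
  have "L * x / a \<le> U * x / a" using a L U assms by (intro divide_right_mono mult_right_mono) auto
  then show "lo x \<le> hi x" by (intro nat_mono floor_mono)
qed

text \<open>Two errors of order \<open>x\<close> arise. Each of the \<open>O x\<close> terms differs
  by a bounded amount from an increment of the antiderivative \<open>F\<close>, since
  \<open>g\<close> has derivative \<open>a * ln s\<close> with \<open>s\<close> in a fixed compact
  range. And rounding an end point moves \<open>F\<close> by at most a bound on its derivative,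
  which is of order \<open>x\<close>.\<close>

lemma riemann_sum_rate:
  obtains C where "\<And>x. 1 \<le> x \<Longrightarrow> 2 * a / L \<le> x \<Longrightarrow>
    \<bar>(\<Sum>n=lo x..<hi x. x * (1 - a * (real n + 1) / x + a * (real n + 1) / x * ln (a * (real n + 1) / x)))
      - x\<^sup>2 / a * (rate_int U - rate_int L)\<bar> \<le> C * x"
proof -
  define M where "M = \<bar>ln (L / 2)\<bar> + \<bar>ln U\<bar>"
  define B where "B = 1 + U + U * M"
  have M: "\<bar>ln s\<bar> \<le> M" if "L / 2 \<le> s" "s \<le> U" for s
  proof -
    have "ln (L / 2) \<le> ln s" "ln s \<le> ln U" using that L by simp_all
    then show ?thesis unfolding M_def by linarith
  qed
  have B: "\<bar>1 - s + s * ln s\<bar> \<le> B" if "L / 2 \<le> s" "s \<le> U" for s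
  proof -
    have "\<bar>s * ln s\<bar> \<le> U * M" unfolding abs_mult using M[OF that] that L by (intro mult_mono) auto
    moreover have "0 \<le> s" using that L by simp
    ultimately show ?thesis using that unfolding B_def by linarith
  qed
  show ?thesis
  proof (rule that[of "U * M + 2 * B"])
    fix x :: real assume x: "1 \<le> x" "2 * a / L \<le> x"
    define g where "g u = x * (1 - a * u / x + a * u / x * ln (a * u / x))" for u
    define F where "F u = x\<^sup>2 / a * rate_int (a * u / x)" for u
    \<comment> \<open>One index of slack at the lower end covers the rounding of
      \<open>lo x\<close>; \<open>2 * a / L \<le> x\<close> keeps the scaled argument above
      \<open>L / 2\<close> there.\<close>
    define R where "R = {L * x / a - 1..U * x / a}"
    have x0: "0 \<le> x" "0 < x" using x by auto
    note bds = lo_hi_bounds[OF x0(1)]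
    have R: "L / 2 \<le> a * u / x" "a * u / x \<le> U" if "u \<in> R" for u
    proof -
      have "L * x - a \<le> a * u" "a * u \<le> U * x"
        using that a by (auto simp: R_def field_simps)
      moreover have "2 * a \<le> L * x" using x L by (simp add: field_simps)
      ultimately show "L / 2 \<le> a * u / x" "a * u / x \<le> U" using x0 by (simp_all add: field_simps)
    qed
    have dF: "(F has_real_derivative g u) (at u within S)" if "u \<in> R" for u S
    proof -
      have "0 < a * u / x" using R[OF that] L by linarith
      then have "((\<lambda>u. rate_int (a * u / x)) has_real_derivative
          (1 - a * u / x + a * u / x * ln (a * u / x)) * (a / x)) (at u within S)"
        by (intro DERIV_chain2[OF has_derivative_rate_int]) (auto intro!: derivative_eq_intros)
      then have "(F has_real_derivative
          x\<^sup>2 / a * ((1 - a * u / x + a * u / x * ln (a * u / x)) * (a / x))) (at u within S)"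
        unfolding F_def by (rule DERIV_cmult)
      moreover have "x\<^sup>2 / a * (c * (a / x)) = x * c" for c
        using a x0 by (simp add: power2_eq_square)
      ultimately show ?thesis by (simp add: g_def)
    qed
    have dg: "(g has_real_derivative a * ln (a * u / x)) (at u within S)" if "u \<in> R" for u S
    proof -
      have pos: "0 < a * u / x" using R[OF that] L by linarith
      then have "0 < u" using a x0 by (simp add: zero_less_divide_iff zero_less_mult_iff)
      then show ?thesis
        unfolding g_def using a x0 pos
        by (auto intro!: derivative_eq_intros simp: field_simps)
    qed
    have step: "\<bar>g (real n + 1) - (F (real n + 1) - F (real n))\<bar> \<le> a * M" if n: "lo x \<le> n" "n < hi x" for n
    proof -
      have sub: "{real n..real n + 1} \<subseteq> R"
      proof -
        have "L * x / a - 1 \<le> real n" using bds(2) n by linarith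
        moreover have "real n + 1 \<le> U * x / a" using bds(3) n by linarith
        ultimately show ?thesis by (auto simp: R_def)
      qed
      have gb: "\<bar>g u - g (real n + 1)\<bar> \<le> a * M" if u: "u \<in> {real n..real n + 1}" for u
      proof -
        have "norm (g u - g (real n + 1)) \<le> a * M * norm (u - (real n + 1))"
        proof (rule field_differentiable_bound[where S = "{real n..real n + 1}" and f' = "\<lambda>u. a * ln (a * u / x)"])
          fix z assume "z \<in> {real n..real n + 1}"
          then have z: "z \<in> R" using sub by auto
          show "(g has_real_derivative a * ln (a * z / x)) (at z within {real n..real n + 1})"
            by (rule dg[OF z])
          show "norm (a * ln (a * z / x)) \<le> a * M"
            using M[OF R[OF z]] a by (simp add: abs_mult)
        qed (use u in auto)
        also have "\<dots> \<le> a * M * 1" using u a by (intro mult_left_mono) (auto simp: M_def)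
        finally show ?thesis by simp
      qed
      \<comment> \<open>Subtracting the linear function of slope \<open>g (n + 1)\<close> leaves a
        derivative of size at most \<open>a * M\<close>, so one mean value estimate compares the
        increment of \<open>F\<close> with \<open>g (n + 1)\<close>.\<close>
      have "norm ((F (real n + 1) - g (real n + 1) * (real n + 1)) - (F (real n) - g (real n + 1) * real n))
          \<le> a * M * norm (real n + 1 - real n)"
      proof (rule field_differentiable_bound[where S = "{real n..real n + 1}" and
            f = "\<lambda>u. F u - g (real n + 1) * u" and f' = "\<lambda>u. g u - g (real n + 1)"])
        fix z assume z: "z \<in> {real n..real n + 1}"
        show "((\<lambda>u. F u - g (real n + 1) * u) has_real_derivative g z - g (real n + 1)) (at z within {real n..real n + 1})"
          using dF z sub by (auto intro!: derivative_eq_intros)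
        show "norm (g z - g (real n + 1)) \<le> a * M" using gb[OF z] by simp
      qed auto
      then show ?thesis by (simp add: algebra_simps abs_minus_commute)
    qed
    have "\<bar>(\<Sum>n=lo x..<hi x. g (real n + 1)) - (F (hi x) - F (lo x))\<bar> =
        \<bar>\<Sum>n=lo x..<hi x. g (real n + 1) - (F (real n + 1) - F (real n))\<bar>"
      using sum_Suc_diff'[OF bds(5), of "\<lambda>n. F (real n)"] by (simp add: sum_subtractf add.commute)
    also have "\<dots> \<le> (\<Sum>n=lo x..<hi x. a * M)"
      by (rule order_trans[OF sum_abs sum_mono]) (use step in auto)
    also have "\<dots> \<le> (U * x / a) * (a * M)"
    proof -
      have "real (hi x - lo x) \<le> U * x / a" using bds(3) by linarith
      moreover have "0 \<le> a * M" using a by (simp add: M_def)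
      ultimately have "real (hi x - lo x) * (a * M) \<le> (U * x / a) * (a * M)" by (rule mult_right_mono)
      then show ?thesis by simp
    qed
    also have "\<dots> = U * M * x" using a by simp
    finally have 1: "\<bar>(\<Sum>n=lo x..<hi x. g (real n + 1)) - (F (hi x) - F (lo x))\<bar> \<le> U * M * x" .
    have near: "\<bar>F u - F v\<bar> \<le> B * x" if "u \<in> R" "v \<in> R" "\<bar>u - v\<bar> \<le> 1" for u v
    proof -
      have "norm (F u - F v) \<le> (x * B) * norm (u - v)"
      proof (rule field_differentiable_bound[where S = R and f' = g])
        fix z assume z: "z \<in> R"
        show "(F has_real_derivative g z) (at z within R)" by (rule dF[OF z])
        show "norm (g z) \<le> x * B"
          using B[OF R[OF z]] x0 by (simp add: g_def abs_mult)
      qed (use that in \<open>auto simp: R_def\<close>)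
      also have "\<dots> \<le> (x * B) * 1"
        using that x0 U by (intro mult_left_mono) (auto simp: B_def M_def)
      finally show ?thesis by (simp add: mult.commute)
    qed
    have LU: "L * x / a \<le> U * x / a" using a L U x0 by (intro divide_right_mono mult_right_mono) auto
    have 2: "\<bar>F (hi x) - F (U * x / a)\<bar> \<le> B * x" "\<bar>F (lo x) - F (L * x / a)\<bar> \<le> B * x"
    proof -
      have "real (lo x) \<le> real (hi x)" using bds(5) by simp
      then have "real (hi x) \<in> R" "U * x / a \<in> R" "real (lo x) \<in> R" "L * x / a \<in> R"
          "\<bar>real (hi x) - U * x / a\<bar> \<le> 1" "\<bar>real (lo x) - L * x / a\<bar> \<le> 1"
        using bds(1-4) LU unfolding R_def atLeastAtMost_iff by linarith+
      then show "\<bar>F (hi x) - F (U * x / a)\<bar> \<le> B * x" "\<bar>F (lo x) - F (L * x / a)\<bar> \<le> B * x"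
        by (auto intro: near)
    qed
    have 3: "F (U * x / a) = x\<^sup>2 / a * rate_int U" "F (L * x / a) = x\<^sup>2 / a * rate_int L"
      using a x0 by (simp_all add: F_def)
    show "\<bar>(\<Sum>n=lo x..<hi x. x * (1 - a * (real n + 1) / x + a * (real n + 1) / x * ln (a * (real n + 1) / x)))
      - x\<^sup>2 / a * (rate_int U - rate_int L)\<bar> \<le> (U * M + 2 * B) * x"
    proof -
      have combine: "\<bar>S - c * (u - v)\<bar> \<le> E"
        if "\<bar>S - (p - q)\<bar> \<le> E1" "\<bar>p - p'\<bar> \<le> E2" "\<bar>q - q'\<bar> \<le> E2" "p' = c * u" "q' = c * v"
          "E = E1 + 2 * E2" for S c u v p q p' q' E E1 E2 :: real
        using that by (simp add: right_diff_distrib)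
      show ?thesis
        by (rule combine[OF 1[unfolded g_def] 2 3]) (simp add: distrib_right)
    qed
  qed
qed

text \<open>The assumption on \<open>L\<close> and \<open>U\<close> puts \<open>x\<close> at one end
  of the range, so the index at position \<open>j\<close> from that end has
  \<open>\<bar>a * (n + 1) - x\<bar>\<close> at least \<open>a * j\<close>. Then
  \<open>min a 1 * (j + 1)\<close> is a lower bound for the denominator and
  \<open>sum_ln_divide_le\<close> applies.\<close>

lemma sum_ln_distance_le:
  assumes "L = 1 \<or> U = 1" "1 \<le> x"
  shows "(\<Sum>n=lo x..<hi x. ln (U * x / (\<bar>a * (real n + 1) - x\<bar> + 1))) \<le> U / min a 1 * x"
proof -
  define c where "c = min a 1"
  have c: "0 < c" "c \<le> a" "c \<le> 1" using a by (auto simp: c_def)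
  define V where "V = U * x / c"
  have V: "0 < V" using U assms(2) c by (simp add: V_def)
  have bds: "real (lo x) \<le> L * x / a" "L * x / a < real (lo x) + 1"
    "real (hi x) \<le> U * x / a" "U * x / a < real (hi x) + 1" "lo x \<le> hi x"
    using lo_hi_bounds[of x] assms by auto
  have term_le: "ln (U * x / (d + 1)) \<le> ln (V / (real j + 1))" if "a * real j \<le> d" for d j
  proof -
    have "c * (real j + 1) \<le> d + 1"
      using mult_right_mono[OF c(2), of "real j"] c(3) that by (simp add: distrib_left)
    moreover have "0 < c * (real j + 1)" using c by simp
    then have "0 < d + 1" using \<open>c * (real j + 1) \<le> d + 1\<close> by linarith
    ultimately have "U * x / (d + 1) \<le> U * x / (c * (real j + 1))"
      using U assms(2) c(1) \<open>0 < d + 1\<close> by (intro divide_left_mono mult_pos_pos) auto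
    also have "\<dots> = V / (real j + 1)" by (simp add: V_def)
    finally show ?thesis
      using \<open>0 < d + 1\<close> U assms(2) by (intro ln_mono) auto
  qed
  have "(\<Sum>n=lo x..<hi x. ln (U * x / (\<bar>a * (real n + 1) - x\<bar> + 1))) \<le> (\<Sum>j<hi x - lo x. ln (V / (real j + 1)))"
    using assms(1)
  proof
    assume "L = 1"
    then have lo: "x \<le> a * (real (lo x) + 1)" using bds(2) a by (simp add: field_simps)
    have "(\<Sum>n=lo x..<hi x. ln (U * x / (\<bar>a * (real n + 1) - x\<bar> + 1))) \<le>
        (\<Sum>n=lo x..<hi x. ln (V / (real (n - lo x) + 1)))"
    proof (rule sum_mono)
      fix n assume "n \<in> {lo x..<hi x}"
      then have "a * real (n - lo x) \<le> a * (real n + 1) - x" using lo by (simp add: of_nat_diff algebra_simps)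
      then show "ln (U * x / (\<bar>a * (real n + 1) - x\<bar> + 1)) \<le> ln (V / (real (n - lo x) + 1))"
        by (intro term_le) linarith
    qed
    also have "\<dots> = (\<Sum>j<hi x - lo x. ln (V / (real j + 1)))"
      by (rule sum.reindex_bij_witness[of _ "\<lambda>j. j + lo x" "\<lambda>n. n - lo x"]) auto
    finally show ?thesis .
  next
    assume "U = 1"
    then have hi: "a * real (hi x) \<le> x" using bds(3) a by (simp add: field_simps)
    have "(\<Sum>n=lo x..<hi x. ln (U * x / (\<bar>a * (real n + 1) - x\<bar> + 1))) \<le>
        (\<Sum>n=lo x..<hi x. ln (V / (real (hi x - 1 - n) + 1)))"
    proof (rule sum_mono)
      fix n assume "n \<in> {lo x..<hi x}"
      then have "a * real (hi x - 1 - n) \<le> x - a * (real n + 1)" using hi by (simp add: of_nat_diff algebra_simps)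
      then show "ln (U * x / (\<bar>a * (real n + 1) - x\<bar> + 1)) \<le> ln (V / (real (hi x - 1 - n) + 1))"
        by (intro term_le) linarith
    qed
    also have "\<dots> = (\<Sum>j<hi x - lo x. ln (V / (real j + 1)))"
      by (rule sum.reindex_bij_witness[of _ "\<lambda>j. hi x - 1 - j" "\<lambda>n. hi x - 1 - n"]) auto
    finally show ?thesis .
  qed
  also have "\<dots> \<le> V" by (rule sum_ln_divide_le[OF V])
  finally show ?thesis by (simp add: V_def c_def)
qed

lemma sum_neg_ln_tail_prob:
  assumes LU: "L = 1 \<or> U = 1"
  obtains C X where "\<And>x. X \<le> x \<Longrightarrow>
    \<bar>(\<Sum>n=lo x..<hi x. - ln (tail_prob x (a * (real n + 1))))
      - (x\<^sup>2 / a * (rate_int U - rate_int L) + (U - L) / (2 * a) * x * ln x)\<bar> \<le> C * x"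
proof -
  obtain C1 where C1: "0 \<le> C1" "\<And>x y. 2 \<le> x \<Longrightarrow> 1 \<le> L * x \<Longrightarrow> L * x \<le> y \<Longrightarrow> y \<le> U * x \<Longrightarrow>
      \<bar>- ln (tail_prob x y) - rate x y\<bar> \<le> C1 + ln (U * x / (\<bar>y - x\<bar> + 1))"
    by (rule neg_ln_tail_prob[OF L U]) blast
  obtain C2 where C2: "\<And>x. 1 \<le> x \<Longrightarrow> 2 * a / L \<le> x \<Longrightarrow>
    \<bar>(\<Sum>n=lo x..<hi x. x * (1 - a * (real n + 1) / x + a * (real n + 1) / x * ln (a * (real n + 1) / x)))
      - x\<^sup>2 / a * (rate_int U - rate_int L)\<bar> \<le> C2 * x"
    by (rule riemann_sum_rate) blast
  define X where "X = max 2 (max (1 / L) (2 * a / L))"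
  show ?thesis
  proof (rule that[of X "U / a * C1 + U / min a 1 + C2 + 1"])
    fix x assume "X \<le> x"
    then have x: "2 \<le> x" "1 / L \<le> x" "2 * a / L \<le> x" by (auto simp: X_def)
    have Lx: "1 \<le> L * x" using x L by (simp add: field_simps)
    have bds: "real (lo x) \<le> L * x / a" "L * x / a < real (lo x) + 1"
      "real (hi x) \<le> U * x / a" "U * x / a < real (hi x) + 1" "lo x \<le> hi x"
      using lo_hi_bounds[of x] x by auto
    let ?y = "\<lambda>n. a * (real n + 1)"
    let ?J = "{lo x..<hi x}"
    have y: "L * x \<le> ?y n" "?y n \<le> U * x" if "n \<in> ?J" for n
    proof -
      have "real (lo x) \<le> real n" "real n + 1 \<le> real (hi x)"
        using that by (simp_all only: atLeastLessThan_iff of_nat_le_iff) linarith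
      then have "L * x / a \<le> real n + 1" "real n + 1 \<le> U * x / a" using bds(2,3) by linarith+
      then show "L * x \<le> ?y n" "?y n \<le> U * x" using a by (simp_all add: field_simps)
    qed
    have "\<bar>(\<Sum>n\<in>?J. - ln (tail_prob x (?y n))) - (\<Sum>n\<in>?J. rate x (?y n))\<bar> =
        \<bar>\<Sum>n\<in>?J. - ln (tail_prob x (?y n)) - rate x (?y n)\<bar>" by (simp only: sum_subtractf)
    also have "\<dots> \<le> (\<Sum>n\<in>?J. C1 + ln (U * x / (\<bar>?y n - x\<bar> + 1)))"
      by (rule order_trans[OF sum_abs sum_mono]) (use C1(2)[OF x(1) Lx] y in blast)
    also have "\<dots> = real (hi x - lo x) * C1 + (\<Sum>n\<in>?J. ln (U * x / (\<bar>?y n - x\<bar> + 1)))"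
      by (simp add: sum.distrib)
    also have "\<dots> \<le> (U * x / a) * C1 + U / min a 1 * x"
    proof (intro add_mono mult_right_mono)
      show "real (hi x - lo x) \<le> U * x / a" using bds by linarith
      show "(\<Sum>n\<in>?J. ln (U * x / (\<bar>?y n - x\<bar> + 1))) \<le> U / min a 1 * x"
        using x by (intro sum_ln_distance_le LU) auto
    qed (use C1 in auto)
    finally have 1: "\<bar>(\<Sum>n\<in>?J. - ln (tail_prob x (?y n))) - (\<Sum>n\<in>?J. rate x (?y n))\<bar>
        \<le> (U * x / a) * C1 + U / min a 1 * x" .
    have "rate x y = x * (1 - y / x + y / x * ln (y / x)) + ln x / 2" for y
      using x by (simp add: rate_def field_simps)
    then have 2: "(\<Sum>n\<in>?J. rate x (?y n)) =
        (\<Sum>n\<in>?J. x * (1 - ?y n / x + ?y n / x * ln (?y n / x))) + real (hi x - lo x) * (ln x / 2)"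
      by (simp add: sum.distrib)
    \<comment> \<open>The number of indices is \<open>(U - L) * x / a\<close> up to 1, so the shares
      \<open>ln x / 2\<close> add up to the second-order term with an error of at most
      \<open>x\<close>.\<close>
    have "\<bar>real (hi x - lo x) - (U - L) * x / a\<bar> \<le> 1"
      using bds by (simp add: of_nat_diff left_diff_distrib diff_divide_distrib abs_le_iff) linarith
    then have "\<bar>real (hi x - lo x) - (U - L) * x / a\<bar> * (ln x / 2) \<le> 1 * (ln x / 2)"
      using x by (intro mult_right_mono) auto
    also have "\<dots> \<le> x" using ln_le_minus_one[of x] x by simp
    finally have "\<bar>(real (hi x - lo x) - (U - L) * x / a) * (ln x / 2)\<bar> \<le> x"
      using x by (simp add: abs_mult)
    moreover have "(real (hi x - lo x) - (U - L) * x / a) * (ln x / 2) =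
        real (hi x - lo x) * (ln x / 2) - (U - L) / (2 * a) * x * ln x"
      using a by (simp add: field_simps)
    ultimately have 3: "\<bar>real (hi x - lo x) * (ln x / 2) - (U - L) / (2 * a) * x * ln x\<bar> \<le> x" by metis
    have 4: "(U / a * C1 + U / min a 1 + C2 + 1) * x = (U * x / a) * C1 + U / min a 1 * x + C2 * x + x"
      by (simp add: distrib_right)
    have "1 \<le> x" using x by simp
    note C2' = C2[OF this x(3)]
    have combine: "\<bar>A - (P + Q)\<bar> \<le> E1 + E2 + E3 + E4"
      if "\<bar>A - S\<bar> \<le> E1 + E2" "S = T + W" "\<bar>T - P\<bar> \<le> E3" "\<bar>W - Q\<bar> \<le> E4"
      for A P Q E1 E2 E3 E4 S T W :: real
      using that by linarith
    show "\<bar>(\<Sum>n\<in>?J. - ln (tail_prob x (?y n)))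
      - (x\<^sup>2 / a * (rate_int U - rate_int L) + (U - L) / (2 * a) * x * ln x)\<bar>
      \<le> (U / a * C1 + U / min a 1 + C2 + 1) * x"
      unfolding 4 by (rule combine[OF 1 2 C2' 3])
  qed
qed

end

section \<open>Exact count probabilities up to exponential error\<close>

text \<open>\<open>K0\<close> may depend on \<open>x\<close>, since the limit in \<open>K\<close> is
  taken for fixed \<open>x\<close>; \<open>C\<close> does not. Outside the range treated above, the
  indices have their typical outcome and cost \<open>O x\<close> in total: below
  \<open>low x\<close> each costs at most \<open>- ln c\<close>, and from \<open>high x\<close> on
  the cost is at most \<open>p n / c\<close>, with a sum of order \<open>x\<close>.\<close>

theorem bern_gamma_cdf_asymptotics:
  fixes a b :: real
  assumes a: "0 < a" and b: "0 < b" "b \<noteq> 1"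
  obtains C X where "\<And>x. X \<le> x \<Longrightarrow> \<exists>K0. \<forall>K\<ge>K0.
    0 < bern (\<lambda>n. gamma_cdf (a * (real n + 1)) x) {..<K} (nat \<lfloor>b * x / a\<rfloor>) \<and>
    \<bar>- ln (bern (\<lambda>n. gamma_cdf (a * (real n + 1)) x) {..<K} (nat \<lfloor>b * x / a\<rfloor>)) -
      (x\<^sup>2 / a * (\<bar>2 * b\<^sup>2 * ln b - (b - 1) * (3 * b - 1)\<bar> / 4) + \<bar>b - 1\<bar> / (2 * a) * x * ln x)\<bar> \<le> C * x"
proof -
  define L where "L = min b 1"
  define U where "U = max b 1"
  have L: "0 < L" "L \<le> 1" and U: "1 \<le> U" and LU: "L = 1 \<or> U = 1"
    using b by (auto simp: L_def U_def)
  define low where "low x = nat \<lfloor>L * x / a\<rfloor>" for x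
  define high where "high x = nat \<lfloor>U * x / a\<rfloor>" for x
  obtain c :: real where c: "0 < c" "\<And>x. 4 \<le> x \<Longrightarrow> c \<le> gamma_cdf x x" "\<And>x. 4 \<le> x \<Longrightarrow> c \<le> 1 - gamma_cdf x x"
    by (rule gamma_cdf_diag) blast
  obtain C1 where C1: "0 \<le> C1" "\<And>x K M. 1 \<le> x \<Longrightarrow> 0 < M \<Longrightarrow>
      (\<Sum>n=M..<K. gamma_cdf (a * real (n + 1)) x / gamma_cdf (a * real M) x) \<le> C1 * x"
    by (rule gamma_cdf_sum_le[OF a]) blast
  obtain C2 X2 where C2: "\<And>x. X2 \<le> x \<Longrightarrow>
    \<bar>(\<Sum>n=low x..<high x. - ln (tail_prob x (a * (real n + 1))))
      - (x\<^sup>2 / a * (rate_int U - rate_int L) + (U - L) / (2 * a) * x * ln x)\<bar> \<le> C2 * x"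
    unfolding low_def high_def by (rule sum_neg_ln_tail_prob[OF a L U LU]) blast
  have "c < 1" using c(3)[of 4] gamma_cdf_pos[of 4 4] by simp
  show ?thesis
  proof (rule that[of "max (max 4 X2) (max a (a / b))" "C2 + (1 / a * (- ln c) + 1 / c * C1 + (b / a * ln 2 + C1))"])
    fix x assume "max (max 4 X2) (max a (a / b)) \<le> x"
    then have x: "4 \<le> x" "X2 \<le> x" "a \<le> x" "a / b \<le> x" by auto
    define p where "p n = gamma_cdf (a * (real n + 1)) x" for n
    define m where "m = nat \<lfloor>b * x / a\<rfloor>"
    define main where "main = x\<^sup>2 / a * (\<bar>2 * b\<^sup>2 * ln b - (b - 1) * (3 * b - 1)\<bar> / 4) + \<bar>b - 1\<bar> / (2 * a) * x * ln x"
    have main: "main = x\<^sup>2 / a * (rate_int U - rate_int L) + (U - L) / (2 * a) * x * ln x"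
    proof -
      have "rate_int U - rate_int L = \<bar>2 * b\<^sup>2 * ln b - (b - 1) * (3 * b - 1)\<bar> / 4"
        unfolding U_def L_def by (rule rate_int_max_minus_min[OF b(1)])
      moreover have "U - L = \<bar>b - 1\<bar>" by (auto simp: U_def L_def)
      ultimately show ?thesis by (simp only: main_def)
    qed
    have p0: "0 < p n" and p1: "p n < 1" for n
      unfolding p_def using a x by (auto intro!: gamma_cdf_pos gamma_cdf_less_1 mult_pos_pos)
    have dec: "p n' \<le> p n" if "n \<le> n'" for n n'
      unfolding p_def using a x that by (intro gamma_cdf_antimono mult_left_mono) auto
    have bds: "real (low x) \<le> L * x / a" "L * x / a < real (low x) + 1"
      "real (high x) \<le> U * x / a" "U * x / a < real (high x) + 1" "low x \<le> high x"
      using lo_hi_bounds[OF a L U, of x] x by (auto simp: low_def high_def)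
    have bxa: "1 \<le> b * x / a" using x a b by (simp add: field_simps)
    have m: "0 < m" "real m \<le> b * x / a" using bxa by (simp_all add: m_def)
    have high_pos: "0 < high x"
    proof -
      have "1 * x \<le> U * x" using U x by (intro mult_right_mono) auto
      then have "a \<le> U * x" using x(3) by linarith
      then have "1 \<le> U * x / a" using a by (simp add: field_simps)
      then show ?thesis using bds(4) by linarith
    qed
    have low_le: "a * (real n + 1) \<le> x" if "n < low x" for n
    proof -
      have "real n + 1 \<le> L * x / a" using that bds(1) by linarith
      then have "a * (real n + 1) \<le> L * x" using a by (simp add: field_simps)
      also have "\<dots> \<le> x" using L x by simp
      finally show ?thesis .
    qed
    have high_gt: "x < a * (real n + 1)" if "high x \<le> n" for n
    proof -
      have "U * x / a < real n + 1" using that bds(4) by linarith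
      then have "U * x < a * (real n + 1)" using a by (simp add: field_simps)
      moreover have "1 * x \<le> U * x" using U x by (intro mult_right_mono) auto
      ultimately show ?thesis by simp
    qed
    have lower_part: "0 \<le> (\<Sum>n<low x. - ln (p n))" "(\<Sum>n<low x. - ln (p n)) \<le> 1 / a * (- ln c) * x"
    proof -
      have "- ln (p n) \<le> - ln c" if "n < low x" for n
      proof -
        have "c \<le> gamma_cdf x x" by (rule c(2)[OF x(1)])
        also have "\<dots> \<le> p n" unfolding p_def using a x low_le[OF that] by (intro gamma_cdf_antimono) auto
        finally show ?thesis using c(1) p0[of n] by simp
      qed
      then have "(\<Sum>n<low x. - ln (p n)) \<le> (\<Sum>n<low x. - ln c)" by (intro sum_mono) auto
      also have "\<dots> = real (low x) * (- ln c)" by simp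
      also have "\<dots> \<le> (x / a) * (- ln c)"
      proof (rule mult_right_mono)
        have "L * x / a \<le> 1 * x / a" using L x a by (intro divide_right_mono mult_right_mono) auto
        then show "real (low x) \<le> x / a" using bds(1) by simp
      qed (use c(1) \<open>c < 1\<close> in simp)
      finally show "(\<Sum>n<low x. - ln (p n)) \<le> 1 / a * (- ln c) * x" by (simp add: mult.commute)
      show "0 \<le> (\<Sum>n<low x. - ln (p n))"
        using p0 p1 by (intro sum_nonneg) (simp add: less_imp_le)
    qed
    have ratio_sum: "(\<Sum>n=M..<K. p n / p (M - 1)) \<le> C1 * x" if "0 < M" for M K
      using C1(2)[of x M K] that x by (simp add: p_def add.commute of_nat_diff)
    have upper_part: "0 \<le> (\<Sum>n=high x..<K. - ln (1 - p n))"
      "(\<Sum>n=high x..<K. - ln (1 - p n)) \<le> 1 / c * C1 * x" for K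
    proof -
      have "- ln (1 - p n) \<le> 1 / c * (p n / p (high x - 1))" if "high x \<le> n" for n
      proof -
        have "c \<le> 1 - gamma_cdf x x" by (rule c(3)[OF x(1)])
        also have "\<dots> \<le> 1 - p n"
          unfolding p_def using a x high_gt[OF that] by (simp add: gamma_cdf_antimono less_imp_le)
        finally have cp: "c \<le> 1 - p n" .
        have "- ln (1 - p n) = ln (1 / (1 - p n))" using p1[of n] by (simp add: ln_div)
        also have "\<dots> \<le> 1 / (1 - p n) - 1" using p1[of n] by (intro ln_le_minus_one) simp
        also have "\<dots> = p n / (1 - p n)" using p1[of n] by (simp add: field_simps)
        also have "\<dots> \<le> p n / c" using cp c(1) p0[of n] by (intro divide_left_mono) auto
        \<comment> \<open>Dividing by a probability enlarges the term and gives it the form of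
          \<open>ratio_sum\<close>.\<close>
        also have "\<dots> \<le> (p n / p (high x - 1)) / c"
        proof (rule divide_right_mono)
          show "p n \<le> p n / p (high x - 1)"
            using p0[of "high x - 1"] p1[of "high x - 1"] p0[of n] by (simp add: field_simps)
        qed (use c(1) in simp)
        finally show ?thesis by (simp add: mult.commute)
      qed
      then have "(\<Sum>n=high x..<K. - ln (1 - p n)) \<le> (\<Sum>n=high x..<K. 1 / c * (p n / p (high x - 1)))"
        by (intro sum_mono) auto
      also have "\<dots> = 1 / c * (\<Sum>n=high x..<K. p n / p (high x - 1))"
        by (simp add: sum_distrib_left)
      also have "\<dots> \<le> 1 / c * (C1 * x)"
        using c(1) by (intro mult_left_mono ratio_sum high_pos) auto
      finally show "(\<Sum>n=high x..<K. - ln (1 - p n)) \<le> 1 / c * C1 * x" by simp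
      show "0 \<le> (\<Sum>n=high x..<K. - ln (1 - p n))"
        using p0 p1 by (intro sum_nonneg) (simp add: less_imp_le)
    qed
    define T where "T = (\<Sum>n=low x..<high x. - ln (tail_prob x (a * (real n + 1))))"
    have "0 < bern p {..<K} m \<and> \<bar>- ln (bern p {..<K} m) - main\<bar> \<le>
        (C2 + (1 / a * (- ln c) + 1 / c * C1 + (b / a * ln 2 + C1))) * x" if K: "high x \<le> K" for K
    proof -
      \<comment> \<open>For \<open>b < 1\<close> the target is the lower end and the middle indices
        are forced to fail; for \<open>b > 1\<close> it is the upper end and they are forced to
        succeed. In both cases \<open>tail_prob\<close> is their factor in \<open>Lam\<close>, which
        is what \<open>split\<close> records.\<close>
      have m_cases: "m = low x \<and> L \<noteq> 1 \<and> U = 1 \<or> m = high x \<and> L = 1"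
        by (cases "b \<le> 1") (use b in \<open>auto simp: m_def low_def high_def L_def U_def min_def max_def\<close>)
      then have mK: "m \<le> K" using K bds(5) by auto
      define Lam where "Lam = (\<Prod>n<m. p n) * (\<Prod>n=m..<K. 1 - p n)"
      have Lam: "0 < Lam"
        unfolding Lam_def using p0 p1 by (intro mult_pos_pos prod_pos) auto
      have "ln Lam = (\<Sum>n<m. ln (p n)) + (\<Sum>n=m..<K. ln (1 - p n))"
        unfolding Lam_def using p0 p1 less_imp_neq
        by (subst ln_mult_pos) (auto intro!: prod_pos simp: ln_prod less_imp_neq[symmetric] ln_prod[OF _ less_imp_neq[THEN not_sym]])
      then have lnLam: "- ln Lam = (\<Sum>n<m. - ln (p n)) + (\<Sum>n=m..<K. - ln (1 - p n))"
        by (simp add: sum_negf)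
      have split: "- ln Lam = (\<Sum>n<low x. - ln (p n)) + T + (\<Sum>n=high x..<K. - ln (1 - p n))"
        using m_cases
      proof
        assume mm: "m = low x \<and> L \<noteq> 1 \<and> U = 1"
        have "T = (\<Sum>n=low x..<high x. - ln (1 - p n))"
          unfolding T_def
        proof (rule sum.cong)
          fix n assume "n \<in> {low x..<high x}"
          then have "real n + 1 \<le> x / a" using bds(3) mm by auto
          then have "a * (real n + 1) \<le> x" using a by (simp add: field_simps)
          then show "- ln (tail_prob x (a * (real n + 1))) = - ln (1 - p n)"
            by (simp add: tail_prob_def p_def)
        qed simp
        then have "T + (\<Sum>n=high x..<K. - ln (1 - p n)) = (\<Sum>n=m..<K. - ln (1 - p n))"
          using mm by (simp only: sum.atLeastLessThan_concat[OF bds(5) K])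
        then show ?thesis using lnLam mm by simp
      next
        assume mm: "m = high x \<and> L = 1"
        have "T = (\<Sum>n=low x..<high x. - ln (p n))"
          unfolding T_def
        proof (rule sum.cong)
          fix n assume "n \<in> {low x..<high x}"
          then have "x / a < real n + 1" using bds(2) mm by auto
          then have "x < a * (real n + 1)" using a by (simp add: field_simps)
          then show "- ln (tail_prob x (a * (real n + 1))) = - ln (p n)"
            by (simp add: tail_prob_def p_def)
        qed simp
        then have "(\<Sum>n<low x. - ln (p n)) + T = (\<Sum>n<m. - ln (p n))"
          using mm sum.atLeastLessThan_concat[of 0 "low x" "high x" "\<lambda>n. - ln (p n)"] bds(5)
          by (simp add: lessThan_atLeast0)
        then show ?thesis using lnLam mm by simp
      qed
      have ge: "Lam \<le> bern p {..<K} m"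
        unfolding Lam_def using p0 p1 mK by (intro bern_ge) (auto simp: less_imp_le)
      have le: "bern p {..<K} m \<le> 2 ^ m * exp (C1 * x) * Lam"
        unfolding Lam_def by (intro bern_le p0 p1 dec m mK ratio_sum)
      have pos: "0 < bern p {..<K} m" using ge Lam by linarith
      have "ln (bern p {..<K} m) \<le> ln (2 ^ m * exp (C1 * x) * Lam)"
        using le pos by simp
      also have "\<dots> = real m * ln 2 + C1 * x + ln Lam"
        using Lam by (simp add: ln_mult ln_realpow)
      also have "real m * ln 2 \<le> b * x / a * ln 2" using m(2) by (intro mult_right_mono) auto
      finally have up: "ln (bern p {..<K} m) \<le> b * x / a * ln 2 + C1 * x + ln Lam" by simp
      have lo: "ln Lam \<le> ln (bern p {..<K} m)" using ge Lam by simp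
      have combine: "\<bar>- B - M\<bar> \<le> E" if "B \<le> e1 + e2 + l" "l \<le> B" "- l = s1 + T + s2" "0 \<le> s1" "s1 \<le> e3" "0 \<le> s2" "s2 \<le> e4"
        "\<bar>T - M\<bar> \<le> e5" "E = e1 + e2 + e3 + e4 + e5" "0 \<le> e1" "0 \<le> e2" for B M E e1 e2 e3 e4 e5 l s1 s2 :: real
        using that by linarith
      have "\<bar>- ln (bern p {..<K} m) - main\<bar> \<le>
          (C2 + (1 / a * (- ln c) + 1 / c * C1 + (b / a * ln 2 + C1))) * x"
      proof (rule combine[OF up lo split lower_part upper_part])
        show "\<bar>T - main\<bar> \<le> C2 * x" using C2[OF x(2)] by (simp only: T_def main)
        show "0 \<le> b * x / a * ln 2" using a b x by (intro mult_nonneg_nonneg divide_nonneg_pos) auto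
        show "0 \<le> C1 * x" using C1 x by simp
      qed (simp add: algebra_simps)
      with pos show ?thesis by simp
    qed
    then show "\<exists>K0. \<forall>K\<ge>K0. 0 < bern (\<lambda>n. gamma_cdf (a * (real n + 1)) x) {..<K} (nat \<lfloor>b * x / a\<rfloor>) \<and>
      \<bar>- ln (bern (\<lambda>n. gamma_cdf (a * (real n + 1)) x) {..<K} (nat \<lfloor>b * x / a\<rfloor>)) -
      (x\<^sup>2 / a * (\<bar>2 * b\<^sup>2 * ln b - (b - 1) * (3 * b - 1)\<bar> / 4) + \<bar>b - 1\<bar> / (2 * a) * x * ln x)\<bar>
      \<le> (C2 + (1 / a * (- ln c) + 1 / c * C1 + (b / a * ln 2 + C1))) * x"
      unfolding p_def[abs_def] m_def main_def by blast
  qed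
qed

section \<open>Rotation invariance and orthogonality of the weighted monomials\<close>

lemma lborel_complex_eq_distr:
  "(lborel :: complex measure) = distr (lborel \<Otimes>\<^sub>M lborel) borel (\<lambda>(x, y). Complex x y)"
proof (rule lborel_eqI)
  have Cm[measurable]: "(\<lambda>(x, y). Complex x y) \<in> (lborel \<Otimes>\<^sub>M lborel) \<rightarrow>\<^sub>M borel"
    unfolding lborel_prod by (simp add: borel_measurable_continuous_onI continuous_on_Complex case_prod_beta continuous_intros)
  fix l u :: complex assume le: "\<And>b. b \<in> Basis \<Longrightarrow> l \<bullet> b \<le> u \<bullet> b"
  have le': "Re l \<le> Re u" "Im l \<le> Im u" using le[of 1] le[of \<i>] by (auto simp: Basis_complex_def)
  have "(\<lambda>(x, y). Complex x y) -` box l u = {Re l<..<Re u} \<times> {Im l<..<Im u}"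
    by (auto simp: in_box_complex_iff)
  then have "emeasure (distr (lborel \<Otimes>\<^sub>M lborel) borel (\<lambda>(x, y). Complex x y)) (box l u) =
      emeasure (lborel \<Otimes>\<^sub>M lborel) ({Re l<..<Re u} \<times> {Im l<..<Im u})"
    by (subst emeasure_distr) (auto simp: space_pair_measure)
  also have "\<dots> = ennreal (Re u - Re l) * ennreal (Im u - Im l)"
    using le' by (subst lborel.emeasure_pair_measure_Times) auto
  also have "\<dots> = (\<Prod>b\<in>Basis. (u - l) \<bullet> b)"
    using le' by (simp add: Basis_complex_def ennreal_mult)
  finally show "emeasure (distr (lborel \<Otimes>\<^sub>M lborel) borel (\<lambda>(x, y). Complex x y)) (box l u) =
      (\<Prod>b\<in>Basis. (u - l) \<bullet> b)" .
qed simp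

lemma measurable_Complex [measurable]:
  assumes [measurable]: "f \<in> borel_measurable M" "g \<in> borel_measurable M"
  shows "(\<lambda>x. Complex (f x) (g x)) \<in> borel_measurable M"
  by (simp add: borel_measurable_complex_iff)

lemma nn_integral_lborel_complex:
  assumes [measurable]: "f \<in> borel_measurable borel"
  shows "(\<integral>\<^sup>+z. f z \<partial>lborel) = (\<integral>\<^sup>+y. \<integral>\<^sup>+x. f (Complex x y) \<partial>lborel \<partial>lborel)"
    and "(\<integral>\<^sup>+z. f z \<partial>lborel) = (\<integral>\<^sup>+x. \<integral>\<^sup>+y. f (Complex x y) \<partial>lborel \<partial>lborel)"
proof -
  have eq: "(\<integral>\<^sup>+z. f z \<partial>lborel) = (\<integral>\<^sup>+w. f (Complex (fst w) (snd w)) \<partial>(lborel \<Otimes>\<^sub>M lborel))"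
    by (subst lborel_complex_eq_distr) (simp add: nn_integral_distr case_prod_beta)
  show "(\<integral>\<^sup>+z. f z \<partial>lborel) = (\<integral>\<^sup>+y. \<integral>\<^sup>+x. f (Complex x y) \<partial>lborel \<partial>lborel)"
    unfolding eq by (subst lborel_pair.nn_integral_snd[symmetric]) simp_all
  show "(\<integral>\<^sup>+z. f z \<partial>lborel) = (\<integral>\<^sup>+x. \<integral>\<^sup>+y. f (Complex x y) \<partial>lborel \<partial>lborel)"
    unfolding eq by (subst lborel.nn_integral_fst[symmetric]) simp_all
qed

text \<open>On each horizontal line the shear is a translation. The two orders of integration in
  \<open>nn_integral_lborel_complex\<close> serve the two kinds of shear.\<close>

lemma nn_integral_shear_Re:
  assumes [measurable]: "f \<in> borel_measurable borel"
  shows "(\<integral>\<^sup>+z. f (Complex (Re z + s * Im z) (Im z)) \<partial>lborel) = (\<integral>\<^sup>+z. f z \<partial>lborel)"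
proof -
  have "(\<integral>\<^sup>+x. f (Complex (x + s * y) y) \<partial>lborel) = (\<integral>\<^sup>+x. f (Complex x y) \<partial>lborel)" for y
    by (subst (2) nn_integral_real_affine[where c = 1 and t = "s * y"]) (simp_all add: add.commute)
  then show ?thesis by (subst (1 2) nn_integral_lborel_complex(1)) simp_all
qed

lemma nn_integral_shear_Im:
  assumes [measurable]: "f \<in> borel_measurable borel"
  shows "(\<integral>\<^sup>+z. f (Complex (Re z) (Im z + s * Re z)) \<partial>lborel) = (\<integral>\<^sup>+z. f z \<partial>lborel)"
proof -
  have "(\<integral>\<^sup>+y. f (Complex x (y + s * x)) \<partial>lborel) = (\<integral>\<^sup>+y. f (Complex x y) \<partial>lborel)" for x
    by (subst (2) nn_integral_real_affine[where c = 1 and t = "s * x"]) (simp_all add: add.commute)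
  then show ?thesis by (subst (1 2) nn_integral_lborel_complex(2)) simp_all
qed

text \<open>A rotation by an angle other than \<open>\<pi>\<close> is a product of three shears.\<close>

lemma lborel_distr_rotation:
  assumes c: "cmod c = 1" "Re c \<noteq> - 1"
  shows "distr lborel borel ((*) c) = (lborel :: complex measure)"
proof (rule measure_eqI)
  \<comment> \<open>For \<open>c = cis \<theta>\<close> this is \<open>- tan (\<theta> / 2)\<close>,
    used by the two outer horizontal shears; the middle vertical one uses
    \<open>sin \<theta>\<close>. The denominator vanishes exactly at the half turn.\<close>
  define s where "s = - Im c / (1 + Re c)"
  have R: "1 + Re c \<noteq> 0" using c by auto
  have norm: "Re c * Re c + Im c * Im c = 1"
    using c(1) by (metis cmod_power2 power2_eq_square power_one)
  have s1: "1 + s * Im c = Re c"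
  proof -
    have sR: "s * (1 + Re c) = - Im c" using R by (simp add: s_def)
    have "(1 + s * Im c) * (1 + Re c) = 1 + Re c + Im c * (s * (1 + Re c))" by (simp add: algebra_simps)
    also have "\<dots> = Re c * (1 + Re c)" unfolding sR using norm by (simp add: algebra_simps)
    finally have "(1 + s * Im c) * (1 + Re c) = Re c * (1 + Re c)" .
    then show ?thesis using R by simp
  qed
  have s2: "s + (1 + s * Im c) * s = - Im c"
  proof -
    have "(s + Re c * s) = s * (1 + Re c)" by (simp add: algebra_simps)
    also have "\<dots> = - Im c" using R by (simp add: s_def)
    finally show ?thesis by (simp add: s1)
  qed
  fix A assume "A \<in> sets (distr lborel borel ((*) c))"
  then have A[measurable]: "A \<in> sets borel" by simp
  define f :: "complex \<Rightarrow> ennreal" where "f = indicator A"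
  have f[measurable]: "f \<in> borel_measurable borel" by (simp add: f_def)
  define S where "S z = Complex (Re z + s * Im z) (Im z)" for z
  define T where "T z = Complex (Re z) (Im z + Im c * Re z)" for z
  have [measurable]: "S \<in> borel_measurable borel" "T \<in> borel_measurable borel"
    unfolding S_def[abs_def] T_def[abs_def] by measurable
  have comp: "S (T (S z)) = c * z" for z
  proof (rule complex_eqI)
    have "Re (S (T (S z))) = (1 + s * Im c) * Re z + (s + (1 + s * Im c) * s) * Im z"
      by (simp add: S_def T_def algebra_simps)
    then show "Re (S (T (S z))) = Re (c * z)" by (simp only: s2) (simp add: s1)
    have "Im (S (T (S z))) = Im c * Re z + (1 + s * Im c) * Im z"
      by (simp add: S_def T_def algebra_simps)
    then show "Im (S (T (S z))) = Im (c * z)" by (simp add: s1)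
  qed
  have "emeasure (distr lborel borel ((*) c)) A = (\<integral>\<^sup>+z. f z \<partial>distr lborel borel ((*) c))"
    by (simp add: f_def)
  also have "\<dots> = (\<integral>\<^sup>+z. f (S (T (S z))) \<partial>lborel)"
    by (subst nn_integral_distr) (auto simp: comp)
  also have "\<dots> = (\<integral>\<^sup>+z. f (S (T z)) \<partial>lborel)"
    using nn_integral_shear_Re[of "\<lambda>z. f (S (T z))" s] unfolding S_def[symmetric] by simp
  also have "\<dots> = (\<integral>\<^sup>+z. f (S z) \<partial>lborel)"
    using nn_integral_shear_Im[of "\<lambda>z. f (S z)" "Im c"] unfolding T_def[symmetric] by simp
  also have "\<dots> = (\<integral>\<^sup>+z. f z \<partial>lborel)"
    using nn_integral_shear_Re[of f s] unfolding S_def[symmetric] by simp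
  finally show "emeasure (distr lborel borel ((*) c)) A = emeasure lborel A"
    by (simp add: f_def)
qed simp

text \<open>This takes the place of polar coordinates: the disk
  \<open>cmod z powr \<rho> \<le> s\<close> has area \<open>pi * s powr (2 / \<rho>)\<close>, and
  half-lines generate the Borel sets.\<close>

lemma distr_cmod_powr:
  assumes \<rho>: "0 < \<rho>"
  shows "distr (lborel :: complex measure) borel (\<lambda>z. cmod z powr \<rho>) =
    density lborel (\<lambda>s. ennreal (indicator {0..} s * (pi * (2 / \<rho>) * s powr (2 / \<rho> - 1))))"
    (is "?M = density lborel ?f")
proof -
  have M: "emeasure ?M {..s} = ennreal (if 0 \<le> s then pi * s powr (2 / \<rho>) else 0)" for s
  proof -
    have "(\<lambda>z. cmod z powr \<rho>) -` {..s} = (if 0 \<le> s then cball 0 (s powr (1 / \<rho>)) else {})"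
    proof (cases "0 \<le> s")
      case True
      have "cmod z powr \<rho> \<le> s \<longleftrightarrow> cmod z \<le> s powr (1 / \<rho>)" for z
      proof
        assume "cmod z powr \<rho> \<le> s"
        then have "(cmod z powr \<rho>) powr (1 / \<rho>) \<le> s powr (1 / \<rho>)" using \<rho> by (intro powr_mono2) auto
        then show "cmod z \<le> s powr (1 / \<rho>)" using \<rho> by (simp add: powr_powr)
      next
        assume "cmod z \<le> s powr (1 / \<rho>)"
        then have "cmod z powr \<rho> \<le> (s powr (1 / \<rho>)) powr \<rho>" using \<rho> by (intro powr_mono2) auto
        then show "cmod z powr \<rho> \<le> s" using \<rho> True by (simp add: powr_powr)
      qed
      then show ?thesis using True by auto
    next
      case False
      then have "\<not> cmod z powr \<rho> \<le> s" for z using powr_ge_zero[of "cmod z" \<rho>] by linarith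
      then show ?thesis using False by auto
    qed
    moreover have "(s powr (1 / \<rho>)) ^ 2 = s powr (2 / \<rho>)"
      by (cases "s = 0") (simp_all add: powr_power)
    ultimately show ?thesis
      by (subst emeasure_distr) (auto simp: emeasure_cball unit_ball_vol_2)
  qed
  have D: "emeasure (density lborel ?f) {..s} = ennreal (if 0 \<le> s then pi * s powr (2 / \<rho>) else 0)" for s
  proof (cases "0 \<le> s")
    case True
    have hi: "((\<lambda>x. pi * (2 / \<rho>) * x powr (2 / \<rho> - 1)) has_integral
        pi * (2 / \<rho>) * (s powr (2 / \<rho> - 1 + 1) / (2 / \<rho> - 1 + 1))) {0..s}"
      using True \<rho> by (intro has_integral_mult_right has_integral_powr_from_0) auto
    have "emeasure (density lborel ?f) {..s} =
        (\<integral>\<^sup>+u. ennreal (indicator {0..s} u * (pi * (2 / \<rho>) * u powr (2 / \<rho> - 1))) \<partial>lborel)"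
      by (subst emeasure_density) (auto intro!: nn_integral_cong simp: indicator_def)
    also have "\<dots> = ennreal (pi * (2 / \<rho>) * (s powr (2 / \<rho> - 1 + 1) / (2 / \<rho> - 1 + 1)))"
      using nn_integral_has_integral_lebesgue[OF _ hi] \<rho> by simp
    also have "\<dots> = ennreal (pi * s powr (2 / \<rho>))" using \<rho> by simp
    finally show ?thesis using True by simp
  next
    case False
    have "emeasure (density lborel ?f) {..s} = (\<integral>\<^sup>+u. ?f u * indicator {..s} u \<partial>lborel)"
      by (rule emeasure_density) auto
    also have "(\<lambda>u. ?f u * indicator {..s} u) = (\<lambda>_. 0)" using False by (auto simp: indicator_def)
    finally have "emeasure (density lborel ?f) {..s} = 0" by simp
    then show ?thesis using False by simp
  qed
  show ?thesis
  proof (rule measure_eqI_generator_eq[where E = "range atMost" and \<Omega> = UNIV and A = "\<lambda>i. {..real i}"])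
    show "Int_stable (range atMost :: real set set)"
      by (auto simp: Int_stable_def)
    show "emeasure ?M X = emeasure (density lborel ?f) X" if "X \<in> range atMost" for X
      using that M D by auto
    show "sets ?M = sigma_sets UNIV (range atMost)" "sets (density lborel ?f) = sigma_sets UNIV (range atMost)"
      by (simp_all add: borel_eq_atMost)
    show "(\<Union>i. {..real i}) = UNIV" using real_arch_simple by auto
    show "emeasure ?M {..real i} \<noteq> \<infinity>" for i by (simp only: M) simp
  qed auto
qed

text \<open>Normalized, for \<open>0 < \<rho>\<close>, so that the squared modulus has integral 1
  over the plane and the products \<open>ml_fun \<rho> n u * cnj (ml_fun \<rho> n w)\<close> sum to
  the kernel.\<close>

definition ml_fun :: "real \<Rightarrow> nat \<Rightarrow> complex \<Rightarrow> complex" where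
  "ml_fun \<rho> n z = of_real (sqrt (\<rho> / (2 * pi * Gamma (2 / \<rho> * (real n + 1)))) * exp (- (cmod z powr \<rho>) / 2)) * z ^ n"

lemma ml_fun_measurable [measurable]: "ml_fun \<rho> n \<in> borel_measurable borel"
  unfolding ml_fun_def[abs_def] by measurable

lemma measurable_ml_fun_product [measurable]:
  "(\<lambda>z. ml_fun \<rho> j z * cnj (ml_fun \<rho> k z)) \<in> borel_measurable borel"
proof -
  have [measurable]: "cnj \<in> borel_measurable borel"
    by (intro borel_measurable_continuous_onI continuous_intros)
  show ?thesis by measurable
qed

lemma measurable_indicator_ml_fun_product [measurable]:
  "(\<lambda>z. indicator (ball 0 t) z *\<^sub>R (ml_fun \<rho> j z * cnj (ml_fun \<rho> k z))) \<in> borel_measurable borel"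
proof -
  have [measurable]: "ball (0 :: complex) t \<in> sets borel" by simp
  show ?thesis by measurable
qed

lemma integrable_ml_fun_product:
  assumes "0 \<le> t"
  shows "integrable lborel (\<lambda>z. indicator (ball 0 t) z *\<^sub>R (ml_fun \<rho> j z * cnj (ml_fun \<rho> k z)))"
proof (rule integrableI_bounded_set_indicator[where B = "\<bar>sqrt (\<rho> / (2 * pi * Gamma (2 / \<rho> * (real j + 1))))\<bar> * t ^ j *
      (\<bar>sqrt (\<rho> / (2 * pi * Gamma (2 / \<rho> * (real k + 1))))\<bar> * t ^ k)"])
  have le: "cmod (ml_fun \<rho> n z) \<le> \<bar>sqrt (\<rho> / (2 * pi * Gamma (2 / \<rho> * (real n + 1))))\<bar> * t ^ n"
    if "cmod z \<le> t" for n z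
  proof -
    have "cmod (ml_fun \<rho> n z) = \<bar>sqrt (\<rho> / (2 * pi * Gamma (2 / \<rho> * (real n + 1))))\<bar> *
        exp (- (cmod z powr \<rho>) / 2) * cmod z ^ n"
      by (simp only: ml_fun_def norm_mult norm_of_real norm_power abs_mult abs_exp_cancel)
    also have "\<dots> \<le> \<bar>sqrt (\<rho> / (2 * pi * Gamma (2 / \<rho> * (real n + 1))))\<bar> * 1 * t ^ n"
      using that by (intro mult_mono power_mono) auto
    finally show ?thesis by simp
  qed
  show "AE z\<in>ball 0 t in lborel. norm (ml_fun \<rho> j z * cnj (ml_fun \<rho> k z)) \<le>
      \<bar>sqrt (\<rho> / (2 * pi * Gamma (2 / \<rho> * (real j + 1))))\<bar> * t ^ j *
      (\<bar>sqrt (\<rho> / (2 * pi * Gamma (2 / \<rho> * (real k + 1))))\<bar> * t ^ k)"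
    unfolding norm_mult complex_mod_cnj using assms by (intro AE_I2 impI mult_mono le mult_nonneg_nonneg) auto
qed (use assms measurable_ml_fun_product in \<open>auto simp: emeasure_ball\<close>)

text \<open>Turning by the angle \<open>pi / (2 * d)\<close> multiplies the integrand by
  \<open>\<i>\<close> or \<open>- \<i>\<close> but preserves the integral, which must vanish. The
  angle is at most \<open>pi / 2\<close>, clear of the excluded half turn.\<close>

lemma ml_fun_orthogonal:
  assumes "j \<noteq> k"
  shows "(\<integral>z. indicator (ball 0 t) z *\<^sub>R (ml_fun \<rho> j z * cnj (ml_fun \<rho> k z)) \<partial>lborel) = 0"
proof -
  define g where "g z = indicator (ball 0 t) z *\<^sub>R (ml_fun \<rho> j z * cnj (ml_fun \<rho> k z))" for z
  have [measurable]: "g \<in> borel_measurable borel"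
    unfolding g_def[abs_def] by (rule measurable_indicator_ml_fun_product)
  define d where "d = \<bar>real j - real k\<bar>"
  have d: "1 \<le> d" using assms by (simp add: d_def)
  define \<theta> where "\<theta> = pi / (2 * d)"
  define c where "c = cis \<theta>"
  have "0 < \<theta>" "\<theta> \<le> pi / 2" using d by (auto simp: \<theta>_def field_simps)
  then have "0 \<le> cos \<theta>" by (intro cos_ge_zero) auto
  then have c: "cmod c = 1" "Re c \<noteq> - 1" by (simp_all add: c_def)
  define w where "w = c ^ j * cnj c ^ k"
  have "w = cis (real j * \<theta>) * cis (- (real k * \<theta>))"
    by (simp add: w_def c_def Complex.DeMoivre cis_cnj)
  also have "\<dots> = cis ((real j - real k) * \<theta>)" by (simp add: cis_mult algebra_simps)
  finally have w: "w = cis ((real j - real k) * \<theta>)" .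
  have "d * \<theta> = pi / 2" using d by (simp add: \<theta>_def)
  moreover have "real j - real k = d \<or> real j - real k = - d" by (auto simp: d_def abs_if)
  ultimately have "(real j - real k) * \<theta> = pi / 2 \<or> (real j - real k) * \<theta> = - (pi / 2)"
    by auto
  then have "w \<noteq> 1"
  proof
    assume e: "(real j - real k) * \<theta> = pi / 2"
    show ?thesis unfolding w e by (simp add: complex_eq_iff)
  next
    assume e: "(real j - real k) * \<theta> = - (pi / 2)"
    show ?thesis unfolding w e by (simp add: complex_eq_iff)
  qed
  have gc: "g (c * z) = w * g z" for z
  proof -
    have "ml_fun \<rho> n (c * z) = c ^ n * ml_fun \<rho> n z" for n
      by (simp add: ml_fun_def norm_mult c power_mult_distrib mult_ac)
    then show ?thesis using c by (simp add: g_def w_def norm_mult indicator_def mult_ac)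
  qed
  have "integral\<^sup>L lborel g = integral\<^sup>L (distr lborel borel ((*) c)) g"
    by (simp add: lborel_distr_rotation[OF c])
  also have "\<dots> = (\<integral>z. g (c * z) \<partial>lborel)" by (subst integral_distr) auto
  also have "\<dots> = w * integral\<^sup>L lborel g" by (simp add: gc)
  finally have "integral\<^sup>L lborel g = 0" using \<open>w \<noteq> 1\<close> by simp
  then show ?thesis by (simp add: g_def[abs_def])
qed

lemma ml_fun_norm:
  assumes \<rho>: "0 < \<rho>" and t: "0 < t"
  shows "(\<integral>z. indicator (ball 0 t) z *\<^sub>R (ml_fun \<rho> n z * cnj (ml_fun \<rho> n z)) \<partial>lborel) =
    of_real (gamma_cdf (2 / \<rho> * (real n + 1)) (t powr \<rho>))"
proof -
  define y where "y = 2 / \<rho> * (real n + 1)"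
  have y: "0 < y" using \<rho> by (simp add: y_def)
  have G: "0 < Gamma y" using y by (simp add: Gamma_real_pos)
  define x where "x = t powr \<rho>"
  have x: "0 < x" using t by (simp add: x_def)
  define h where "h s = indicator {..<x} s * (\<rho> / (2 * pi * Gamma y) * s powr (2 / \<rho> * real n) * exp (- s))" for s :: real
  have [measurable]: "h \<in> borel_measurable borel" unfolding h_def[abs_def] by measurable
  \<comment> \<open>The origin, a null set, is excluded: for \<open>n = 0\<close> the power
    \<open>0 ^ 0\<close> is 1 while \<open>0 powr 0\<close> is 0.\<close>
  have eq: "indicator (ball 0 t) z *\<^sub>R (ml_fun \<rho> n z * cnj (ml_fun \<rho> n z)) = complex_of_real (h (cmod z powr \<rho>))"
    if "z \<noteq> 0" for z
  proof -
    have "ml_fun \<rho> n z * cnj (ml_fun \<rho> n z) = of_real ((cmod (ml_fun \<rho> n z))\<^sup>2)"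
      by (rule complex_norm_square[symmetric])
    also have "(cmod (ml_fun \<rho> n z))\<^sup>2 = \<rho> / (2 * pi * Gamma y) * (exp (- (cmod z powr \<rho>) / 2))\<^sup>2 * (cmod z ^ n)\<^sup>2"
      unfolding ml_fun_def y_def[symmetric] using \<rho> G by (simp add: norm_mult norm_power power_mult_distrib)
    also have "(exp (- (cmod z powr \<rho>) / 2))\<^sup>2 = exp (- (cmod z powr \<rho>))"
      by (simp add: exp_double[symmetric])
    also have "(cmod z ^ n)\<^sup>2 = (cmod z powr \<rho>) powr (2 / \<rho> * real n)"
      using that \<rho> by (simp add: powr_powr powr_realpow[symmetric] power_mult[symmetric] mult.commute)
    finally have 1: "ml_fun \<rho> n z * cnj (ml_fun \<rho> n z) =
        of_real (\<rho> / (2 * pi * Gamma y) * exp (- (cmod z powr \<rho>)) * (cmod z powr \<rho>) powr (2 / \<rho> * real n))" .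
    have "cmod z < t \<longleftrightarrow> cmod z powr \<rho> < x"
      unfolding x_def using \<rho> t by (metis norm_ge_zero powr_less_mono2 powr_mono2 linorder_not_less less_imp_le)
    then show ?thesis unfolding 1 h_def by (simp add: indicator_def mult_ac)
  qed
  have "(\<integral>z. indicator (ball 0 t) z *\<^sub>R (ml_fun \<rho> n z * cnj (ml_fun \<rho> n z)) \<partial>lborel) =
      (\<integral>z. complex_of_real (h (cmod z powr \<rho>)) \<partial>lborel)"
    by (rule integral_cong_AE) (auto intro!: eventually_mono[OF AE_lborel_singleton[of 0]] eq)
  also have "\<dots> = of_real (\<integral>z. h (cmod z powr \<rho>) \<partial>lborel)" by simp
  also have "(\<integral>z. h (cmod z powr \<rho>) \<partial>(lborel :: complex measure)) = integral\<^sup>L (distr (lborel :: complex measure) borel (\<lambda>z. cmod z powr \<rho>)) h"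
    by (subst integral_distr) auto
  also have "\<dots> = (\<integral>s. indicator {0..} s * (pi * (2 / \<rho>) * s powr (2 / \<rho> - 1)) * h s \<partial>lborel)"
    unfolding distr_cmod_powr[OF \<rho>] using \<rho> by (subst integral_density) auto
  \<comment> \<open>The open disk gives \<open>s < x\<close> while \<open>gamma_lower\<close> uses
    the closed interval; they differ at the single point \<open>x\<close>.\<close>
  also have "\<dots> = (\<integral>s. indicator {0..x} s * (s powr (y - 1) * exp (- s)) / Gamma y \<partial>lborel)"
  proof (rule integral_cong_AE)
    have e: "s powr (2 / \<rho> - 1) * s powr (2 / \<rho> * real n) = s powr (y - 1)" for s :: real
      by (simp add: powr_add[symmetric] y_def algebra_simps add_divide_distrib)
    have "indicator {0..} s * (pi * (2 / \<rho>) * s powr (2 / \<rho> - 1)) * h s =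
        indicator {0..x} s * (s powr (y - 1) * exp (- s)) / Gamma y" if "s \<noteq> x" for s
      unfolding e[symmetric] h_def using that \<rho> G by (auto simp: indicator_def)
    then show "AE s in lborel. indicator {0..} s * (pi * (2 / \<rho>) * s powr (2 / \<rho> - 1)) * h s =
        indicator {0..x} s * (s powr (y - 1) * exp (- s)) / Gamma y"
      by (auto intro!: eventually_mono[OF AE_lborel_singleton[of x]])
  qed auto
  also have "\<dots> = gamma_cdf y x" by (simp add: gamma_cdf_def gamma_lower_def)
  finally show ?thesis by (simp add: y_def x_def)
qed

section \<open>Integrals of Gram determinants\<close>

lemma det_mat_rows:
  fixes f :: "nat \<times> nat \<Rightarrow> 'a::comm_ring_1"
  shows "Determinant.det (mat k k f) = (\<Sum>\<sigma> | \<sigma> permutes {..<k}. of_int (sign \<sigma>) * (\<Prod>i<k. f (i, \<sigma> i)))"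
  unfolding lessThan_atLeast0
proof (subst det_def')
  show "mat k k f \<in> carrier_mat k k" by simp
  have "(\<Prod>i = 0..<k. mat k k f $$ (i, \<sigma> i)) = (\<Prod>i = 0..<k. f (i, \<sigma> i))" if "\<sigma> permutes {0..<k}" for \<sigma>
  proof (rule prod.cong[OF refl])
    fix i assume "i \<in> {0..<k}"
    moreover then have "\<sigma> i \<in> {0..<k}" by (simp only: permutes_in_image[OF that])
    ultimately show "mat k k f $$ (i, \<sigma> i) = f (i, \<sigma> i)" by simp
  qed
  then show "(\<Sum>\<sigma> | \<sigma> permutes {0..<k}. signof \<sigma> * (\<Prod>i = 0..<k. mat k k f $$ (i, \<sigma> i))) =
      (\<Sum>\<sigma> | \<sigma> permutes {0..<k}. of_int (sign \<sigma>) * (\<Prod>i = 0..<k. f (i, \<sigma> i)))"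
    by (intro sum.cong) simp_all
qed

lemma det_mat_cols:
  fixes f :: "nat \<times> nat \<Rightarrow> 'a::comm_ring_1"
  shows "Determinant.det (mat k k f) = (\<Sum>\<sigma> | \<sigma> permutes {..<k}. of_int (sign \<sigma>) * (\<Prod>j<k. f (\<sigma> j, j)))"
  unfolding lessThan_atLeast0
proof (subst det_col)
  show "mat k k f \<in> carrier_mat k k" by simp
  have "(\<Prod>j<k. mat k k f $$ (\<sigma> j, j)) = (\<Prod>j = 0..<k. f (\<sigma> j, j))" if "\<sigma> permutes {0..<k}" for \<sigma>
  proof (rule prod.cong)
    fix j assume "j \<in> {0..<k}"
    moreover then have "\<sigma> j \<in> {0..<k}" by (simp only: permutes_in_image[OF that])
    ultimately show "mat k k f $$ (\<sigma> j, j) = f (\<sigma> j, j)" by simp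
  qed (simp add: lessThan_atLeast0)
  then show "(\<Sum>\<sigma> | \<sigma> permutes {0..<k}. signof \<sigma> * (\<Prod>j<k. mat k k f $$ (\<sigma> j, j))) =
      (\<Sum>\<sigma> | \<sigma> permutes {0..<k}. of_int (sign \<sigma>) * (\<Prod>j = 0..<k. f (\<sigma> j, j)))"
    by (intro sum.cong) simp_all
qed

lemma det_mat_permute_rows:
  fixes f :: "nat \<times> nat \<Rightarrow> 'a::comm_ring_1"
  assumes "\<sigma> permutes {..<k}"
  shows "Determinant.det (mat k k (\<lambda>(i, j). f (\<sigma> i, j))) = of_int (sign \<sigma>) * Determinant.det (mat k k f)"
proof -
  have p: "\<sigma> permutes {0..<k}" using assms by (simp only: lessThan_atLeast0)
  have "mat k k (\<lambda>(i, j). f (\<sigma> i, j)) = mat k k (\<lambda>(i, j). mat k k f $$ (\<sigma> i, j))"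
  proof (rule cong_mat)
    fix i j assume "i < k" "j < k"
    moreover then have "\<sigma> i < k" using permutes_in_image[OF p, of i] by simp
    ultimately show "(\<lambda>(i, j). f (\<sigma> i, j)) (i, j) = (\<lambda>(i, j). mat k k f $$ (\<sigma> i, j)) (i, j)" by simp
  qed simp_all
  then show ?thesis using det_permute_rows[OF _ p, of "mat k k f"] by simp
qed

lemma det_mat_eq_rows:
  fixes f :: "nat \<times> nat \<Rightarrow> 'a::comm_ring_1"
  assumes "i < k" "j < k" "i \<noteq> j" "\<And>l. l < k \<Longrightarrow> f (i, l) = f (j, l)"
  shows "Determinant.det (mat k k f) = 0"
  by (rule det_identical_rows[of _ k i j]) (use assms in \<open>auto intro!: eq_vecI\<close>)

text \<open>The unnormalized Slater determinant of the functions selected by \<open>c\<close>, at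
  the points \<open>z\<close>.\<close>

definition slater :: "(nat \<Rightarrow> 'a \<Rightarrow> complex) \<Rightarrow> nat \<Rightarrow> (nat \<Rightarrow> nat) \<Rightarrow> (nat \<Rightarrow> 'a) \<Rightarrow> complex" where
  "slater \<psi> k c z = Determinant.det (mat k k (\<lambda>(i, j). \<psi> (c i) (z j)))"

text \<open>The determinant belonging to the truncation of the kernel
  \<open>\<Sum>n. \<psi> n u * cnj (\<psi> n w)\<close> to its first \<open>K\<close> terms.\<close>

definition gram_det :: "(nat \<Rightarrow> 'a \<Rightarrow> complex) \<Rightarrow> nat \<Rightarrow> nat \<Rightarrow> (nat \<Rightarrow> 'a) \<Rightarrow> complex" where
  "gram_det \<psi> K k z = Determinant.det (mat k k (\<lambda>(i, j). \<Sum>n<K. \<psi> n (z i) * cnj (\<psi> n (z j))))"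

lemma cnj_slater: "cnj (slater \<psi> k c z) = (\<Sum>\<sigma> | \<sigma> permutes {..<k}. of_int (sign \<sigma>) * (\<Prod>i<k. cnj (\<psi> (c i) (z (\<sigma> i)))))"
  unfolding slater_def det_mat_rows by simp

text \<open>Cauchy--Binet for a Gram matrix, obtained by expanding the entries and symmetrizing over
  the order of the indices.\<close>

lemma gram_det_eq_sum_slater:
  "of_nat (fact k) * gram_det \<psi> K k z =
     complex_of_real (\<Sum>c\<in>PiE {..<k} (\<lambda>_. {..<K}). (cmod (slater \<psi> k c z))\<^sup>2)"
proof -
  let ?P = "PiE {..<k} (\<lambda>_. {..<K})"
  let ?S = "{\<sigma>. \<sigma> permutes {..<k}}"
  define F where "F c = (\<Prod>i<k. \<psi> (c i) (z i)) * cnj (slater \<psi> k c z)" for c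
  have "gram_det \<psi> K k z =
      (\<Sum>\<sigma>\<in>?S. of_int (sign \<sigma>) * (\<Sum>c\<in>?P. \<Prod>i<k. \<psi> (c i) (z i) * cnj (\<psi> (c i) (z (\<sigma> i)))))"
    unfolding gram_det_def det_mat_rows by (simp add: prod_sum_PiE)
  also have "\<dots> = (\<Sum>c\<in>?P. \<Sum>\<sigma>\<in>?S. (\<Prod>i<k. \<psi> (c i) (z i)) * (of_int (sign \<sigma>) * (\<Prod>i<k. cnj (\<psi> (c i) (z (\<sigma> i))))))"
    by (subst sum.swap) (simp add: sum_distrib_left prod.distrib mult_ac)
  also have "\<dots> = (\<Sum>c\<in>?P. F c)"
    by (simp only: F_def cnj_slater sum_distrib_left)
  finally have gram: "gram_det \<psi> K k z = (\<Sum>c\<in>?P. F c)" .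
  \<comment> \<open>Reindexing the selections by \<open>\<tau>\<close> leaves the sum unchanged and
    takes \<open>sign \<tau>\<close> out of the Slater determinant; summing over all
    \<open>\<tau>\<close> then assembles a second Slater determinant from the plain product.\<close>
  have permuted: "gram_det \<psi> K k z =
      (\<Sum>c\<in>?P. of_int (sign \<tau>) * (\<Prod>i<k. \<psi> (c (\<tau> i)) (z i)) * cnj (slater \<psi> k c z))" if \<tau>: "\<tau> \<in> ?S" for \<tau>
  proof -
    have \<tau>p: "\<tau> permutes {..<k}" using \<tau> by simp
    have closed: "c \<circ> \<upsilon> \<in> ?P" if "c \<in> ?P" "\<upsilon> permutes {..<k}" for c \<upsilon>
      using that permutes_in_image[OF that(2)] permutes_not_in[OF that(2)]
      by (auto simp: PiE_iff extensional_def)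
    have "(\<Sum>c\<in>?P. F c) = (\<Sum>c\<in>?P. F (c \<circ> \<tau>))"
    proof (rule sum.reindex_bij_witness[of _ "\<lambda>c. c \<circ> \<tau>" "\<lambda>c. c \<circ> inv_into UNIV \<tau>"])
      show "(c \<circ> \<tau>) \<circ> inv_into UNIV \<tau> = c" "(c \<circ> inv_into UNIV \<tau>) \<circ> \<tau> = c" for c :: "nat \<Rightarrow> nat"
        using permutes_inv_o[OF \<tau>p] by (simp_all add: comp_assoc)
    qed (use closed \<tau>p permutes_inv[OF \<tau>p] permutes_inv_o[OF \<tau>p] in \<open>auto simp: comp_assoc\<close>)
    also have "\<dots> = (\<Sum>c\<in>?P. of_int (sign \<tau>) * (\<Prod>i<k. \<psi> (c (\<tau> i)) (z i)) * cnj (slater \<psi> k c z))"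
    proof (rule sum.cong[OF refl])
      fix c
      have "slater \<psi> k (c \<circ> \<tau>) z = of_int (sign \<tau>) * slater \<psi> k c z"
        unfolding slater_def using det_mat_permute_rows[OF \<tau>p, of "\<lambda>(i, j). \<psi> (c i) (z j)"] by simp
      then show "F (c \<circ> \<tau>) = of_int (sign \<tau>) * (\<Prod>i<k. \<psi> (c (\<tau> i)) (z i)) * cnj (slater \<psi> k c z)"
        by (simp add: F_def mult_ac)
    qed
    finally show ?thesis using gram by simp
  qed
  have "card ?S = fact k" by (rule card_permutations) auto
  then have "of_nat (fact k) * gram_det \<psi> K k z = (\<Sum>\<tau>\<in>?S. gram_det \<psi> K k z)" by simp
  also have "\<dots> = (\<Sum>\<tau>\<in>?S. \<Sum>c\<in>?P. of_int (sign \<tau>) * (\<Prod>i<k. \<psi> (c (\<tau> i)) (z i)) * cnj (slater \<psi> k c z))"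
    by (rule sum.cong[OF refl permuted])
  also have "\<dots> = (\<Sum>c\<in>?P. slater \<psi> k c z * cnj (slater \<psi> k c z))"
    by (subst sum.swap) (simp add: slater_def det_mat_cols sum_distrib_right)
  also have "\<dots> = complex_of_real (\<Sum>c\<in>?P. (cmod (slater \<psi> k c z))\<^sup>2)"
    by (simp only: complex_norm_square of_real_sum)
  finally show ?thesis .
qed

lemma Re_gram_det:
  "Re (gram_det \<psi> K k z) = (\<Sum>c\<in>PiE {..<k} (\<lambda>_. {..<K}). (cmod (slater \<psi> k c z))\<^sup>2) / fact k"
proof -
  have "Re (of_nat (fact k) * gram_det \<psi> K k z) = (\<Sum>c\<in>PiE {..<k} (\<lambda>_. {..<K}). (cmod (slater \<psi> k c z))\<^sup>2)"
    unfolding gram_det_eq_sum_slater by simp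
  then show ?thesis by (simp add: field_simps)
qed

text \<open>Enlarging \<open>K\<close> only adds squares. This permits monotone convergence to the
  full kernel.\<close>

lemma Re_gram_det_mono: "K \<le> K' \<Longrightarrow> Re (gram_det \<psi> K k z) \<le> Re (gram_det \<psi> K' k z)"
  unfolding Re_gram_det
  by (intro divide_right_mono sum_mono2 finite_PiE PiE_mono) auto

text \<open>Orthogonal but not orthonormal: restriction to a disk lowers the squared norms from 1 to
  \<open>p n\<close>, which become the success probabilities.\<close>

locale orthogonal_family =
  fixes \<psi> :: "nat \<Rightarrow> complex \<Rightarrow> complex" and p :: "nat \<Rightarrow> real"
  assumes meas [measurable]: "\<psi> n \<in> borel_measurable borel"
    and integrable_product: "integrable lborel (\<lambda>z. \<psi> i z * cnj (\<psi> j z))"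
    and orthogonal: "i \<noteq> j \<Longrightarrow> (\<integral>z. \<psi> i z * cnj (\<psi> j z) \<partial>lborel) = 0"
    and norm_square: "(\<integral>z. \<psi> i z * cnj (\<psi> i z) \<partial>lborel) = of_real (p i)"
    and nonneg: "0 \<le> p i"
begin

lemma slater_measurable [measurable]:
  "slater \<psi> k c \<in> borel_measurable (PiM {..<k} (\<lambda>_. lborel))"
  unfolding slater_def det_mat_cols by measurable

lemma gram_det_measurable [measurable]:
  "(\<lambda>z. Re (gram_det \<psi> K k z)) \<in> borel_measurable (PiM {..<k} (\<lambda>_. lborel))"
  unfolding Re_gram_det by measurable

text \<open>Expand both determinants. By Fubini a pair of permutations contributes a product of
  one-variable inner products, which vanishes unless the permutations agree, by injectivity of
  \<open>c\<close>; the \<open>fact k\<close> diagonal pairs contribute equally.\<close>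

lemma integral_slater:
  assumes inj: "inj_on c {..<k}"
  shows "has_bochner_integral (PiM {..<k} (\<lambda>_. lborel))
    (\<lambda>z. slater \<psi> k c z * cnj (slater \<psi> k c z)) (of_real (fact k * (\<Prod>i<k. p (c i))))"
proof -
  interpret P: product_sigma_finite "\<lambda>_ :: nat. lborel :: complex measure" ..
  let ?S = "{\<sigma>. \<sigma> permutes {..<k}}"
  have fin: "finite ?S" by (rule finite_permutations) simp
  define f where "f \<sigma> \<tau> j w = \<psi> (c (\<sigma> j)) w * cnj (\<psi> (c (\<tau> j)) w)" for \<sigma> \<tau> :: "nat \<Rightarrow> nat" and j w
  have int_f: "integrable lborel (f \<sigma> \<tau> j)" for \<sigma> \<tau> j
    unfolding f_def[abs_def] by (rule integrable_product)
  have prod_int: "has_bochner_integral (PiM {..<k} (\<lambda>_. lborel)) (\<lambda>z. \<Prod>j<k. f \<sigma> \<tau> j (z j))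
      (\<Prod>j<k. integral\<^sup>L lborel (f \<sigma> \<tau> j))" for \<sigma> \<tau>
    using P.product_integrable_prod[of "{..<k}" "f \<sigma> \<tau>"] P.product_integral_prod[of "{..<k}" "f \<sigma> \<tau>"] int_f
    by (simp add: has_bochner_integral_iff)
  have val: "(\<Prod>j<k. integral\<^sup>L lborel (f \<sigma> \<tau> j)) = (if \<tau> = \<sigma> then of_real (\<Prod>i<k. p (c i)) else 0)"
    if \<sigma>: "\<sigma> \<in> ?S" and \<tau>: "\<tau> \<in> ?S" for \<sigma> \<tau>
  proof (cases "\<tau> = \<sigma>")
    case True
    have "(\<Prod>j<k. integral\<^sup>L lborel (f \<sigma> \<tau> j)) = (\<Prod>j<k. of_real (p (c (\<sigma> j))))"
      unfolding True f_def by (simp add: norm_square)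
    also have "\<dots> = (\<Prod>i<k. of_real (p (c i)))"
      using \<sigma> prod.permute[of \<sigma> "{..<k}" "\<lambda>i. complex_of_real (p (c i))"] by (simp add: comp_def)
    finally show ?thesis using True by simp
  next
    case False
    then obtain j where j: "\<sigma> j \<noteq> \<tau> j" by (metis ext)
    have "j < k"
    proof (rule ccontr)
      assume "\<not> j < k"
      then have "\<sigma> j = j" "\<tau> j = j" using \<sigma> \<tau> by (auto simp: permutes_def)
      then show False using j by simp
    qed
    moreover have "\<sigma> j < k" "\<tau> j < k"
      using \<sigma> \<tau> \<open>j < k\<close> permutes_in_image[of \<sigma> "{..<k}" j] permutes_in_image[of \<tau> "{..<k}" j] by auto
    then have "c (\<sigma> j) \<noteq> c (\<tau> j)" using inj j by (auto simp: inj_on_def)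
    then have "integral\<^sup>L lborel (f \<sigma> \<tau> j) = 0" unfolding f_def[abs_def] by (rule orthogonal)
    ultimately show ?thesis using False by (auto intro!: prod_zero)
  qed
  have expand: "slater \<psi> k c z * cnj (slater \<psi> k c z) =
      (\<Sum>\<sigma>\<in>?S. \<Sum>\<tau>\<in>?S. of_int (sign \<sigma>) * of_int (sign \<tau>) * (\<Prod>j<k. f \<sigma> \<tau> j (z j)))" for z
    unfolding slater_def det_mat_cols f_def
    by (simp add: sum_product prod.distrib mult_ac)
  have "has_bochner_integral (PiM {..<k} (\<lambda>_. lborel)) (\<lambda>z. slater \<psi> k c z * cnj (slater \<psi> k c z))
      (\<Sum>\<sigma>\<in>?S. \<Sum>\<tau>\<in>?S. of_int (sign \<sigma>) * of_int (sign \<tau>) * (\<Prod>j<k. integral\<^sup>L lborel (f \<sigma> \<tau> j)))"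
    unfolding expand by (intro has_bochner_integral_sum has_bochner_integral_mult_right prod_int)
  also have "(\<Sum>\<sigma>\<in>?S. \<Sum>\<tau>\<in>?S. of_int (sign \<sigma>) * of_int (sign \<tau>) * (\<Prod>j<k. integral\<^sup>L lborel (f \<sigma> \<tau> j))) =
      (\<Sum>\<sigma>\<in>?S. \<Sum>\<tau>\<in>?S. if \<tau> = \<sigma> then of_real (\<Prod>i<k. p (c i)) else 0)"
  proof (intro sum.cong refl)
    fix \<sigma> \<tau> assume st: "\<sigma> \<in> ?S" "\<tau> \<in> ?S"
    have "of_int (sign \<sigma>) * of_int (sign \<sigma>) = (1 :: complex)"
      by (metis of_int_mult sign_idempotent of_int_1)
    then show "of_int (sign \<sigma>) * of_int (sign \<tau>) * (\<Prod>j<k. integral\<^sup>L lborel (f \<sigma> \<tau> j)) =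
        (if \<tau> = \<sigma> then of_real (\<Prod>i<k. p (c i)) else 0)"
      by (simp add: val[OF st])
  qed
  also have "\<dots> = (\<Sum>\<sigma>\<in>?S. of_real (\<Prod>i<k. p (c i)))"
    using fin by (intro sum.cong refl) (simp add: sum.delta)
  also have "\<dots> = of_real (fact k * (\<Prod>i<k. p (c i)))"
  proof -
    have "card ?S = fact k" by (rule card_permutations) auto
    then show ?thesis by simp
  qed
  finally show ?thesis .
qed

lemma nn_integral_slater:
  "(\<integral>\<^sup>+z. ennreal ((cmod (slater \<psi> k c z))\<^sup>2) \<partial>PiM {..<k} (\<lambda>_. lborel)) =
    (if inj_on c {..<k} then ennreal (fact k * (\<Prod>i<k. p (c i))) else 0)"
proof (cases "inj_on c {..<k}")
  case True
  have "has_bochner_integral (PiM {..<k} (\<lambda>_. lborel)) (\<lambda>z. Re (complex_of_real ((cmod (slater \<psi> k c z))\<^sup>2)))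
      (Re (of_real (fact k * (\<Prod>i<k. p (c i)))))"
    unfolding complex_norm_square by (intro has_bochner_integral_bounded_linear[OF bounded_linear_Re] integral_slater True)
  then have "has_bochner_integral (PiM {..<k} (\<lambda>_. lborel)) (\<lambda>z. (cmod (slater \<psi> k c z))\<^sup>2) (fact k * (\<Prod>i<k. p (c i)))"
    by (simp only: Re_complex_of_real)
  then show ?thesis
    using True by (simp add: has_bochner_integral_iff nn_integral_eq_integral)
next
  case False
  then obtain i j where ij: "i < k" "j < k" "i \<noteq> j" "c i = c j" by (auto simp: inj_on_def)
  then have "slater \<psi> k c z = 0" for z
    unfolding slater_def by (intro det_mat_eq_rows[of i k j]) auto
  then show ?thesis using False by simp
qed

text \<open>The \<open>1 / fact k\<close> of \<open>Re_gram_det\<close> cancels the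
  \<open>fact k\<close> of each Slater integral; the \<open>fact k\<close> in the result counts the
  orders of a \<open>k\<close>-set of indices.\<close>

lemma nn_integral_gram_det:
  "(\<integral>\<^sup>+z. ennreal (Re (gram_det \<psi> K k z)) \<partial>PiM {..<k} (\<lambda>_. lborel)) = ennreal (fact k * esym p {..<K} k)"
proof -
  let ?P = "PiE {..<k} (\<lambda>_. {..<K})"
  let ?M = "PiM {..<k} (\<lambda>_. lborel :: complex measure)"
  have "ennreal (Re (gram_det \<psi> K k z)) = (\<Sum>c\<in>?P. ennreal (1 / fact k) * ennreal ((cmod (slater \<psi> k c z))\<^sup>2))" for z
    unfolding Re_gram_det by (simp add: ennreal_mult[symmetric] sum_ennreal sum_divide_distrib)
  then have "(\<integral>\<^sup>+z. ennreal (Re (gram_det \<psi> K k z)) \<partial>?M) =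
      (\<Sum>c\<in>?P. ennreal (1 / fact k) * (\<integral>\<^sup>+z. ennreal ((cmod (slater \<psi> k c z))\<^sup>2) \<partial>?M))"
    by (simp add: nn_integral_sum nn_integral_cmult)
  also have "\<dots> = (\<Sum>c\<in>?P. if inj_on c {..<k} then ennreal (\<Prod>i<k. p (c i)) else 0)"
    unfolding nn_integral_slater
    by (intro sum.cong refl) (auto simp: ennreal_mult[symmetric] prod_nonneg nonneg)
  also have "\<dots> = (\<Sum>c | c \<in> ?P \<and> inj_on c {..<k}. ennreal (\<Prod>i<k. p (c i)))"
    by (intro sum.mono_neutral_cong_right) (auto intro: finite_PiE)
  also have "\<dots> = ennreal (\<Sum>c | c \<in> ?P \<and> inj_on c {..<k}. \<Prod>i<k. p (c i))"
    by (intro sum_ennreal prod_nonneg nonneg)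
  also have "(\<Sum>c | c \<in> ?P \<and> inj_on c {..<k}. \<Prod>i<k. p (c i)) = fact k * esym p {..<K} k"
    using sum_inj_PiE_eq_esym[where I = "{..<K}" and k = k and w = p] by simp
  finally show ?thesis .
qed

end

section \<open>Series expansion of the Mittag-Leffler kernel\<close>

lemma Gamma_ge:
  fixes y R :: real
  assumes "1 \<le> y" "0 < R"
  shows "R powr (y - 1) * exp (- (R + 1)) \<le> Gamma y"
proof -
  have "R powr (y - 1) * exp (- (R + 1)) = R powr (y - 1) * exp (- R) * exp (- 1)"
    by (simp add: exp_add[symmetric])
  also have "\<dots> \<le> gamma_upper y R" by (rule gamma_upper_ge[OF assms])
  also have "\<dots> \<le> Gamma y"
    using gamma_lower_plus_upper[of y R] gamma_lower_pos[of y R] assms by simp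
  finally show ?thesis .
qed

text \<open>By \<open>Gamma_ge\<close> the Gamma function dominates \<open>R powr y\<close> up to a
  constant, with \<open>R\<close> free. The choice \<open>R powr a = 2 * cmod z + 1\<close> makes
  the ratio of the comparison series less than 1 and is positive even at
  \<open>z = 0\<close>.\<close>

lemma summable_mittag_leffler:
  assumes a: "0 < a" and b: "0 < b"
  shows "summable (\<lambda>k. z ^ k / complex_of_real (Gamma (a * real k + b)))"
proof -
  define R where "R = (2 * cmod z + 1) powr (1 / a)"
  define q where "q = cmod z / R powr a"
  have R: "0 < R" "R powr a = 2 * cmod z + 1"
  proof -
    have "0 < 2 * cmod z + 1" using norm_ge_zero[of z] by linarith
    then show "0 < R" "R powr a = 2 * cmod z + 1" using a by (simp_all add: R_def powr_powr)
  qed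
  have base: "0 < 2 * cmod z + 1" using norm_ge_zero[of z] by linarith
  have q: "0 \<le> q" "q < 1"
  proof -
    show "0 \<le> q" using base by (simp add: q_def R(2))
    have "cmod z < 2 * cmod z + 1" using norm_ge_zero[of z] by linarith
    then show "q < 1" using base by (simp add: q_def R(2))
  qed
  define B where "B = exp (R + 1) * R powr (1 - b)"
  show ?thesis
  proof (rule summable_comparison_test_ev)
    show "summable (\<lambda>k. B * q ^ k)" using q by (intro summable_mult summable_geometric) simp
    obtain k0 where k0: "1 / a < real k0" using reals_Archimedean2 by blast
    show "eventually (\<lambda>k. norm (z ^ k / complex_of_real (Gamma (a * real k + b))) \<le> B * q ^ k) sequentially"
    proof (rule eventually_sequentiallyI)
      fix k assume "k0 \<le> k"
      then have "1 / a \<le> real k" using k0 by linarith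
      then have y: "1 \<le> a * real k + b" using a b by (simp add: field_simps)
      let ?y = "a * real k + b"
      define g where "g = R powr (?y - 1) * exp (- (R + 1))"
      have g: "0 < g" "g \<le> Gamma ?y" using R Gamma_ge[OF y R(1)] by (simp_all only: g_def) simp
      have "norm (z ^ k / complex_of_real (Gamma ?y)) = cmod z ^ k / Gamma ?y"
        using g by (simp add: norm_divide norm_power)
      also have "\<dots> \<le> cmod z ^ k / g" using g by (intro divide_left_mono mult_pos_pos) auto
      also have "\<dots> = B * q ^ k"
      proof -
        have "R powr (?y - 1) * R powr (1 - b) = (R powr a) ^ k"
          using R(1) by (simp add: powr_add[symmetric] powr_power mult.commute)
        then have "g * (B * q ^ k) = exp (- (R + 1)) * exp (R + 1) * ((R powr a) ^ k * q ^ k)"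
          by (simp add: g_def B_def mult_ac)
        also have "\<dots> = cmod z ^ k"
          using base by (simp add: exp_add[symmetric] power_mult_distrib[symmetric] q_def R(2) less_imp_neq[THEN not_sym])
        finally show ?thesis using g by (simp add: field_simps)
      qed
      finally show "norm (z ^ k / complex_of_real (Gamma ?y)) \<le> B * q ^ k" .
    qed
  qed
qed

lemma ml_fun_sums_kernel:
  assumes \<rho>: "0 < \<rho>"
  shows "(\<lambda>n. ml_fun \<rho> n u * cnj (ml_fun \<rho> n w)) sums mittag_leffler_kernel \<rho> u w"
proof -
  have "0 < 2 / \<rho>" using \<rho> by simp
  then have "(\<lambda>n. (u * cnj w) ^ n / complex_of_real (Gamma (2 / \<rho> * real n + 2 / \<rho>)))
      sums mittag_leffler (2 / \<rho>) (2 / \<rho>) (u * cnj w)"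
    unfolding mittag_leffler_def by (intro summable_sums summable_mittag_leffler)
  then have "(\<lambda>n. of_real (\<rho> / (2 * pi)) * ((u * cnj w) ^ n / complex_of_real (Gamma (2 / \<rho> * real n + 2 / \<rho>)))
      * of_real (exp (- (cmod u powr \<rho>) / 2 - cmod w powr \<rho> / 2))) sums mittag_leffler_kernel \<rho> u w"
    unfolding mittag_leffler_kernel_def by (intro sums_mult sums_mult2)
  moreover have "ml_fun \<rho> n u * cnj (ml_fun \<rho> n w) =
      of_real (\<rho> / (2 * pi)) * ((u * cnj w) ^ n / complex_of_real (Gamma (2 / \<rho> * real n + 2 / \<rho>)))
      * of_real (exp (- (cmod u powr \<rho>) / 2 - cmod w powr \<rho> / 2))" for n
  proof -
    define G where "G = Gamma (2 / \<rho> * (real n + 1))"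
    have G: "0 < G" using \<rho> by (simp add: G_def Gamma_real_pos)
    have G': "Gamma (2 / \<rho> * real n + 2 / \<rho>) = G" by (simp add: G_def distrib_left)
    have sq: "complex_of_real (sqrt (\<rho> / (2 * pi * G))) * complex_of_real (sqrt (\<rho> / (2 * pi * G))) = of_real (\<rho> / (2 * pi * G))"
      using \<rho> G by (simp add: of_real_mult[symmetric] del: of_real_mult)
    have ex: "exp (- (cmod u powr \<rho>) / 2 - cmod w powr \<rho> / 2) = exp (- (cmod u powr \<rho>) / 2) * exp (- (cmod w powr \<rho>) / 2)"
      by (simp add: exp_add[symmetric])
    have "ml_fun \<rho> n u * cnj (ml_fun \<rho> n w) =
        (complex_of_real (sqrt (\<rho> / (2 * pi * G))) * complex_of_real (sqrt (\<rho> / (2 * pi * G)))) * (u * cnj w) ^ n *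
          (of_real (exp (- (cmod u powr \<rho>) / 2)) * of_real (exp (- (cmod w powr \<rho>) / 2)))"
      unfolding ml_fun_def G_def[symmetric] by (simp add: power_mult_distrib mult_ac)
    also have "\<dots> = of_real (\<rho> / (2 * pi)) * ((u * cnj w) ^ n / complex_of_real G)
        * of_real (exp (- (cmod u powr \<rho>) / 2 - cmod w powr \<rho> / 2))"
      unfolding sq ex by simp
    finally show ?thesis unfolding G' .
  qed
  ultimately show ?thesis by simp
qed

lemma ml_orthogonal_family:
  assumes "0 < \<rho>" "0 < t"
  shows "orthogonal_family (\<lambda>n z. indicator (ball 0 t) z *\<^sub>R ml_fun \<rho> n z)
    (\<lambda>n. gamma_cdf (2 / \<rho> * (real n + 1)) (t powr \<rho>))"
proof -
  have eq: "indicator (ball 0 t) z *\<^sub>R ml_fun \<rho> i z * cnj (indicator (ball 0 t) z *\<^sub>R ml_fun \<rho> j z) =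
      indicator (ball 0 t) z *\<^sub>R (ml_fun \<rho> i z * cnj (ml_fun \<rho> j z))" for i j and z :: complex
    by (simp add: indicator_def)
  show ?thesis
  proof
    show "(\<lambda>z. indicator (ball 0 t) z *\<^sub>R ml_fun \<rho> n z) \<in> borel_measurable borel" for n
    proof -
      have [measurable]: "ball (0 :: complex) t \<in> sets borel" by simp
      show ?thesis by measurable
    qed
    show "0 \<le> gamma_cdf (2 / \<rho> * (real i + 1)) (t powr \<rho>)" for i
      using assms by (intro less_imp_le gamma_cdf_pos) auto
    show "(\<integral>z. indicator (ball 0 t) z *\<^sub>R ml_fun \<rho> i z * cnj (indicator (ball 0 t) z *\<^sub>R ml_fun \<rho> j z) \<partial>lborel) = 0"
      if "i \<noteq> j" for i j
      unfolding eq by (rule ml_fun_orthogonal[OF that])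
  qed (use assms in \<open>simp_all only: eq integrable_ml_fun_product[OF less_imp_le] ml_fun_norm\<close>)
qed

abbreviation ml_det :: "real \<Rightarrow> nat \<Rightarrow> (nat \<Rightarrow> complex) \<Rightarrow> ennreal" where
  "ml_det \<rho> k z \<equiv> ennreal (Re (Determinant.det (mat k k (\<lambda>(i, j). mittag_leffler_kernel \<rho> (z i) (z j)))))"

lemma measurable_mittag_leffler_kernel [measurable]:
  assumes [measurable]: "f \<in> borel_measurable M" "g \<in> borel_measurable M"
  shows "(\<lambda>x. mittag_leffler_kernel \<rho> (f x) (g x)) \<in> borel_measurable M"
proof -
  have [measurable]: "cnj \<in> borel_measurable borel"
    by (intro borel_measurable_continuous_onI continuous_intros)
  show ?thesis
    unfolding mittag_leffler_kernel_def mittag_leffler_def by measurable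
qed

lemma ml_det_measurable [measurable]:
  "ml_det \<rho> k \<in> borel_measurable (PiM {..<k} (\<lambda>_. lborel))"
  unfolding det_mat_rows
proof -
  have "(\<lambda>z. \<Prod>i<k. mittag_leffler_kernel \<rho> (z i) (z (\<sigma> i))) \<in> borel_measurable (PiM {..<k} (\<lambda>_. lborel))"
    if "\<sigma> permutes {..<k}" for \<sigma>
  proof (rule borel_measurable_prod)
    fix i assume "i \<in> {..<k}"
    moreover then have "\<sigma> i \<in> {..<k}" by (simp only: permutes_in_image[OF that])
    ultimately have [measurable]: "(\<lambda>z. z i) \<in> borel_measurable (PiM {..<k} (\<lambda>_. lborel :: complex measure))"
        "(\<lambda>z. z (\<sigma> i)) \<in> borel_measurable (PiM {..<k} (\<lambda>_. lborel :: complex measure))"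
      using measurable_component_singleton[of _ "{..<k}" "\<lambda>_. lborel :: complex measure"] by simp_all
    show "(\<lambda>z. mittag_leffler_kernel \<rho> (z i) (z (\<sigma> i))) \<in> borel_measurable (PiM {..<k} (\<lambda>_. lborel))"
      by measurable
  qed
  then show "(\<lambda>z. ennreal (Re (\<Sum>\<sigma> | \<sigma> permutes {..<k}. of_int (sign \<sigma>) *
      (\<Prod>i<k. (\<lambda>(i, j). mittag_leffler_kernel \<rho> (z i) (z j)) (i, \<sigma> i)))))
      \<in> borel_measurable (PiM {..<k} (\<lambda>_. lborel))"
    by (intro measurable_compose[OF _ measurable_ennreal] measurable_compose[OF _ borel_measurable_Re]
      borel_measurable_sum borel_measurable_times) auto
qed

text \<open>The truncated kernels converge pointwise and their determinants increase, so monotone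
  convergence applies. With the indicator of the disk built into \<open>\<psi>\<close>, a point
  outside the disk produces a zero row, which yields the restriction to \<open>PiE\<close>.\<close>

lemma nn_integral_ml_det:
  assumes \<rho>: "0 < \<rho>" and t: "0 < t"
  shows "(\<integral>\<^sup>+z\<in>PiE {..<k} (\<lambda>_. ball 0 t). ml_det \<rho> k z \<partial>PiM {..<k} (\<lambda>_. lborel)) =
    (SUP K. ennreal (fact k * esym (\<lambda>n. gamma_cdf (2 / \<rho> * (real n + 1)) (t powr \<rho>)) {..<K} k))"
proof -
  define \<psi> where "\<psi> = (\<lambda>n z. indicator (ball 0 t) z *\<^sub>R ml_fun \<rho> n z)"
  interpret orthogonal_family \<psi> "\<lambda>n. gamma_cdf (2 / \<rho> * (real n + 1)) (t powr \<rho>)"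
    unfolding \<psi>_def by (rule ml_orthogonal_family[OF \<rho> t])
  let ?M = "PiM {..<k} (\<lambda>_. lborel :: complex measure)"
  have inc: "incseq (\<lambda>K z. ennreal (Re (gram_det \<psi> K k z)))"
    by (auto simp: incseq_def le_fun_def intro!: ennreal_leI Re_gram_det_mono)
  have pointwise: "(SUP K. ennreal (Re (gram_det \<psi> K k z))) =
      ml_det \<rho> k z * indicator (PiE {..<k} (\<lambda>_. ball 0 t)) z" if z: "z \<in> space ?M" for z
  proof (cases "\<forall>i<k. z i \<in> ball 0 t")
    case True
    have "(\<lambda>K. \<Sum>n<K. \<psi> n (z i) * cnj (\<psi> n (z j))) \<longlonglongrightarrow> mittag_leffler_kernel \<rho> (z i) (z j)"
      if "i < k" "j < k" for i j
      using ml_fun_sums_kernel[OF \<rho>, of "z i" "z j"] True that by (simp add: \<psi>_def sums_def)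
    then have "(\<lambda>K. gram_det \<psi> K k z) \<longlonglongrightarrow> Determinant.det (mat k k (\<lambda>(i, j). mittag_leffler_kernel \<rho> (z i) (z j)))"
      unfolding gram_det_def det_mat_rows
    proof (intro tendsto_sum tendsto_mult tendsto_const tendsto_prod)
      fix \<sigma> i assume lim: "\<And>i j. i < k \<Longrightarrow> j < k \<Longrightarrow>
          (\<lambda>K. \<Sum>n<K. \<psi> n (z i) * cnj (\<psi> n (z j))) \<longlonglongrightarrow> mittag_leffler_kernel \<rho> (z i) (z j)"
        and s: "\<sigma> \<in> {\<sigma>. \<sigma> permutes {..<k}}" and i: "i \<in> {..<k}"
      have "\<sigma> i \<in> {..<k}" using s i permutes_in_image[of \<sigma> "{..<k}" i] by simp
      then show "(\<lambda>K. (\<lambda>(i, j). \<Sum>n<K. \<psi> n (z i) * cnj (\<psi> n (z j))) (i, \<sigma> i)) \<longlonglongrightarrow>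
          (\<lambda>(i, j). mittag_leffler_kernel \<rho> (z i) (z j)) (i, \<sigma> i)"
        using lim[of i "\<sigma> i"] i by simp
    qed
    then have "(\<lambda>K. ennreal (Re (gram_det \<psi> K k z))) \<longlonglongrightarrow> ml_det \<rho> k z"
      by (intro tendsto_ennrealI tendsto_Re)
    moreover have "(\<lambda>K. ennreal (Re (gram_det \<psi> K k z))) \<longlonglongrightarrow> (SUP K. ennreal (Re (gram_det \<psi> K k z)))"
      by (intro LIMSEQ_SUP) (auto simp: incseq_def intro!: ennreal_leI Re_gram_det_mono)
    ultimately have "(SUP K. ennreal (Re (gram_det \<psi> K k z))) = ml_det \<rho> k z"
      using LIMSEQ_unique by blast
    moreover have "z \<in> PiE {..<k} (\<lambda>_. ball 0 t)"
      using True z by (auto simp: space_PiM PiE_def)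
    ultimately show ?thesis by simp
  next
    case False
    then obtain i where i: "i < k" "z i \<notin> ball 0 t" by auto
    then have "\<psi> n (z i) = 0" for n by (simp add: \<psi>_def)
    then have "gram_det \<psi> K k z = 0" for K
      unfolding gram_det_def det_mat_rows using i(1)
      by (intro sum.neutral) (auto intro!: prod_zero bexI[of _ i])
    moreover have "z \<notin> PiE {..<k} (\<lambda>_. ball 0 t)" using i by (auto simp: PiE_def Pi_def)
    ultimately show ?thesis by simp
  qed
  have "(\<integral>\<^sup>+z\<in>PiE {..<k} (\<lambda>_. ball 0 t). ml_det \<rho> k z \<partial>?M) = (\<integral>\<^sup>+z. (SUP K. ennreal (Re (gram_det \<psi> K k z))) \<partial>?M)"
    by (intro nn_integral_cong) (simp add: pointwise)
  also have "\<dots> = (SUP K. \<integral>\<^sup>+z. ennreal (Re (gram_det \<psi> K k z)) \<partial>?M)"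
    by (intro nn_integral_monotone_convergence_SUP inc) simp
  finally show ?thesis by (simp only: nn_integral_gram_det)
qed

section \<open>Factorial moments of a determinantal process\<close>

text \<open>Half-open dyadic squares of side \<open>1 / 2 ^ l\<close>, a partition of the plane at
  every level.\<close>

definition cell :: "nat \<Rightarrow> int \<times> int \<Rightarrow> complex set" where
  "cell l q = {z. \<lfloor>2 ^ l * Re z\<rfloor> = fst q \<and> \<lfloor>2 ^ l * Im z\<rfloor> = snd q}"

definition cell_index :: "nat \<Rightarrow> complex \<Rightarrow> int \<times> int" where
  "cell_index l z = (\<lfloor>2 ^ l * Re z\<rfloor>, \<lfloor>2 ^ l * Im z\<rfloor>)"

lemma in_cell_iff: "z \<in> cell l q \<longleftrightarrow> cell_index l z = q"
  by (auto simp: cell_def cell_index_def)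

lemma cell_sets [measurable]: "cell l q \<in> sets borel"
  unfolding cell_def by measurable

lemma cell_diameter:
  assumes "z \<in> cell l q" "w \<in> cell l q"
  shows "dist z w \<le> 2 / 2 ^ l"
proof -
  have *: "\<bar>x - y\<bar> \<le> 1 / 2 ^ l" if "\<lfloor>2 ^ l * x\<rfloor> = \<lfloor>2 ^ l * y\<rfloor>" for x y :: real
  proof -
    have "\<bar>2 ^ l * x - 2 ^ l * y\<bar> \<le> 1" using that by linarith
    then have "\<bar>2 ^ l * (x - y)\<bar> \<le> 1" by (simp add: right_diff_distrib)
    then have "2 ^ l * \<bar>x - y\<bar> \<le> 1" by (simp add: abs_mult)
    then show ?thesis by (simp add: field_simps)
  qed
  have "dist z w \<le> \<bar>Re (z - w)\<bar> + \<bar>Im (z - w)\<bar>" unfolding dist_norm by (rule cmod_le)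
  also have "\<dots> \<le> 1 / 2 ^ l + 1 / 2 ^ l"
    using assms by (intro add_mono) (simp_all add: cell_def *)
  finally show ?thesis by simp
qed

lemma finite_cell_index:
  assumes "bounded D"
  shows "finite (cell_index l ` D)"
proof -
  obtain R where R: "\<And>z. z \<in> D \<Longrightarrow> cmod z \<le> R" using assms by (auto simp: bounded_iff)
  define N where "N = \<lceil>2 ^ l * R\<rceil> + 1"
  have *: "- N \<le> \<lfloor>2 ^ l * x\<rfloor> \<and> \<lfloor>2 ^ l * x\<rfloor> \<le> N" if "\<bar>x\<bar> \<le> R" for x
  proof -
    have "\<bar>2 ^ l * x\<bar> \<le> 2 ^ l * R" using that by (simp add: abs_mult)
    then show ?thesis unfolding N_def by linarith
  qed
  have "cell_index l ` D \<subseteq> {- N..N} \<times> {- N..N}"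
  proof
    fix q assume "q \<in> cell_index l ` D"
    then obtain z where z: "z \<in> D" "q = cell_index l z" by auto
    have "\<bar>Re z\<bar> \<le> R" "\<bar>Im z\<bar> \<le> R"
      using R[OF z(1)] abs_Re_le_cmod[of z] abs_Im_le_cmod[of z] by linarith+
    then show "q \<in> {- N..N} \<times> {- N..N}" using * by (simp add: z(2) cell_index_def)
  qed
  then show ?thesis by (rule finite_subset) auto
qed

lemma eventually_cell_index_neq:
  assumes "z \<noteq> w"
  shows "eventually (\<lambda>l. cell_index l z \<noteq> cell_index l w) sequentially"
proof -
  have "(\<lambda>l. 2 / 2 ^ l :: real) \<longlonglongrightarrow> 0" by real_asymp
  then have "eventually (\<lambda>l. 2 / 2 ^ l < dist z w) sequentially"
    using assms by (intro order_tendstoD) auto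
  then show ?thesis
  proof eventually_elim
    case (elim l)
    then show ?case using cell_diameter[of z l "cell_index l w" w] by (auto simp: in_cell_iff)
  qed
qed

text \<open>If cells of mass above 1, hence at least 2, occurred at arbitrarily fine levels, points
  chosen in them would accumulate at some \<open>x\<close> by compactness. Every closed ball around
  \<open>x\<close> would then have mass at least 2, and so would \<open>{x}\<close> by continuity
  from above.\<close>

lemma eventually_cells_simple:
  assumes sets: "sets \<mu> = sets borel" and D: "D \<in> sets borel" "bounded D"
    and int: "\<And>B. B \<in> sets borel \<Longrightarrow> bounded B \<Longrightarrow> \<exists>n::nat. emeasure \<mu> B = of_nat n"
    and simple: "\<And>z. emeasure \<mu> {z} \<le> 1"
  shows "eventually (\<lambda>l. \<forall>q. emeasure \<mu> (D \<inter> cell l q) \<le> 1) sequentially"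
proof (rule ccontr)
  assume "\<not> ?thesis"
  then have "\<forall>L. \<exists>l\<ge>L. \<exists>q. \<not> emeasure \<mu> (D \<inter> cell l q) \<le> 1"
    by (auto simp: eventually_sequentially)
  then obtain l q where lq: "\<And>i. i \<le> l i" "\<And>i. \<not> emeasure \<mu> (D \<inter> cell (l i) (q i)) \<le> 1" by metis
  have "D \<inter> cell (l i) (q i) \<noteq> {}" for i using lq(2)[of i] by auto
  then have "\<forall>i. \<exists>w. w \<in> D \<inter> cell (l i) (q i)" by blast
  then obtain z where z: "\<And>i. z i \<in> D \<inter> cell (l i) (q i)" by metis
  have "compact (closure D)" using D(2) by (simp add: compact_closure)
  moreover have "\<forall>i. z i \<in> closure D" using z closure_subset by blast
  ultimately obtain x r where r: "strict_mono (r :: nat \<Rightarrow> nat)" "(z \<circ> r) \<longlonglongrightarrow> x"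
    unfolding compact_def by metis
  define A where "A n = D \<inter> cball x (1 / real (Suc n))" for n
  have A_sets: "A n \<in> sets borel" for n using D by (simp add: A_def)
  have A_bounded: "bounded (A n)" for n using D(2) by (auto simp: A_def intro: bounded_subset)
  have A_ge: "2 \<le> emeasure \<mu> (A n)" for n
  proof -
    have "(\<lambda>l. 2 / 2 ^ l :: real) \<longlonglongrightarrow> 0" by real_asymp
    then have "eventually (\<lambda>l. 2 / 2 ^ l < 1 / (2 * real (Suc n))) sequentially"
      by (intro order_tendstoD) auto
    then obtain L where L: "\<And>l. L \<le> l \<Longrightarrow> (2 :: real) / 2 ^ l < 1 / (2 * real (Suc n))"
      by (auto simp: eventually_sequentially)
    have "(\<lambda>i. z (r i)) \<longlonglongrightarrow> x" using r(2) by (simp only: comp_def)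
    then have "eventually (\<lambda>i. dist (z (r i)) x < 1 / (2 * real (Suc n))) sequentially"
      by (rule tendstoD) simp
    then obtain I where I: "\<And>i. I \<le> i \<Longrightarrow> dist (z (r i)) x < 1 / (2 * real (Suc n))"
      by (auto simp: eventually_sequentially)
    define i where "i = max I L"
    have "L \<le> l (r i)" using lq(1)[of "r i"] seq_suble[OF r(1), of i] by (simp add: i_def)
    have sub: "D \<inter> cell (l (r i)) (q (r i)) \<subseteq> A n"
    proof
      fix w assume w: "w \<in> D \<inter> cell (l (r i)) (q (r i))"
      have "dist (z (r i)) w \<le> 2 / 2 ^ l (r i)" using w z[of "r i"] by (intro cell_diameter) auto
      also have "\<dots> < 1 / (2 * real (Suc n))" by (rule L) fact
      finally have "dist (z (r i)) w < 1 / (2 * real (Suc n))" .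
      moreover have "dist (z (r i)) x < 1 / (2 * real (Suc n))" by (rule I) (simp add: i_def)
      ultimately have "dist x w \<le> 1 / (2 * real (Suc n)) + 1 / (2 * real (Suc n))"
        using dist_triangle3[of x w "z (r i)"] by linarith
      also have "\<dots> = 1 / real (Suc n)" by (simp add: field_simps)
      finally show "w \<in> A n" using w by (simp add: A_def)
    qed
    have gt: "1 < emeasure \<mu> (D \<inter> cell (l (r i)) (q (r i)))" using lq(2)[of "r i"] by simp
    also have "\<dots> \<le> emeasure \<mu> (A n)" using sub A_sets sets by (intro emeasure_mono) auto
    finally have "1 < emeasure \<mu> (A n)" .
    moreover obtain m where m: "emeasure \<mu> (A n) = of_nat m" using int[OF A_sets A_bounded] by blast
    ultimately have "2 \<le> m" by (metis Suc_1 Suc_leI of_nat_1 of_nat_less_iff)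
    then show ?thesis unfolding m by (metis of_nat_le_iff of_nat_numeral)
  qed
  have "(\<lambda>n. emeasure \<mu> (A n)) \<longlonglongrightarrow> emeasure \<mu> (\<Inter>n. A n)"
  proof (rule Lim_emeasure_decseq)
    show "range A \<subseteq> sets \<mu>" using A_sets sets by auto
    show "decseq A"
    proof (rule decseq_SucI)
      fix n
      have "1 / real (Suc (Suc n)) \<le> 1 / real (Suc n)" by (intro frac_le) auto
      then show "A (Suc n) \<le> A n" unfolding A_def by (intro Int_mono subset_cball order_refl)
    qed
    fix n obtain m where "emeasure \<mu> (A n) = of_nat m" using int[OF A_sets A_bounded] by blast
    then show "emeasure \<mu> (A n) \<noteq> \<infinity>" by simp
  qed
  then have "2 \<le> emeasure \<mu> (\<Inter>n. A n)"
    by (rule LIMSEQ_le_const) (use A_ge in blast)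
  also have "\<dots> \<le> emeasure \<mu> {x}"
  proof (rule emeasure_mono)
    show "(\<Inter>n. A n) \<subseteq> {x}"
    proof
      fix w assume "w \<in> (\<Inter>n. A n)"
      then have "dist x w \<le> 1 / real (Suc n)" for n by (auto simp: A_def)
      moreover have "(\<lambda>n. 1 / real (Suc n)) \<longlonglongrightarrow> 0" by real_asymp
      ultimately have "dist x w \<le> 0" by (intro LIMSEQ_le_const[of _ 0]) auto
      then show "w \<in> {x}" by simp
    qed
  qed (simp add: sets)
  also have "\<dots> \<le> 1" by (rule simple)
  finally show False by simp
qed

lemma lim_nn_integral_le_liminf:
  fixes u :: "nat \<Rightarrow> 'a \<Rightarrow> ennreal"
  assumes "\<And>i. u i \<in> borel_measurable M" "AE x in M. (\<lambda>i. u i x) \<longlonglongrightarrow> v x"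
  shows "(\<integral>\<^sup>+x. v x \<partial>M) \<le> liminf (\<lambda>i. \<integral>\<^sup>+x. u i x \<partial>M)"
proof -
  have "(\<integral>\<^sup>+x. v x \<partial>M) = (\<integral>\<^sup>+x. liminf (\<lambda>i. u i x) \<partial>M)"
    using assms(2) by (intro nn_integral_cong_AE) (auto elim!: eventually_mono simp: lim_imp_Liminf)
  also have "\<dots> \<le> liminf (\<lambda>i. \<integral>\<^sup>+x. u i x \<partial>M)" by (rule nn_integral_liminf) (rule assms(1))
  finally show ?thesis .
qed

text \<open>\<open>X l\<close> counts ordered \<open>k\<close>-tuples of points in distinct cells of
  level \<open>l\<close>, and \<open>W l\<close> is the indicator of such tuples, so the identity
  for disjoint sets can be summed over cells. Both \<open>X l\<close> and \<open>f * W l\<close> are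
  dominated by their limits, so Fatou's lemma gives both inequalities even if the integrals are
  infinite.\<close>

lemma nn_integral_choose_count:
  fixes M :: "'w measure" and \<Theta> :: "'w \<Rightarrow> complex measure" and N :: "'w \<Rightarrow> nat"
  assumes dpp: "determinantal_point_process M \<Theta> C"
    and D: "D \<in> sets borel" "bounded D" and k: "1 \<le> k"
    and N: "\<And>\<omega>. \<omega> \<in> space M \<Longrightarrow> emeasure (\<Theta> \<omega>) D = of_nat (N \<omega>)"
    and f_def: "f = (\<lambda>z. ennreal (Re (Determinant.det (mat k k (\<lambda>(i, j). C (z i) (z j))))))"
    and f: "f \<in> borel_measurable (PiM {..<k} (\<lambda>_. lborel))"
  shows "(\<integral>\<^sup>+\<omega>. of_nat (fact k * (N \<omega> choose k)) \<partial>M) =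
    (\<integral>\<^sup>+z\<in>PiE {..<k} (\<lambda>_. D). f z \<partial>PiM {..<k} (\<lambda>_. lborel))"
proof -
  let ?P = "PiM {..<k} (\<lambda>_. lborel :: complex measure)"
  have simple: "AE \<omega> in M. \<forall>z. emeasure (\<Theta> \<omega>) {z} \<le> 1"
    and pp: "point_process M \<Theta>"
    using dpp by (auto simp: determinantal_point_process_def simple_point_process_def)
  have sets: "sets (\<Theta> \<omega>) = sets borel" if "\<omega> \<in> space M" for \<omega>
    using pp that by (auto simp: point_process_def)
  have count_meas: "(\<lambda>\<omega>. emeasure (\<Theta> \<omega>) B) \<in> borel_measurable M" if "B \<in> sets borel" for B
    using pp that by (auto simp: point_process_def)
  have int: "\<exists>n::nat. emeasure (\<Theta> \<omega>) B = of_nat n" if "\<omega> \<in> space M" "B \<in> sets borel" "bounded B" for \<omega> B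
    using pp that by (auto simp: point_process_def)
  have moments: "(\<integral>\<^sup>+\<omega>. (\<Prod>j<k. emeasure (\<Theta> \<omega>) (B j)) \<partial>M) = (\<integral>\<^sup>+z\<in>PiE {..<k} B. f z \<partial>?P)"
    if "\<And>i. i < k \<Longrightarrow> B i \<in> sets borel" "disjoint_family_on B {..<k}" for B
    using dpp that k unfolding determinantal_point_process_def f_def by blast
  define I where "I l = cell_index l ` D" for l
  have fin: "finite (I l)" for l unfolding I_def by (rule finite_cell_index[OF D(2)])
  define J where "J l = {c. c \<in> PiE {..<k} (\<lambda>_. I l) \<and> inj_on c {..<k}}" for l
  have finJ: "finite (J l)" for l
    unfolding J_def by (rule finite_subset[OF _ finite_PiE[of "{..<k}" "\<lambda>_. I l"]]) (auto simp: fin)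
  define X where "X l \<omega> = (\<Sum>c\<in>J l. \<Prod>j<k. emeasure (\<Theta> \<omega>) (D \<inter> cell l (c j)))" for l \<omega>
  define W where "W l z = (\<Sum>c\<in>J l. indicator (PiE {..<k} (\<lambda>j. D \<inter> cell l (c j))) z :: ennreal)" for l z
  have Bs: "D \<inter> cell l q \<in> sets borel" for l q using D by simp
  have X_meas: "X l \<in> borel_measurable M" for l
    unfolding X_def[abs_def] by (intro borel_measurable_sum borel_measurable_prod_ennreal count_meas Bs)
  have box_meas: "PiE {..<k} B \<in> sets ?P" if "\<And>j. j < k \<Longrightarrow> B j \<in> sets borel" for B
    using that by (intro sets_PiM_I_finite) auto
  have W_meas: "W l \<in> borel_measurable ?P" for l
    unfolding W_def[abs_def] by (intro borel_measurable_sum borel_measurable_indicator box_meas Bs)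
  have EX: "(\<integral>\<^sup>+\<omega>. X l \<omega> \<partial>M) = (\<integral>\<^sup>+z. f z * W l z \<partial>?P)" for l
  proof -
    have "(\<integral>\<^sup>+\<omega>. X l \<omega> \<partial>M) = (\<Sum>c\<in>J l. \<integral>\<^sup>+\<omega>. (\<Prod>j<k. emeasure (\<Theta> \<omega>) (D \<inter> cell l (c j))) \<partial>M)"
      unfolding X_def by (intro nn_integral_sum borel_measurable_prod_ennreal count_meas Bs)
    also have "\<dots> = (\<Sum>c\<in>J l. \<integral>\<^sup>+z. f z * indicator (PiE {..<k} (\<lambda>j. D \<inter> cell l (c j))) z \<partial>?P)"
    proof (intro sum.cong refl moments Bs)
      fix c assume "c \<in> J l"
      then have "inj_on c {..<k}" by (simp add: J_def)
      then show "disjoint_family_on (\<lambda>j. D \<inter> cell l (c j)) {..<k}"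
        by (auto simp: disjoint_family_on_def inj_on_def in_cell_iff)
    qed
    also have "\<dots> = (\<integral>\<^sup>+z. (\<Sum>c\<in>J l. f z * indicator (PiE {..<k} (\<lambda>j. D \<inter> cell l (c j))) z) \<partial>?P)"
      using f by (intro nn_integral_sum[symmetric] borel_measurable_times_ennreal borel_measurable_indicator box_meas Bs)
    finally show ?thesis by (simp add: W_def sum_distrib_left)
  qed
  have X_eq: "X l \<omega> \<le> of_nat (fact k * (N \<omega> choose k)) \<and>
      ((\<forall>q. emeasure (\<Theta> \<omega>) (D \<inter> cell l q) \<le> 1) \<longrightarrow> X l \<omega> = of_nat (fact k * (N \<omega> choose k)))"
    if \<omega>: "\<omega> \<in> space M" for l \<omega>
  proof -
    have "\<forall>q. \<exists>n::nat. emeasure (\<Theta> \<omega>) (D \<inter> cell l q) = of_nat n"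
      using D(2) by (intro allI int[OF \<omega> Bs]) (auto intro: bounded_subset)
    then obtain n :: "int \<times> int \<Rightarrow> nat" where n: "\<And>q. emeasure (\<Theta> \<omega>) (D \<inter> cell l q) = of_nat (n q)" by metis
    have "of_nat (N \<omega>) = emeasure (\<Theta> \<omega>) (\<Union>q\<in>I l. D \<inter> cell l q)"
      unfolding N[OF \<omega>, symmetric] by (rule arg_cong[where f = "emeasure _"]) (auto simp: I_def in_cell_iff)
    also have "\<dots> = (\<Sum>q\<in>I l. emeasure (\<Theta> \<omega>) (D \<inter> cell l q))"
      using fin Bs sets[OF \<omega>]
      by (intro sum_emeasure[symmetric]) (auto simp: disjoint_family_on_def in_cell_iff)
    also have "\<dots> = of_nat (\<Sum>q\<in>I l. n q)" by (simp add: n)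
    finally have Nsum: "N \<omega> = (\<Sum>q\<in>I l. n q)" by (simp only: of_nat_eq_iff)
    have "X l \<omega> = of_nat (\<Sum>c\<in>J l. \<Prod>j<k. n (c j))"
      by (simp add: X_def n)
    also have "(\<Sum>c\<in>J l. \<Prod>j<k. n (c j)) = fact k * esym n (I l) k"
      unfolding J_def using sum_inj_PiE_eq_esym[where I = "I l" and k = k and w = n] fin by simp
    finally have Xn: "X l \<omega> = of_nat (fact k * esym n (I l) k)" .
    have "fact k * esym n (I l) k \<le> fact k * (N \<omega> choose k)"
      unfolding Nsum by (intro mult_left_mono esym_nat_le_choose fin) simp
    then have 1: "X l \<omega> \<le> of_nat (fact k * (N \<omega> choose k))"
      unfolding Xn by (simp only: of_nat_le_iff)
    have 2: "X l \<omega> = of_nat (fact k * (N \<omega> choose k))" if "\<forall>q. emeasure (\<Theta> \<omega>) (D \<inter> cell l q) \<le> 1"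
    proof -
      have "n q \<le> 1" for q using that[rule_format, of q] unfolding n by (metis of_nat_1 of_nat_le_iff)
      then have "esym n (I l) k = N \<omega> choose k" unfolding Nsum by (intro esym_nat_eq_choose fin)
      then show ?thesis unfolding Xn by simp
    qed
    from 1 2 show ?thesis by blast
  qed
  have X_lim: "AE \<omega> in M. (\<lambda>l. X l \<omega>) \<longlonglongrightarrow> of_nat (fact k * (N \<omega> choose k))"
    using simple
  proof (rule AE_mp, intro AE_I2 impI)
    fix \<omega> assume \<omega>: "\<omega> \<in> space M" and "\<forall>z. emeasure (\<Theta> \<omega>) {z} \<le> 1"
    then have "eventually (\<lambda>l. \<forall>q. emeasure (\<Theta> \<omega>) (D \<inter> cell l q) \<le> 1) sequentially"
      using int[OF \<omega>] by (intro eventually_cells_simple[OF sets[OF \<omega>] D]) auto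
    then have "eventually (\<lambda>l. X l \<omega> = of_nat (fact k * (N \<omega> choose k))) sequentially"
      by eventually_elim (use X_eq[OF \<omega>] in blast)
    then show "(\<lambda>l. X l \<omega>) \<longlonglongrightarrow> of_nat (fact k * (N \<omega> choose k))" by (rule tendsto_eventually)
  qed
  have W_eq: "W l z = (if z \<in> PiE {..<k} (\<lambda>_. D) \<and> inj_on (\<lambda>j. cell_index l (z j)) {..<k} then 1 else 0)" for l z
  proof (cases "z \<in> PiE {..<k} (\<lambda>_. D)")
    case False
    then have "z \<notin> PiE {..<k} (\<lambda>j. D \<inter> cell l (c j))" for c by (auto simp: PiE_def Pi_def)
    then show ?thesis using False by (simp add: W_def)
  next
    case True
    define c0 where "c0 = restrict (\<lambda>j. cell_index l (z j)) {..<k}"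
    have "z \<in> PiE {..<k} (\<lambda>j. D \<inter> cell l (c j)) \<longleftrightarrow> c = c0" if "c \<in> J l" for c
    proof -
      have "c \<in> extensional {..<k}" using that by (auto simp: J_def PiE_def)
      then have "c = c0 \<longleftrightarrow> (\<forall>j<k. cell_index l (z j) = c j)"
        by (auto simp: c0_def extensional_def fun_eq_iff restrict_def)
      moreover have "z \<in> PiE {..<k} (\<lambda>j. D \<inter> cell l (c j)) \<longleftrightarrow> (\<forall>j<k. cell_index l (z j) = c j)"
        using True by (auto simp: PiE_def Pi_def in_cell_iff)
      ultimately show ?thesis by simp
    qed
    then have "W l z = (\<Sum>c\<in>J l. if c = c0 then 1 else 0)"
      unfolding W_def by (intro sum.cong) (auto simp: indicator_def)
    also have "\<dots> = (if c0 \<in> J l then 1 else 0)" using finJ by simp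
    also have "c0 \<in> J l \<longleftrightarrow> inj_on (\<lambda>j. cell_index l (z j)) {..<k}"
      using True by (auto simp: J_def c0_def I_def PiE_def Pi_def inj_on_def)
    finally show ?thesis using True by simp
  qed
  \<comment> \<open>A tuple with a repeated point never has distinct cells, so \<open>W l\<close>
    stays 0 there; but the determinant then has two equal rows, and \<open>f\<close> vanishes as
    well.\<close>
  have W_lim: "(\<lambda>l. f z * W l z) \<longlonglongrightarrow> f z * indicator (PiE {..<k} (\<lambda>_. D)) z" for z
  proof (cases "inj_on z {..<k}")
    case True
    have "eventually (\<lambda>l. \<forall>i\<in>{..<k}. \<forall>j\<in>{..<k}. i \<noteq> j \<longrightarrow> cell_index l (z i) \<noteq> cell_index l (z j)) sequentially"
    proof (intro eventually_ball_finite ballI)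
      fix i j assume ij: "i \<in> {..<k}" "j \<in> {..<k}"
      show "eventually (\<lambda>l. i \<noteq> j \<longrightarrow> cell_index l (z i) \<noteq> cell_index l (z j)) sequentially"
      proof (cases "i = j")
        case False
        then have "z i \<noteq> z j" using True ij by (auto simp: inj_on_def)
        then show ?thesis by (rule eventually_mono[OF eventually_cell_index_neq]) simp
      qed simp
    qed auto
    then have "eventually (\<lambda>l. f z * W l z = f z * indicator (PiE {..<k} (\<lambda>_. D)) z) sequentially"
    proof eventually_elim
      case (elim l)
      then have "inj_on (\<lambda>j. cell_index l (z j)) {..<k}" by (auto simp: inj_on_def)
      then show ?case by (simp add: W_eq indicator_def)
    qed
    then show ?thesis by (rule tendsto_eventually)
  next
    case False
    then obtain i j where ij: "i < k" "j < k" "i \<noteq> j" "z i = z j" by (auto simp: inj_on_def)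
    have "Determinant.det (mat k k (\<lambda>(i, j). C (z i) (z j))) = 0"
      by (rule det_identical_rows[OF _ ij(3,1,2)]) (use ij in \<open>auto intro!: eq_vecI\<close>)
    then have "f z = 0" by (simp add: f_def)
    then show ?thesis by simp
  qed
  show ?thesis
  proof (rule antisym)
    have "(\<integral>\<^sup>+\<omega>. of_nat (fact k * (N \<omega> choose k)) \<partial>M) \<le> liminf (\<lambda>l. \<integral>\<^sup>+\<omega>. X l \<omega> \<partial>M)"
      by (rule lim_nn_integral_le_liminf[OF X_meas X_lim])
    also have "\<dots> \<le> liminf (\<lambda>l. \<integral>\<^sup>+z\<in>PiE {..<k} (\<lambda>_. D). f z \<partial>?P)"
      unfolding EX
      by (intro Liminf_mono always_eventually allI nn_integral_mono) (auto simp: W_eq indicator_def)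
    finally show "(\<integral>\<^sup>+\<omega>. of_nat (fact k * (N \<omega> choose k)) \<partial>M) \<le> (\<integral>\<^sup>+z\<in>PiE {..<k} (\<lambda>_. D). f z \<partial>?P)"
      by (simp add: Liminf_const)
    have "(\<integral>\<^sup>+z\<in>PiE {..<k} (\<lambda>_. D). f z \<partial>?P) \<le> liminf (\<lambda>l. \<integral>\<^sup>+z. f z * W l z \<partial>?P)"
      using f W_meas by (intro lim_nn_integral_le_liminf) (auto simp: W_lim)
    also have "\<dots> \<le> liminf (\<lambda>l. \<integral>\<^sup>+\<omega>. of_nat (fact k * (N \<omega> choose k)) \<partial>M)"
      unfolding EX[symmetric]
      by (intro Liminf_mono always_eventually allI nn_integral_mono) (use X_eq in blast)
    finally show "(\<integral>\<^sup>+z\<in>PiE {..<k} (\<lambda>_. D). f z \<partial>?P) \<le> (\<integral>\<^sup>+\<omega>. of_nat (fact k * (N \<omega> choose k)) \<partial>M)"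
      by (simp add: Liminf_const)
  qed
qed

section \<open>The law of the number of points in a disk\<close>

lemma summable_power_over_fact: "summable (\<lambda>k. (S :: real) ^ k / fact k)"
  using summable_exp[of S] by (simp add: divide_inverse mult.commute)

text \<open>The number of points has the law of a sum of independent indicators with success
  probabilities \<open>p n\<close>, because both have the same factorial moments, and these determine the
  probabilities by inclusion and exclusion.\<close>

lemma prob_eq_lim_bern:
  fixes N :: "'w \<Rightarrow> nat" and p :: "nat \<Rightarrow> real"
  assumes M: "prob_space M" and N [measurable]: "N \<in> M \<rightarrow>\<^sub>M count_space UNIV"
    and moments: "\<And>k. 1 \<le> k \<Longrightarrow>
      (\<integral>\<^sup>+\<omega>. of_nat (fact k * (N \<omega> choose k)) \<partial>M) = (SUP K. ennreal (fact k * esym p {..<K} k))"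
    and p: "\<And>n. 0 \<le> p n" and S: "\<And>K. (\<Sum>n<K. p n) \<le> S"
  shows "(\<lambda>K. bern p {..<K} m) \<longlonglongrightarrow> measure M {\<omega> \<in> space M. N \<omega> = m}"
proof -
  interpret prob_space M by (rule M)
  have S0: "0 \<le> S" using S[of 0] by simp
  have esym_nn: "0 \<le> esym p {..<K} k" for K k by (intro esym_nonneg p)
  have esym_le: "esym p {..<K} k \<le> S ^ k / fact k" for K k
  proof -
    have "esym p {..<K} k \<le> (\<Sum>n<K. p n) ^ k / fact k" by (intro esym_le_power p) simp
    also have "\<dots> \<le> S ^ k / fact k" using S p by (intro divide_right_mono power_mono sum_nonneg) auto
    finally show ?thesis .
  qed
  have inc: "incseq (\<lambda>K. esym p {..<K} k)" for k
    by (auto simp: incseq_def intro!: esym_mono_set p)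
  have "\<exists>L. (\<lambda>K. esym p {..<K} k) \<longlonglongrightarrow> L" for k
  proof -
    obtain L where "(\<lambda>K. esym p {..<K} k) \<longlonglongrightarrow> L"
      by (rule incseq_convergent[OF inc[of k], of "S ^ k / fact k"]) (simp_all add: esym_le)
    then show ?thesis ..
  qed
  \<comment> \<open>\<open>fact k * e k\<close> turns out to be the \<open>k\<close>-th factorial
    moment of \<open>N\<close>; the limit exists by monotonicity and boundedness.\<close>
  then obtain e where e: "\<And>k. (\<lambda>K. esym p {..<K} k) \<longlonglongrightarrow> e k" by metis
  have e_nn: "0 \<le> e k" for k by (rule LIMSEQ_le_const[OF e]) (use esym_nn in blast)
  have e_le: "e k \<le> S ^ k / fact k" for k by (rule LIMSEQ_le_const2[OF e]) (use esym_le in blast)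
  have choose_moment: "(\<integral>\<^sup>+\<omega>. ennreal (real (N \<omega> choose k)) \<partial>M) = ennreal (e k)" for k
  proof (cases "k = 0")
    case True
    have "(\<lambda>K. esym p {..<K} 0) \<longlonglongrightarrow> 1" by simp
    then have "e 0 = 1" using e[of 0] LIMSEQ_unique by blast
    then show ?thesis using True by (simp add: emeasure_space_1)
  next
    case False
    have "(\<lambda>K. ennreal (fact k * esym p {..<K} k)) \<longlonglongrightarrow> ennreal (fact k * e k)"
      by (intro tendsto_ennrealI tendsto_mult tendsto_const e)
    moreover have "(\<lambda>K. ennreal (fact k * esym p {..<K} k)) \<longlonglongrightarrow> (SUP K. ennreal (fact k * esym p {..<K} k))"
      using inc[of k] by (intro LIMSEQ_SUP) (auto simp: incseq_def intro!: ennreal_leI mult_left_mono)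
    ultimately have "(\<integral>\<^sup>+\<omega>. of_nat (fact k * (N \<omega> choose k)) \<partial>M) = ennreal (fact k * e k)"
      using moments[of k] False LIMSEQ_unique by force
    moreover have "ennreal (real (N \<omega> choose k)) = ennreal (1 / fact k) * of_nat (fact k * (N \<omega> choose k))" for \<omega>
    proof -
      have "ennreal (1 / fact k) * of_nat (fact k * (N \<omega> choose k)) = ennreal (1 / fact k * real (fact k * (N \<omega> choose k)))"
        unfolding ennreal_of_nat_eq_real_of_nat by (rule ennreal_mult[symmetric]) simp_all
      also have "1 / fact k * real (fact k * (N \<omega> choose k)) = real (N \<omega> choose k)" by simp
      finally show ?thesis ..
    qed
    ultimately have "(\<integral>\<^sup>+\<omega>. ennreal (real (N \<omega> choose k)) \<partial>M) = ennreal (1 / fact k) * ennreal (fact k * e k)"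
      by (simp add: nn_integral_cmult del: of_nat_mult)
    also have "\<dots> = ennreal (e k)" using e_nn by (simp add: ennreal_mult[symmetric])
    finally show ?thesis .
  qed
  have bochner: "has_bochner_integral M (\<lambda>\<omega>. real (N \<omega> choose k)) (e k)" for k
    by (rule has_bochner_integral_nn_integral) (use choose_moment e_nn in auto)
  let ?t = "\<lambda>k. (-1) ^ (k + m) * real (k choose m)"
  \<comment> \<open>With the bounds on \<open>e\<close> and \<open>esym\<close> this dominates the
    inversion series by \<open>(2 * S) ^ k / fact k\<close>, uniformly in \<open>K\<close>. It
    serves both the exchange of series and expectation and the limit in \<open>K\<close>.\<close>
  have t_le: "\<bar>?t k\<bar> \<le> 2 ^ k" for k
  proof -
    have "real (k choose m) \<le> real (2 ^ k)" by (simp only: of_nat_le_iff binomial_le_pow2)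
    then show ?thesis by (simp add: abs_mult)
  qed
  have "measure M {\<omega> \<in> space M. N \<omega> = m} = (\<integral>\<omega>. indicator {\<omega> \<in> space M. N \<omega> = m} \<omega> \<partial>M)"
    by (subst Bochner_Integration.integral_indicator) (auto simp: Int_absorb2)
  also have "\<dots> = (\<integral>\<omega>. (\<Sum>k. ?t k * real (N \<omega> choose k)) \<partial>M)"
  proof (rule Bochner_Integration.integral_cong[OF refl])
    fix \<omega> assume "\<omega> \<in> space M"
    have "(\<Sum>k. ?t k * real (N \<omega> choose k)) = (\<Sum>k\<le>N \<omega>. ?t k * real (N \<omega> choose k))"
      by (rule suminf_finite) auto
    then show "indicator {\<omega> \<in> space M. N \<omega> = m} \<omega> = (\<Sum>k. ?t k * real (N \<omega> choose k))"
      using sum_alternating_choose_choose[where N = "N \<omega>" and m = m] \<open>\<omega> \<in> space M\<close> by (simp add: indicator_def)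
  qed
  also have "\<dots> = (\<Sum>k. \<integral>\<omega>. ?t k * real (N \<omega> choose k) \<partial>M)"
  proof (rule integral_suminf)
    show "integrable M (\<lambda>\<omega>. ?t k * real (N \<omega> choose k))" for k
      using bochner[of k] by (intro integrable_mult_right) (rule integrable.intros)
    show "AE \<omega> in M. summable (\<lambda>k. norm (?t k * real (N \<omega> choose k)))"
    proof (rule AE_I2)
      fix \<omega> show "summable (\<lambda>k. norm (?t k * real (N \<omega> choose k)))"
        by (rule summable_finite[of "{..N \<omega>}"]) auto
    qed
    have "(\<integral>\<omega>. norm (?t k * real (N \<omega> choose k)) \<partial>M) = \<bar>?t k\<bar> * e k" for k
      using has_bochner_integral_integral_eq[OF bochner[of k]] by (simp add: abs_mult)
    moreover have "\<bar>?t k\<bar> * e k \<le> (2 * S) ^ k / fact k" for k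
      using mult_mono[OF t_le e_le _ e_nn, of k k] by (simp add: power_mult_distrib)
    ultimately show "summable (\<lambda>k. \<integral>\<omega>. norm (?t k * real (N \<omega> choose k)) \<partial>M)"
      using e_nn by (intro summable_comparison_test'[OF summable_power_over_fact[of "2 * S"], of 0]) simp
  qed
  also have "\<dots> = (\<Sum>k. ?t k * e k)"
    using has_bochner_integral_integral_eq[OF bochner] by simp
  finally have prob_eq: "measure M {\<omega> \<in> space M. N \<omega> = m} = (\<Sum>k. ?t k * e k)" .
  have bern_eq: "bern p {..<K} m = (\<Sum>k. ?t k * esym p {..<K} k)" for K
  proof -
    have "(\<Sum>k. ?t k * esym p {..<K} k) = (\<Sum>k\<le>K. ?t k * esym p {..<K} k)"
      by (rule suminf_finite) (auto simp: esym_eq_0)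
    then show ?thesis using bern_eq_alternating_sum[of "{..<K}" K p m] by simp
  qed
  have "(\<lambda>K. \<Sum>k. ?t k * esym p {..<K} k) \<longlonglongrightarrow> (\<Sum>k. ?t k * e k)"
  proof (rule tannerys_theorem[THEN conjunct2, THEN conjunct2])
    show "(\<lambda>K. ?t k * esym p {..<K} k) \<longlonglongrightarrow> ?t k * e k" for k
      by (intro tendsto_mult tendsto_const e)
    have "norm (?t k * esym p {..<K} k) \<le> (2 * S) ^ k / fact k" for k K
      using mult_mono[OF t_le esym_le _ esym_nn, of k K k] esym_nn[of K k] by (simp add: abs_mult power_mult_distrib)
    then show "\<forall>\<^sub>F (k, K) in at_top \<times>\<^sub>F sequentially. norm (?t k * esym p {..<K} k) \<le> (2 * S) ^ k / fact k"
      by (intro always_eventually) auto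
  qed (rule summable_power_over_fact, simp)
  then show ?thesis by (simp only: bern_eq prob_eq)
qed

lemma count_prob_eq_lim_bern:
  assumes \<rho>: "0 < \<rho>" and dpp: "determinantal_point_process M \<Theta> (mittag_leffler_kernel \<rho>)" and t: "1 \<le> t powr \<rho>" "0 < t"
  shows "(\<lambda>K. bern (\<lambda>n. gamma_cdf (2 / \<rho> * (real n + 1)) (t powr \<rho>)) {..<K} m) \<longlonglongrightarrow>
    measure M {\<omega> \<in> space M. emeasure (\<Theta> \<omega>) (ball 0 t) = of_nat m}"
proof -
  define p where "p n = gamma_cdf (2 / \<rho> * (real n + 1)) (t powr \<rho>)" for n
  define x where "x = t powr \<rho>"
  have a: "0 < 2 / \<rho>" using \<rho> by simp
  have x: "1 \<le> x" using t by (simp add: x_def)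
  have p: "0 < p n" "p n < 1" for n
    unfolding p_def using a t by (auto intro!: gamma_cdf_pos gamma_cdf_less_1 mult_pos_pos)
  obtain C where C: "0 \<le> C" "\<And>x K M. 1 \<le> x \<Longrightarrow> 0 < M \<Longrightarrow>
      (\<Sum>n=M..<K. gamma_cdf (2 / \<rho> * real (n + 1)) x / gamma_cdf (2 / \<rho> * real M) x) \<le> C * x"
    by (rule gamma_cdf_sum_le[OF a]) blast
  \<comment> \<open>\<open>gamma_cdf_sum_le\<close> starts at a positive index, so the index 0 is
    split off; dividing the other terms by \<open>p 0\<close> enlarges them.\<close>
  have S: "(\<Sum>n<K. p n) \<le> 1 + C * x" for K
  proof -
    have "(\<Sum>n<K. p n) \<le> p 0 + (\<Sum>n=1..<K. p n)"
    proof (cases K)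
      case (Suc n)
      then have "{..<K} = insert 0 {1..<K}" by auto
      then show ?thesis by simp
    qed (use p in \<open>simp add: less_imp_le\<close>)
    also have "(\<Sum>n=1..<K. p n) \<le> (\<Sum>n=1..<K. p n / p 0)"
      using p by (intro sum_mono) (auto simp: le_divide_eq less_imp_le mult_le_cancel_left1)
    also have "\<dots> \<le> C * x"
      using C(2)[OF x, of 1 K] by (simp add: p_def x_def add.commute)
    finally show ?thesis using p(2)[of 0] by linarith
  qed
  have pp: "point_process M \<Theta>"
    using dpp by (auto simp: determinantal_point_process_def simple_point_process_def)
  have ps: "prob_space M" using pp by (simp add: point_process_def)
  have D: "ball (0 :: complex) t \<in> sets borel" "bounded (ball (0 :: complex) t)" by auto
  \<comment> \<open>A natural-valued and measurable version of the count, which agrees with the mass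
    of the disk on \<open>space M\<close>.\<close>
  define N where "N \<omega> = nat \<lfloor>enn2real (emeasure (\<Theta> \<omega>) (ball 0 t))\<rfloor>" for \<omega>
  have N: "emeasure (\<Theta> \<omega>) (ball 0 t) = of_nat (N \<omega>)" if "\<omega> \<in> space M" for \<omega>
  proof -
    have "\<forall>\<omega>\<in>space M. \<forall>B\<in>sets borel. bounded B \<longrightarrow> (\<exists>n::nat. emeasure (\<Theta> \<omega>) B = of_nat n)"
      using pp unfolding point_process_def by (elim conjE)
    from this[rule_format, OF that D] obtain n :: nat where n: "emeasure (\<Theta> \<omega>) (ball 0 t) = of_nat n" ..
    have "N \<omega> = n" unfolding N_def n ennreal_of_nat_eq_real_of_nat by simp
    then show ?thesis using n by simp
  qed
  have N_meas: "N \<in> M \<rightarrow>\<^sub>M count_space UNIV"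
  proof -
    have [measurable]: "(\<lambda>\<omega>. emeasure (\<Theta> \<omega>) (ball 0 t)) \<in> borel_measurable M"
    proof -
      have "\<forall>B\<in>sets borel. (\<lambda>\<omega>. emeasure (\<Theta> \<omega>) B) \<in> borel_measurable M"
        using pp unfolding point_process_def by (elim conjE)
      then show ?thesis using D(1) by blast
    qed
    show ?thesis unfolding N_def[abs_def] by measurable
  qed
  have "(\<lambda>K. bern p {..<K} m) \<longlonglongrightarrow> measure M {\<omega> \<in> space M. N \<omega> = m}"
  proof (rule prob_eq_lim_bern[OF ps N_meas _ less_imp_le[OF p(1)] S])
    fix k :: nat assume k: "1 \<le> k"
    have "(\<integral>\<^sup>+\<omega>. of_nat (fact k * (N \<omega> choose k)) \<partial>M) =
        (\<integral>\<^sup>+z\<in>PiE {..<k} (\<lambda>_. ball 0 t). ml_det \<rho> k z \<partial>PiM {..<k} (\<lambda>_. lborel))"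
      by (rule nn_integral_choose_count[OF dpp D k N refl ml_det_measurable])
    also have "\<dots> = (SUP K. ennreal (fact k * esym p {..<K} k))"
      unfolding p_def[abs_def] by (rule nn_integral_ml_det[OF \<rho> t(2)])
    finally show "(\<integral>\<^sup>+\<omega>. of_nat (fact k * (N \<omega> choose k)) \<partial>M) = (SUP K. ennreal (fact k * esym p {..<K} k))" .
  qed
  moreover have "{\<omega> \<in> space M. N \<omega> = m} = {\<omega> \<in> space M. emeasure (\<Theta> \<omega>) (ball 0 t) = of_nat m}"
    using N by (auto simp: of_nat_eq_iff)
  ultimately show ?thesis by (simp add: p_def[abs_def])
qed

text \<open>The lower bound \<open>exp (- (A + E))\<close> survives the limit, so \<open>q\<close>
  is positive. This is the crux, since \<open>ln\<close> is continuous only away from 0 and its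
  default value at 0 must not enter.\<close>

lemma abs_neg_ln_lim_le:
  fixes f :: "nat \<Rightarrow> real"
  assumes lim: "f \<longlonglongrightarrow> q" and ev: "\<And>K. K0 \<le> K \<Longrightarrow> 0 < f K \<and> \<bar>- ln (f K) - A\<bar> \<le> E"
  shows "\<bar>- ln q - A\<bar> \<le> E"
proof -
  have "exp (- (A + E)) \<le> f K" if "K0 \<le> K" for K
  proof -
    have "- (A + E) \<le> ln (f K)" using ev[OF that] by linarith
    then have "exp (- (A + E)) \<le> exp (ln (f K))" by simp
    then show ?thesis using ev[OF that] by simp
  qed
  then have "exp (- (A + E)) \<le> q" by (intro LIMSEQ_le_const[OF lim]) blast
  then have "q \<noteq> 0" using exp_gt_zero[of "- (A + E)"] by linarith
  then have "(\<lambda>K. \<bar>- ln (f K) - A\<bar>) \<longlonglongrightarrow> \<bar>- ln q - A\<bar>"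
    by (intro tendsto_rabs tendsto_diff tendsto_minus tendsto_ln lim tendsto_const)
  then show ?thesis by (rule LIMSEQ_le_const2) (use ev in blast)
qed

theorem mainTheorem6:
  fixes M :: "'w measure" and \<Theta> :: "'w \<Rightarrow> complex measure" and \<rho> b :: real
  assumes "\<rho> > 0"
    and "determinantal_point_process M \<Theta> (mittag_leffler_kernel \<rho>)"
    and "b > 0" and "b \<noteq> 1"
  shows "(\<lambda>t::real.
            - ln (measure M {\<omega> \<in> space M.
                    emeasure (\<Theta> \<omega>) (ball 0 t) = of_nat (nat \<lfloor>b * (\<rho> / 2) * t powr \<rho>\<rfloor>)})
            - (\<rho> / 8 * \<bar>2 * b\<^sup>2 * ln b - (b - 1) * (3 * b - 1)\<bar> * t powr (2 * \<rho>)
               + \<bar>b - 1\<bar> * \<rho>\<^sup>2 / 4 * t powr \<rho> * ln t))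
         \<in> O[at_top](\<lambda>t. t powr \<rho>)"
proof -
  have a: "0 < 2 / \<rho>" using assms by simp
  obtain C X where CX: "\<And>x. X \<le> x \<Longrightarrow> \<exists>K0. \<forall>K\<ge>K0.
    0 < bern (\<lambda>n. gamma_cdf (2 / \<rho> * (real n + 1)) x) {..<K} (nat \<lfloor>b * x / (2 / \<rho>)\<rfloor>) \<and>
    \<bar>- ln (bern (\<lambda>n. gamma_cdf (2 / \<rho> * (real n + 1)) x) {..<K} (nat \<lfloor>b * x / (2 / \<rho>)\<rfloor>)) -
      (x\<^sup>2 / (2 / \<rho>) * (\<bar>2 * b\<^sup>2 * ln b - (b - 1) * (3 * b - 1)\<bar> / 4) + \<bar>b - 1\<bar> / (2 * (2 / \<rho>)) * x * ln x)\<bar> \<le> C * x"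
    by (rule bern_gamma_cdf_asymptotics[OF a assms(3,4)]) blast
  have at_top: "filterlim (\<lambda>t. t powr \<rho>) at_top at_top"
    using assms(1) by real_asymp
  have "eventually (\<lambda>t::real. max 1 X \<le> t powr \<rho> \<and> 1 \<le> t) at_top"
    by (intro eventually_conj eventually_ge_at_top at_top[unfolded filterlim_at_top, rule_format])
  then show ?thesis
  proof (intro bigoI[where c = C], eventually_elim)
    case (elim t)
    define x where "x = t powr \<rho>"
    have x: "X \<le> x" "1 \<le> x" and t: "0 < t" using elim by (auto simp: x_def)
    let ?q = "measure M {\<omega> \<in> space M. emeasure (\<Theta> \<omega>) (ball 0 t) = of_nat (nat \<lfloor>b * (\<rho> / 2) * t powr \<rho>\<rfloor>)}"
    let ?A = "x\<^sup>2 / (2 / \<rho>) * (\<bar>2 * b\<^sup>2 * ln b - (b - 1) * (3 * b - 1)\<bar> / 4) + \<bar>b - 1\<bar> / (2 * (2 / \<rho>)) * x * ln x"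
    have m: "b * x / (2 / \<rho>) = b * (\<rho> / 2) * t powr \<rho>" by (simp add: x_def)
    obtain K0 where K0: "\<And>K. K0 \<le> K \<Longrightarrow>
      0 < bern (\<lambda>n. gamma_cdf (2 / \<rho> * (real n + 1)) x) {..<K} (nat \<lfloor>b * x / (2 / \<rho>)\<rfloor>) \<and>
      \<bar>- ln (bern (\<lambda>n. gamma_cdf (2 / \<rho> * (real n + 1)) x) {..<K} (nat \<lfloor>b * x / (2 / \<rho>)\<rfloor>)) - ?A\<bar> \<le> C * x"
      using CX[OF x(1)] by blast
    have "\<bar>- ln ?q - ?A\<bar> \<le> C * x"
    proof (rule abs_neg_ln_lim_le[OF _ K0])
      show "(\<lambda>K. bern (\<lambda>n. gamma_cdf (2 / \<rho> * (real n + 1)) x) {..<K} (nat \<lfloor>b * x / (2 / \<rho>)\<rfloor>)) \<longlonglongrightarrow> ?q"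
        unfolding m using count_prob_eq_lim_bern[OF assms(1,2) _ t] x(2) unfolding x_def .
    qed
    \<comment> \<open>With \<open>a = 2 / \<rho>\<close> and \<open>ln x = \<rho> * ln t\<close>,
      the coefficient \<open>\<bar>b - 1\<bar> / (2 * a)\<close> turns into
      \<open>\<bar>b - 1\<bar> * \<rho>\<^sup>2 / 4\<close>.\<close>
    moreover have "?A = \<rho> / 8 * \<bar>2 * b\<^sup>2 * ln b - (b - 1) * (3 * b - 1)\<bar> * t powr (2 * \<rho>)
               + \<bar>b - 1\<bar> * \<rho>\<^sup>2 / 4 * t powr \<rho> * ln t"
    proof -
      have "x\<^sup>2 = t powr (2 * \<rho>)" using t by (simp add: x_def powr_power mult.commute)
      moreover have "ln x = \<rho> * ln t" by (simp add: x_def)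
      ultimately show ?thesis by (simp add: x_def power2_eq_square mult_ac)
    qed
    ultimately show ?case using x(2) by (simp add: x_def)
  qed
qed

end
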